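(* Let $\nu>-1/2$, $p_0=\frac{4(\nu+1)}{2\nu+3+2\delta}$ and $p_1=\frac{4(\nu+1)}{2\nu+1-2\delta}$. If $0<\delta<\nu+1/2$, there is $C>0$ such that for all sufficiently large $R$, $$\sup_{\|f\|_{L^{p_1}((0,1),d\mu_\nu)}=1}\|\mathcal{B}_R^\delta f\|_{L^{p_1,\infty}((0,1),d\mu_\nu)}\ge C(\log R)^{1/p_0};$$ and if $\delta=\nu+1/2$, there is $C>0$ such that for all sufficiently large $R$, $$\sup_{\|f\|_{L^{\infty}((0,1),d\mu_\nu)}=1}\|\mathcal{B}_R^\delta f\|_{L^{\infty}((0,1),d\mu_\nu)}\ge C\log R.$$
   Context: Let $J_\nu$ be the Bessel function of order $\nu$, $0<s_1<s_2<\dots$ its successive positive zeros, $d\mu_\nu(x)=x^{2\nu+1}dx$ on $(0,1)$, $\psi_j(x)=\frac{\sqrt2}{|J_{\nu+1}(s_j)|}x^{-\nu}J_\nu(s_jx)$, $a_j(f)=\int_0^1 f\psi_j\,d\mu_\nu$. For $\delta>0$, $R>0$, $\mathcal{B}_R^\delta f(x)=\sum_{j\ge1}(1-s_j^2/R^2)_+^\delta a_j(f)\psi_j(x)$ with $(1-s^2)_+=\max\{1-s^2,0\}$. $\|g\|_{L^{q,\infty}((0,1),d\mu_\nu)}=\sup_{\lambda>0}\lambda\,\mu_\nu(\{|g|>\lambda\})^{1/q}$. *)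

theory Defs
  imports "HOL-Analysis.Analysis" "HOL-Probability.Essential_Supremum"
begin

text \<open>Bessel function of the first kind of (real) order nu, for x > 0, by its power series.\<close>
definition besselJ :: "real \<Rightarrow> real \<Rightarrow> real" where
  "besselJ nu x = (\<Sum>m. (-1) ^ m / (fact m * Gamma (real m + nu + 1)) * (x / 2) powr (2 * real m + nu))"

text \<open>Successive positive zeros of J_nu, indexed from 0: bessel_zero nu 0 = s_1 < bessel_zero nu 1 = s_2 < ...\<close>
definition bessel_zero :: "real \<Rightarrow> nat \<Rightarrow> real" where
  "bessel_zero nu = (THE s. strict_mono s \<and> range s = {x. 0 < x \<and> besselJ nu x = 0})"

definition mu :: "real \<Rightarrow> real measure" where
  "mu nu = density lborel (\<lambda>x. indicator {0<..<1} x * ennreal (x powr (2 * nu + 1)))"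

definition psi :: "real \<Rightarrow> nat \<Rightarrow> real \<Rightarrow> real" where
  "psi nu j x = sqrt 2 / \<bar>besselJ (nu + 1) (bessel_zero nu j)\<bar> * x powr (- nu)
                * besselJ nu (bessel_zero nu j * x)"

definition coef :: "real \<Rightarrow> (real \<Rightarrow> real) \<Rightarrow> nat \<Rightarrow> real" where
  "coef nu f j = (\<integral>x. f x * psi nu j x \<partial>mu nu)"

definition bochner_riesz :: "real \<Rightarrow> real \<Rightarrow> real \<Rightarrow> (real \<Rightarrow> real) \<Rightarrow> real \<Rightarrow> real" where
  "bochner_riesz nu delta R f x =
     (\<Sum>j. (max 0 (1 - (bessel_zero nu j)\<^sup>2 / R\<^sup>2)) powr delta * coef nu f j * psi nu j x)"

definition Lp_norm :: "real measure \<Rightarrow> real \<Rightarrow> (real \<Rightarrow> real) \<Rightarrow> real" where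
  "Lp_norm M p f = (\<integral>x. \<bar>f x\<bar> powr p \<partial>M) powr (1 / p)"

definition weak_Lq_norm :: "real measure \<Rightarrow> real \<Rightarrow> (real \<Rightarrow> real) \<Rightarrow> ereal" where
  "weak_Lq_norm M q g =
     (SUP lam\<in>{0<..}. ereal (lam * measure M {x \<in> space M. \<bar>g x\<bar> > lam} powr (1 / q)))"

definition Linf_norm :: "real measure \<Rightarrow> (real \<Rightarrow> real) \<Rightarrow> ereal" where
  "Linf_norm M f = esssup M (\<lambda>x. ereal \<bar>f x\<bar>)"

end

theory Submission
  imports Defs "HOL-Probability.Characteristic_Functions"
begin

text \<open>
  The extremal function is \<open>f(y) = y^(delta - nu - 1/2) (1 - y)^(b - 1) cos (R y + phi)\<close>, cut off at
  \<open>y = 1/R\<close>. Its \<open>p1\<close>-th power has integral at most \<open>ln R\<close>, while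
  \<open>B_R f \<ge> c R^(nu + 1/2 - delta) ln R\<close> on \<open>(0, c0/R)\<close>; comparing the two gives the theorem.

  Poisson's integral writes the coefficient of \<open>f\<close> at a zero \<open>s\<close> as an average of the values
  \<open>G(R - s t)\<close>, \<open>-1 \<le> t \<le> 1\<close>, where \<open>G\<close> is the phase-shifted Fourier transform of the Beta weight
  \<open>y^(a - 1) (1 - y)^(b - 1)\<close>, \<open>a = delta + nu + 3/2\<close>. For suitable \<open>phi\<close> and large \<open>b\<close> one has
  \<open>G(w) \<ge> c w^(-a)\<close> for \<open>w \<ge> A\<close>. Hence no coefficient with \<open>s \<le> R - A\<close> contributes negatively,
  those with \<open>R/2 < s \<le> R - A\<close> contribute at least a multiple of \<open>R^(nu + 1/2 - delta) / (R - s)\<close>,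
  and the remaining terms and the cut-off only cost \<open>O(R^(nu + 1/2 - delta))\<close>. About the zeros only
  the following is needed: their gaps are bounded above and below, and \<open>J_(nu+1)(s)^2\<close> is
  comparable with \<open>1/s\<close>. Both follow from the equation \<open>u'' = - (1 - (nu^2 - 1/4) / x^2) u\<close> of
  \<open>u = x^(1/2) J_nu(x)\<close> via the energy \<open>u^2 + u'^2\<close> and Sturm comparison.
\<close>

section \<open>The Bessel series\<close>

text \<open>The power of y in the test function is critical: against the density of
  \<open>mu\<close> its p1-th power becomes 1/y. The norm is thus O((ln R)^(1/p1)), and since 1 -
  1/p1 = 1/p0 a factor (ln R)^(1/p0) survives the normalisation. Nothing is lost by looking only at
  (0, c0/R): with E = nu + 1/2 - delta one has E * p1 = 2 nu + 2, so R^E on that interval has weak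
  norm of order 1. The factor cos (R y + phi) moves the singular frequency to the edge s = R of the
  multiplier, and the logarithm is the harmonic sum of 1/(R - s) over zeros with bounded gaps. The
  obstacle is cancellation in that sum. It is met by a sign argument instead of asymptotics of J_nu:
  Poisson's integral samples G only at arguments that stay above A once s <= R - A. This is also why
  (1 - y)^(b - 1) is present: the endpoint y = 1 adds to G an oscillation of order w^(-b), which has
  to be negligible against w^(-a).\<close>

definition bessel_coeff :: "real \<Rightarrow> nat \<Rightarrow> real" where
  "bessel_coeff nu m = (-1) ^ m / (fact m * Gamma (real m + nu + 1))"

text \<open>With z = x^2/4 and x > 0 this is (x/2)^(-nu) J_nu(x). Removing the non-integer power
  leaves a series that converges everywhere, so that termwise differentiation applies and the value
  at 0 makes sense.\<close>

definition bessel_entire :: "real \<Rightarrow> real \<Rightarrow> real" where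
  "bessel_entire nu z = (\<Sum>m. bessel_coeff nu m * z ^ m)"

lemma bessel_coeff_Suc:
  assumes "nu > -1/2"
  shows "bessel_coeff nu (Suc m) = - bessel_coeff nu m / ((real m + 1) * (real m + nu + 1))"
proof -
  have "Gamma (real (Suc m) + nu + 1) = Gamma ((real m + nu + 1) + 1)"
    by (simp add: algebra_simps)
  also have "\<dots> = (real m + nu + 1) * Gamma (real m + nu + 1)"
    using assms by (intro Gamma_plus1) (auto elim!: nonpos_Ints_cases)
  finally show ?thesis by (simp add: bessel_coeff_def field_simps)
qed

lemma summable_bessel_entire:
  assumes "nu > -1/2"
  shows "summable (\<lambda>m. bessel_coeff nu m * z ^ m)"
proof (rule summable_ratio_test[where c = "1/2" and N = "nat \<lceil>4 * \<bar>z\<bar>\<rceil>"])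
  fix n assume "nat \<lceil>4 * \<bar>z\<bar>\<rceil> \<le> n"
  then have n: "4 * \<bar>z\<bar> \<le> real n" by linarith
  have pos: "(real n + 1) * (real n + nu + 1) > 0" using assms by (intro mult_pos_pos) auto
  have "2 * \<bar>z\<bar> \<le> (real n + 1) * (1/2)" using n by simp
  also have "\<dots> \<le> (real n + 1) * (real n + nu + 1)"
    using assms by (intro mult_left_mono) auto
  finally have "\<bar>z\<bar> / ((real n + 1) * (real n + nu + 1)) \<le> 1/2"
    using pos by (simp add: pos_divide_le_eq)
  then have "norm (bessel_coeff nu n * z ^ n) * (\<bar>z\<bar> / ((real n + 1) * (real n + nu + 1)))
      \<le> norm (bessel_coeff nu n * z ^ n) * (1/2)"
    by (intro mult_left_mono) auto
  then show "norm (bessel_coeff nu (Suc n) * z ^ Suc n) \<le> 1/2 * norm (bessel_coeff nu n * z ^ n)"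
    using pos by (simp add: bessel_coeff_Suc[OF assms] abs_mult field_simps)
qed simp

lemma diffs_bessel_coeff: "diffs (bessel_coeff nu) = (\<lambda>m. - bessel_coeff (nu + 1) m)"
proof
  fix m
  have e: "real m + (nu + 1) + 1 = real (Suc m) + nu + 1" by simp
  show "diffs (bessel_coeff nu) m = - bessel_coeff (nu + 1) m"
    unfolding diffs_def bessel_coeff_def fact_Suc e by (simp del: of_nat_Suc)
qed

lemma bessel_entire_deriv:
  assumes "nu > -1/2"
  shows "(bessel_entire nu has_real_derivative - bessel_entire (nu + 1) z) (at z)"
proof -
  have "((\<lambda>x. \<Sum>m. bessel_coeff nu m * x ^ m) has_real_derivative
          (\<Sum>m. diffs (bessel_coeff nu) m * z ^ m)) (at z)"
    by (rule termdiffs_strong_converges_everywhere) (rule summable_bessel_entire[OF assms])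
  moreover have "(\<Sum>m. diffs (bessel_coeff nu) m * z ^ m) = - bessel_entire (nu + 1) z"
    unfolding diffs_bessel_coeff bessel_entire_def
    using summable_bessel_entire[of "nu + 1" z] assms by (simp add: suminf_minus)
  ultimately show ?thesis by (simp add: bessel_entire_def[abs_def])
qed

text \<open>This is J_nu + J_(nu+2) = (2 (nu + 1)/x) J_(nu+1) without the powers of x.
  Coefficientwise it says (m + nu + 1) - m = nu + 1. Together with
  \<open>bessel_entire_deriv\<close> it stands in for Bessel's differential equation.\<close>

lemma bessel_entire_recurrence:
  assumes "nu > -1/2"
  shows "bessel_entire nu z + z * bessel_entire (nu + 2) z = (nu + 1) * bessel_entire (nu + 1) z"
proof -
  have "(\<lambda>m. bessel_coeff (nu + 2) m * z ^ m) sums bessel_entire (nu + 2) z"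
    unfolding bessel_entire_def using assms by (intro summable_sums summable_bessel_entire) auto
  then have "(\<lambda>m. z * (bessel_coeff (nu + 2) m * z ^ m)) sums (z * bessel_entire (nu + 2) z)"
    by (rule sums_mult)
  then have "(\<lambda>m. bessel_coeff (nu + 2) m * z ^ Suc m) sums (z * bessel_entire (nu + 2) z)"
    by (simp add: algebra_simps)
  then have 2: "(\<lambda>m. case m of 0 \<Rightarrow> 0 | Suc k \<Rightarrow> bessel_coeff (nu + 2) k * z ^ Suc k) sums (z * bessel_entire (nu + 2) z)"
    using sums_Suc[of "\<lambda>m. case m of 0 \<Rightarrow> 0 | Suc k \<Rightarrow> bessel_coeff (nu + 2) k * z ^ Suc k"] by simp
  have 0: "(\<lambda>m. bessel_coeff nu m * z ^ m) sums bessel_entire nu z"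
    unfolding bessel_entire_def using assms by (intro summable_sums summable_bessel_entire)
  have 1: "(\<lambda>m. (nu + 1) * (bessel_coeff (nu + 1) m * z ^ m)) sums ((nu + 1) * bessel_entire (nu + 1) z)"
    unfolding bessel_entire_def using assms by (intro sums_mult summable_sums summable_bessel_entire) auto
  have G: "Gamma (real m + nu + 1 + 1) = (real m + nu + 1) * Gamma (real m + nu + 1)" for m
    using assms by (intro Gamma_plus1) (auto elim!: nonpos_Ints_cases)
  have "bessel_coeff nu m * z ^ m + (case m of 0 \<Rightarrow> 0 | Suc k \<Rightarrow> bessel_coeff (nu + 2) k * z ^ Suc k)
      = (nu + 1) * (bessel_coeff (nu + 1) m * z ^ m)" for m
  proof (cases m)
    case 0
    have "Gamma (nu + 1) > 0" using assms by (intro Gamma_real_pos) auto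
    then show ?thesis using 0 G[of 0] assms by (simp add: bessel_coeff_def add_ac)
  next
    case (Suc k)
    have pos: "Gamma (real m + nu + 1) > 0" "real m + nu + 1 > 0"
      using assms by (auto intro!: Gamma_real_pos)
    have e1: "bessel_coeff nu m = (real m + nu + 1) * ((-1) ^ m / (fact m * Gamma (real m + nu + 2)))"
      using G[of m] pos by (simp add: bessel_coeff_def add_ac)
    have e2: "bessel_coeff (nu + 2) k = - real m * ((-1) ^ m / (fact m * Gamma (real m + nu + 2)))"
    proof -
      have g: "real k + (nu + 2) + 1 = real m + nu + 2" and h: "(-1::real) ^ k = - ((-1) ^ m)"
        "(fact m :: real) = real m * fact k" "real m \<noteq> 0"
        using Suc by (simp_all add: fact_Suc del: of_nat_Suc)
      show ?thesis unfolding bessel_coeff_def g using h by simp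
    qed
    have e3: "bessel_coeff (nu + 1) m = (-1) ^ m / (fact m * Gamma (real m + nu + 2))"
      by (simp add: bessel_coeff_def add_ac)
    have "(case m of 0 \<Rightarrow> 0 | Suc k \<Rightarrow> bessel_coeff (nu + 2) k * z ^ Suc k) = bessel_coeff (nu + 2) k * z ^ m"
      using Suc by simp
    moreover have "(real m + nu + 1) * X * Y + - real m * X * Y = (nu + 1) * (X * Y)" for X Y :: real
      by (simp add: algebra_simps)
    ultimately show ?thesis unfolding e1 e3 e2 by (simp only:)
  qed
  then have "(\<lambda>m. (nu + 1) * (bessel_coeff (nu + 1) m * z ^ m)) sums (bessel_entire nu z + z * bessel_entire (nu + 2) z)"
    using sums_add[OF 0 2] by simp
  then show ?thesis using 1 sums_unique2 by blast
qed

lemma besselJ_eq_bessel_entire: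
  assumes "nu > -1/2" "x > 0"
  shows "besselJ nu x = (x / 2) powr nu * bessel_entire nu (x\<^sup>2 / 4)"
proof -
  have "(x / 2) powr (2 * real m + nu) = (x / 2) powr nu * (x\<^sup>2 / 4) ^ m" for m
  proof -
    have "(x / 2) powr (2 * real m + nu) = (x / 2) powr nu * (x / 2) powr real (2 * m)"
      by (simp add: powr_add)
    also have "(x / 2) powr real (2 * m) = ((x / 2)\<^sup>2) ^ m"
      using assms by (subst powr_realpow) (auto simp: power_mult)
    finally show ?thesis by (simp add: power_divide)
  qed
  then have "besselJ nu x = (\<Sum>m. (x / 2) powr nu * (bessel_coeff nu m * (x\<^sup>2 / 4) ^ m))"
    unfolding besselJ_def bessel_coeff_def by (simp add: mult_ac)
  also have "\<dots> = (x / 2) powr nu * bessel_entire nu (x\<^sup>2 / 4)"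
    unfolding bessel_entire_def by (rule suminf_mult) (rule summable_bessel_entire[OF assms(1)])
  finally show ?thesis .
qed

lemma bessel_entire_0: "bessel_entire nu 0 = 1 / Gamma (nu + 1)"
  unfolding bessel_entire_def by (subst suminf_finite[of "{0}"]) (auto simp: bessel_coeff_def)

lemma continuous_on_bessel_entire: "nu > -1/2 \<Longrightarrow> continuous_on A (bessel_entire nu)"
  using bessel_entire_deriv by (intro DERIV_continuous_on) (blast intro: has_field_derivative_at_within)

lemma borel_measurable_bessel_entire [measurable]: "nu > -1/2 \<Longrightarrow> bessel_entire nu \<in> borel_measurable borel"
  by (intro borel_measurable_continuous_onI continuous_on_bessel_entire)

section \<open>Perturbed harmonic oscillators\<close>

locale oscillator =
  fixes u v :: "real \<Rightarrow> real" and k :: real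
  assumes u_deriv: "x > 0 \<Longrightarrow> (u has_real_derivative v x) (at x)"
    and v_deriv: "x > 0 \<Longrightarrow> (v has_real_derivative - (1 - k / x\<^sup>2) * u x) (at x)"
begin

definition energy :: "real \<Rightarrow> real" where "energy x = (u x)\<^sup>2 + (v x)\<^sup>2"

lemma energy_deriv:
  "x > 0 \<Longrightarrow> (energy has_real_derivative 2 * k * u x * v x / x\<^sup>2) (at x)"
  unfolding energy_def[abs_def]
  by (rule derivative_eq_intros u_deriv v_deriv refl | assumption)+ (simp add: field_simps)

lemma energy_deriv_bound: "\<bar>2 * k * u x * v x / x\<^sup>2\<bar> \<le> \<bar>k\<bar> * energy x / x\<^sup>2"
proof -
  have "2 * (\<bar>u x\<bar> * \<bar>v x\<bar>) \<le> \<bar>u x\<bar>\<^sup>2 + \<bar>v x\<bar>\<^sup>2"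
    using sum_squares_bound[of "\<bar>u x\<bar>" "\<bar>v x\<bar>"] by (simp add: mult_ac)
  then have "\<bar>k\<bar> * (2 * (\<bar>u x\<bar> * \<bar>v x\<bar>)) \<le> \<bar>k\<bar> * energy x"
    unfolding energy_def by (intro mult_left_mono) auto
  then have "\<bar>k\<bar> * (2 * (\<bar>u x\<bar> * \<bar>v x\<bar>)) / x\<^sup>2 \<le> \<bar>k\<bar> * energy x / x\<^sup>2"
    by (intro divide_right_mono) auto
  then show ?thesis by (simp add: abs_mult mult_ac)
qed

lemma abs_sum_nonneg: "\<bar>A\<bar> \<le> B \<Longrightarrow> 0 \<le> A + B" for A B :: real
  by arith

text \<open>By \<open>energy_deriv_bound\<close> the logarithmic derivative of \<open>energy\<close>
  is at most |k|/x^2, which is integrable at infinity. Hence \<open>energy\<close> times exp(-|k|/x)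
  increases, and in \<open>energy_upper\<close> \<open>energy\<close> times exp(|k|/x)
  decreases.\<close>

lemma energy_lower:
  assumes "0 < e" "e \<le> x"
  shows "energy x \<ge> energy e * exp (- \<bar>k\<bar> / e)"
proof -
  have "energy e * exp (- \<bar>k\<bar> / e) \<le> energy x * exp (- \<bar>k\<bar> / x)"
  proof (rule DERIV_nonneg_imp_nondecreasing[OF assms(2)])
    fix y assume y: "e \<le> y" "y \<le> x"
    then have "y > 0" using assms by auto
    then have "((\<lambda>x. energy x * exp (- \<bar>k\<bar> / x)) has_real_derivative
        (2 * k * u y * v y / y\<^sup>2 + \<bar>k\<bar> * energy y / y\<^sup>2) * exp (- \<bar>k\<bar> / y)) (at y)"
      by (auto intro!: derivative_eq_intros energy_deriv simp: field_simps power2_eq_square)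
    moreover have "2 * k * u y * v y / y\<^sup>2 + \<bar>k\<bar> * energy y / y\<^sup>2 \<ge> 0"
      by (rule abs_sum_nonneg[OF energy_deriv_bound])
    ultimately show "\<exists>z. ((\<lambda>x. energy x * exp (- \<bar>k\<bar> / x)) has_real_derivative z) (at y) \<and> 0 \<le> z"
      by (meson exp_ge_zero mult_nonneg_nonneg)
  qed
  also have "\<dots> \<le> energy x * 1"
    using assms by (intro mult_left_mono) (auto simp: energy_def)
  finally show ?thesis by simp
qed

lemma energy_upper:
  assumes "0 < e" "e \<le> x"
  shows "energy x \<le> energy e * exp (\<bar>k\<bar> / e)"
proof -
  have "energy x * 1 \<le> energy x * exp (\<bar>k\<bar> / x)"
    using assms by (intro mult_left_mono) (auto simp: energy_def)
  also have "energy x * exp (\<bar>k\<bar> / x) \<le> energy e * exp (\<bar>k\<bar> / e)"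
  proof (rule DERIV_nonpos_imp_nonincreasing[OF assms(2)])
    fix y assume y: "e \<le> y" "y \<le> x"
    then have "y > 0" using assms by auto
    then have "((\<lambda>x. energy x * exp (\<bar>k\<bar> / x)) has_real_derivative
        (2 * k * u y * v y / y\<^sup>2 - \<bar>k\<bar> * energy y / y\<^sup>2) * exp (\<bar>k\<bar> / y)) (at y)"
      by (auto intro!: derivative_eq_intros energy_deriv simp: field_simps power2_eq_square)
    moreover have "2 * k * u y * v y / y\<^sup>2 - \<bar>k\<bar> * energy y / y\<^sup>2 \<le> 0"
      using abs_le_D1[OF energy_deriv_bound[of y]] by (simp only: diff_le_0_iff_le)
    ultimately show "\<exists>z. ((\<lambda>x. energy x * exp (\<bar>k\<bar> / x)) has_real_derivative z) (at y) \<and> z \<le> 0"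
      by (meson exp_ge_zero mult_nonpos_nonneg)
  qed
  finally show ?thesis by simp
qed

text \<open>At a zero all the energy sits in \<open>v\<close>, so |v s| >= c there. Before the next
  zero \<open>v\<close> has to vanish (Rolle), while |v'| <= B on the way; this takes at least the
  time c / B.\<close>

lemma zero_gap:
  assumes "e > 0" "energy e > 0"
  shows "\<exists>d>0. \<forall>s\<ge>e. \<forall>t>s. u s = 0 \<longrightarrow> u t = 0 \<longrightarrow> d \<le> t - s"
proof -
  define c where "c = sqrt (energy e * exp (- \<bar>k\<bar> / e))"
  define B where "B = (1 + \<bar>k\<bar> / e\<^sup>2) * sqrt (energy e * exp (\<bar>k\<bar> / e))"
  have c: "c > 0" using assms by (simp add: c_def)
  have B: "B > 0" unfolding B_def using assms by (intro mult_pos_pos add_pos_nonneg) auto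
  have "c / B \<le> t - s" if st: "e \<le> s" "s < t" and z: "u s = 0" "u t = 0" for s t
  proof -
    have s0: "s > 0" using st assms by auto
    obtain r where r: "s < r" "r < t" "v r = 0"
    proof -
      have "\<exists>z. s < z \<and> z < t \<and> v z = 0"
      proof (rule ccontr)
        assume neg: "\<nexists>z. s < z \<and> z < t \<and> v z = 0"
        obtain z where "z > s" "z < t" "u t - u s = (t - s) * v z"
          using MVT2[of s t u v] st s0 u_deriv by auto
        then show False using neg z st by auto
      qed
      then show ?thesis using that by auto
    qed
    obtain q where q: "q > s" "q < r" "v r - v s = (r - s) * (- (1 - k / q\<^sup>2) * u q)"
      using MVT2[of s r v "\<lambda>q. - (1 - k / q\<^sup>2) * u q"] r s0 v_deriv by auto
    have "c\<^sup>2 \<le> (v s)\<^sup>2"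
      using energy_lower[of e s] assms st z by (simp add: c_def energy_def)
    then have "c \<le> \<bar>v s\<bar>" using c by (metis abs_le_square_iff abs_of_pos)
    also have "\<bar>v s\<bar> = \<bar>- v s\<bar>" by simp
    also have "- v s = (r - s) * (- (1 - k / q\<^sup>2) * u q)" using q r by simp
    also have "\<bar>\<dots>\<bar> = (r - s) * (\<bar>1 - k / q\<^sup>2\<bar> * \<bar>u q\<bar>)"
      unfolding abs_mult abs_minus_cancel using r by simp
    also have "\<dots> \<le> (r - s) * B"
    proof (rule mult_left_mono)
      have eq: "e \<le> q" "q > 0" using q st s0 by auto
      have "\<bar>1 - k / q\<^sup>2\<bar> \<le> 1 + \<bar>k\<bar> / q\<^sup>2"
        using abs_triangle_ineq4[of 1 "k / q\<^sup>2"] by simp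
      also have "\<dots> \<le> 1 + \<bar>k\<bar> / e\<^sup>2"
        using eq assms by (intro add_left_mono divide_left_mono power_mono) auto
      finally have 1: "\<bar>1 - k / q\<^sup>2\<bar> \<le> 1 + \<bar>k\<bar> / e\<^sup>2" .
      have "(u q)\<^sup>2 \<le> energy q" by (simp add: energy_def)
      also have "\<dots> \<le> energy e * exp (\<bar>k\<bar> / e)" by (rule energy_upper[OF assms(1) eq(1)])
      finally have "\<bar>u q\<bar> \<le> sqrt (energy e * exp (\<bar>k\<bar> / e))"
        by (metis real_sqrt_abs real_sqrt_le_mono)
      then show "\<bar>1 - k / q\<^sup>2\<bar> * \<bar>u q\<bar> \<le> B"
        unfolding B_def using 1 assms by (intro mult_mono) auto
    qed (use r in auto)
    also have "\<dots> \<le> (t - s) * B" using r B by (intro mult_right_mono) auto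
    finally show ?thesis using B by (simp add: pos_divide_le_eq)
  qed
  then show ?thesis using c B by (intro exI[of _ "c / B"]) auto
qed

text \<open>Sturm comparison with \<open>sin (x / 2)\<close>.\<close>

lemma zero_exists_aux:
  assumes x: "x > 0" "\<bar>k\<bar> / x\<^sup>2 \<le> 3/4" and pos: "\<And>y. x \<le> y \<Longrightarrow> y \<le> x + 2 * pi \<Longrightarrow> sg * u y > 0"
  shows False
proof -
  \<comment> \<open>Wronskian of sg * u with sin((y - x)/2), which vanishes at both ends of an
    interval of length 2 pi. The number 3/4 is 1 - (1/2)^2: it makes W nonincreasing, although
    positivity of sg * u would give W(x) < 0 < W(x + 2 pi).\<close>
  define W where "W y = sg * v y * sin ((y - x) / 2) - sg * u y * cos ((y - x) / 2) / 2" for y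
  have "W (x + 2 * pi) \<le> W x"
  proof (rule DERIV_nonpos_imp_nonincreasing[where f = W])
    fix y assume y: "x \<le> y" "y \<le> x + 2 * pi"
    then have y0: "y > 0" using x by auto
    have D: "(W has_real_derivative (sg * u y) * sin ((y - x) / 2) * (k / y\<^sup>2 - 3/4)) (at y)"
      unfolding W_def[abs_def]
      by (rule derivative_eq_intros u_deriv v_deriv y0 refl | simp)+ (use y0 in \<open>simp add: field_simps\<close>)
    have "k / y\<^sup>2 \<le> \<bar>k\<bar> / y\<^sup>2" by (intro divide_right_mono) auto
    also have "\<dots> \<le> \<bar>k\<bar> / x\<^sup>2" using x y by (intro divide_left_mono power_mono) auto
    also have "\<dots> \<le> 3/4" by (rule x(2))
    finally have "k / y\<^sup>2 - 3/4 \<le> 0" by (simp only: diff_le_0_iff_le)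
    moreover have "sin ((y - x) / 2) \<ge> 0" using y by (intro sin_ge_zero) auto
    ultimately show "\<exists>z. (W has_real_derivative z) (at y) \<and> z \<le> 0"
      using D pos[OF y] by (meson mult_nonneg_nonpos mult_nonneg_nonneg less_imp_le)
  qed auto
  moreover have "W (x + 2 * pi) = sg * u (x + 2 * pi) / 2" "W x = - (sg * u x) / 2"
    by (auto simp: W_def)
  ultimately show False using pos[of x] pos[of "x + 2 * pi"] by auto
qed

lemma zero_exists:
  assumes x: "x > 0" "\<bar>k\<bar> / x\<^sup>2 \<le> 3/4"
  shows "\<exists>y. x \<le> y \<and> y \<le> x + 2 * pi \<and> u y = 0"
proof (rule ccontr)
  assume neg: "\<not> ?thesis"
  have cont: "continuous_on {a..b} u" if "a > 0" for a b
    using u_deriv that by (intro DERIV_continuous_on[where D = v]) (auto intro: has_field_derivative_at_within)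
  define sg where "sg = sgn (u x)"
  have "sg * u y > 0" if y: "x \<le> y" "y \<le> x + 2 * pi" for y
  proof (rule ccontr)
    assume a: "\<not> sg * u y > 0"
    have nz: "u x \<noteq> 0" "u y \<noteq> 0" using neg y by auto
    have "\<exists>z. x \<le> z \<and> z \<le> y \<and> u z = 0"
    proof (cases "u x > 0")
      case True
      then have "u y \<le> 0" using a by (simp add: sg_def not_less)
      then show ?thesis using IVT2'[of u y 0 x] True y cont[OF x(1)] by auto
    next
      case False
      then have "u x < 0" using nz by auto
      then have "u y \<ge> 0" using a by (simp add: sg_def not_less)
      then show ?thesis using IVT'[of u x 0 y] \<open>u x < 0\<close> y cont[OF x(1)] by auto
    qed
    then show False using neg y by force
  qed
  then show False by (rule zero_exists_aux[OF x])
qed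

end

section \<open>Enumerating a locally finite set\<close>

text \<open>Every s n is some t (k n) with \<open>k\<close> strictly increasing, hence k n >= n.
  Used in both directions, this gives uniqueness of the enumeration.\<close>

lemma strict_mono_range_le:
  fixes s t :: "nat \<Rightarrow> real"
  assumes "strict_mono s" "strict_mono t" "range s \<subseteq> range t"
  shows "t n \<le> s n"
proof -
  have "\<forall>n. \<exists>k. s n = t k" using assms(3) by (metis UNIV_I imageE image_subset_iff)
  then obtain k where k: "\<And>n. s n = t (k n)" by metis
  have "strict_mono k"
    using assms(1,2) k by (metis strict_mono_def strict_mono_less)
  then have "n \<le> k n" by (rule strict_mono_imp_increasing)
  then show ?thesis using assms(2) k by (simp add: strict_mono_less_eq)
qed

text \<open>\<open>bessel_zero\<close> is defined by a definite description, so nothing can be said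
  about it before both existence and uniqueness of the enumeration are known.\<close>

lemma ex1_enumeration:
  fixes S :: "real set"
  assumes fin: "\<And>X. finite (S \<inter> {..X})" and unb: "\<And>X. \<exists>x\<in>S. X < x"
  shows "\<exists>!s :: nat \<Rightarrow> real. strict_mono s \<and> range s = S"
proof (rule ex_ex1I)
  have least: "\<exists>y\<in>S. X < y \<and> (\<forall>z\<in>S. X < z \<longrightarrow> y \<le> z)" for X
  proof -
    obtain x where x: "x \<in> S" "X < x" using unb by blast
    define F where "F = {y \<in> S. X < y \<and> y \<le> x}"
    have F: "finite F" "F \<noteq> {}"
      using fin[of x] x by (auto simp: F_def elim: rev_finite_subset)
    have "Min F \<in> F" using F by (rule Min_in)
    moreover have "Min F \<le> z" if "z \<in> S" "X < z" for z
    proof (cases "z \<le> x")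
      case True
      then show ?thesis using that F by (intro Min_le) (auto simp: F_def)
    next
      case False
      then show ?thesis using \<open>Min F \<in> F\<close> by (auto simp: F_def)
    qed
    ultimately show ?thesis by (auto simp: F_def)
  qed
  have first: "\<exists>y\<in>S. \<forall>z\<in>S. y \<le> z"
  proof -
    obtain x where x: "x \<in> S" using unb by blast
    have "Min (S \<inter> {..x}) \<in> S \<inter> {..x}" using fin x by (intro Min_in) auto
    moreover have "Min (S \<inter> {..x}) \<le> z" if "z \<in> S" for z
    proof (cases "z \<le> x")
      case True
      then show ?thesis using that fin by (intro Min_le) auto
    next
      case False
      then show ?thesis using calculation by auto
    qed
    ultimately show ?thesis by blast
  qed
  have "\<exists>s. \<forall>n. (s n \<in> S \<and> (n = 0 \<longrightarrow> (\<forall>z\<in>S. s n \<le> z))) \<and>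
      (s n < s (Suc n) \<and> (\<forall>z\<in>S. s n < z \<longrightarrow> s (Suc n) \<le> z))"
  proof (rule dependent_nat_choice)
    show "\<exists>y. y \<in> S \<and> ((0::nat) = 0 \<longrightarrow> (\<forall>z\<in>S. y \<le> z))" using first by blast
  next
    fix x and n :: nat
    show "\<exists>y. (y \<in> S \<and> (Suc n = 0 \<longrightarrow> (\<forall>z\<in>S. y \<le> z))) \<and> x < y \<and> (\<forall>z\<in>S. x < z \<longrightarrow> y \<le> z)"
      using least[of x] by blast
  qed
  then obtain s where s: "\<And>n. s n \<in> S \<and> (n = 0 \<longrightarrow> (\<forall>z\<in>S. s n \<le> z))"
    "\<And>n. s n < s (Suc n) \<and> (\<forall>z\<in>S. s n < z \<longrightarrow> s (Suc n) \<le> z)"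
    by blast
  have mono: "strict_mono s" using s(2) by (simp add: strict_mono_Suc_iff)
  \<comment> \<open>A point skipped by the successor construction would bound all of
    \<open>s\<close>, and an infinite range would lie in a finite set.\<close>
  have "x \<in> range s" if x: "x \<in> S" for x
  proof (rule ccontr)
    assume nx: "x \<notin> range s"
    have "s n < x" for n
    proof (induction n)
      case 0
      then show ?case using s(1)[of 0] x nx by (metis order_le_less rangeI)
    next
      case (Suc n)
      then show ?case using s(2)[of n] x nx by (metis order_le_less rangeI)
    qed
    then have "range s \<subseteq> S \<inter> {..x}" using s(1) by (auto intro: less_imp_le)
    then have "finite (range s)" using fin finite_subset by blast
    then show False using mono finite_imageD strict_mono_imp_inj_on by blast
  qed
  then show "\<exists>s :: nat \<Rightarrow> real. strict_mono s \<and> range s = S"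
    using mono s(1) by (intro exI[of _ s]) auto
next
  fix s t :: "nat \<Rightarrow> real"
  assume "strict_mono s \<and> range s = S" "strict_mono t \<and> range t = S"
  then show "s = t" using strict_mono_range_le[of s t] strict_mono_range_le[of t s]
    by (intro ext antisym) auto
qed

section \<open>The zeros of the Bessel function\<close>

locale bessel =
  fixes nu :: real
  assumes nu: "nu > -1/2"
begin

text \<open>The Liouville normal form \<open>2^nu * x^(1/2) * J_nu(x)\<close>.\<close>

definition liouville :: "real \<Rightarrow> real" where
  "liouville x = x powr (nu + 1/2) * bessel_entire nu (x\<^sup>2 / 4)"

definition liouville_deriv :: "real \<Rightarrow> real" where
  "liouville_deriv x = (nu + 1/2) * x powr (nu - 1/2) * bessel_entire nu (x\<^sup>2 / 4) - x powr (nu + 3/2) / 2 * bessel_entire (nu + 1) (x\<^sup>2 / 4)"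

lemma bessel_entire_sq_deriv:
  assumes "a > -1/2"
  shows "((\<lambda>x. bessel_entire a (x\<^sup>2 / 4)) has_real_derivative - (x / 2 * bessel_entire (a + 1) (x\<^sup>2 / 4))) (at x)"
proof -
  have "((\<lambda>x. x\<^sup>2 / 4) has_real_derivative x / 2) (at x)"
    by (auto intro!: derivative_eq_intros)
  from DERIV_chain2[OF bessel_entire_deriv[OF assms] this] show ?thesis by (simp add: mult.commute)
qed

lemma liouville_deriv: "x > 0 \<Longrightarrow> (liouville has_real_derivative liouville_deriv x) (at x)"
proof -
  assume x: "x > 0"
  have "x powr (nu + 3/2) = x powr (nu + 1/2) * x"
    using x powr_mult_base[of x "nu + 1/2"] by (simp add: add_ac mult.commute)
  moreover have "((\<lambda>x. x powr (nu + 1/2)) has_real_derivative (nu + 1/2) * x powr (nu - 1/2)) (at x)"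
    using has_real_derivative_powr[of x "nu + 1/2"] x by simp
  note DERIV_mult[OF this bessel_entire_sq_deriv[OF nu]]
  ultimately show ?thesis
    unfolding liouville_def[abs_def] liouville_deriv_def by (simp add: algebra_simps)
qed

text \<open>Differentiating brings in the orders nu + 1 and nu + 2; the recurrence \<open>r\<close>
  trades both for order nu. The factor \<open>P\<close> is the smallest power of x that occurs, so
  the rest is polynomial arithmetic.\<close>

lemma liouville_deriv_has_deriv: "x > 0 \<Longrightarrow> (liouville_deriv has_real_derivative - (1 - (nu\<^sup>2 - 1/4) / x\<^sup>2) * liouville x) (at x)"
proof -
  assume x: "x > 0"
  define P where "P = x powr (nu - 3/2)"
  have p: "x powr (nu - 1/2) = P * x" "x powr (nu + 1/2) = P * x\<^sup>2" "x powr (nu + 3/2) = P * x ^ 3"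
    using x powr_add[of x "nu - 3/2" 1] powr_add[of x "nu - 3/2" 2] powr_add[of x "nu - 3/2" 3]
    by (simp_all add: P_def add.commute)
  define L0 L1 L2 where "L0 = bessel_entire nu (x\<^sup>2 / 4)" and "L1 = bessel_entire (nu + 1) (x\<^sup>2 / 4)" and "L2 = bessel_entire (nu + 2) (x\<^sup>2 / 4)"
  have d1: "((\<lambda>x. x powr (nu - 1/2)) has_real_derivative (nu - 1/2) * P) (at x)"
    using has_real_derivative_powr[of x "nu - 1/2"] x by (simp add: P_def)
  have d2: "((\<lambda>x. x powr (nu + 3/2)) has_real_derivative (nu + 3/2) * (P * x\<^sup>2)) (at x)"
    using has_real_derivative_powr[of x "nu + 3/2"] x p(2) by (simp add: add.commute)
  have l0: "((\<lambda>x. bessel_entire nu (x\<^sup>2 / 4)) has_real_derivative - (x / 2 * L1)) (at x)"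
    using bessel_entire_sq_deriv[OF nu] by (simp add: L1_def)
  have l1: "((\<lambda>x. bessel_entire (nu + 1) (x\<^sup>2 / 4)) has_real_derivative - (x / 2 * L2)) (at x)"
    using bessel_entire_sq_deriv[of "nu + 1" x] nu by (simp add: L2_def add_ac)
  have "(liouville_deriv has_real_derivative
      (nu + 1/2) * ((nu - 1/2) * P) * L0 + (nu + 1/2) * (P * x) * (- (x / 2 * L1))
      - ((nu + 3/2) * (P * x\<^sup>2) / 2 * L1 + (P * x ^ 3) / 2 * (- (x / 2 * L2)))) (at x)"
    unfolding liouville_deriv_def[abs_def]
    by (rule derivative_eq_intros d1 d2 l0 l1 refl | simp)+ (simp add: L0_def L1_def p algebra_simps)
  moreover have r: "L0 + x\<^sup>2 / 4 * L2 = (nu + 1) * L1"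
    using bessel_entire_recurrence[OF nu, of "x\<^sup>2 / 4"] by (simp add: L0_def L1_def L2_def)
  have "(nu + 1/2) * ((nu - 1/2) * P) * L0 + (nu + 1/2) * (P * x) * (- (x / 2 * L1))
      - ((nu + 3/2) * (P * x\<^sup>2) / 2 * L1 + (P * x ^ 3) / 2 * (- (x / 2 * L2)))
      = (nu\<^sup>2 - 1/4) * P * L0 + P * x\<^sup>2 * (x\<^sup>2 / 4 * L2 - (nu + 1) * L1)"
    by (simp add: algebra_simps power2_eq_square power3_eq_cube)
  also have "\<dots> = (nu\<^sup>2 - 1/4) * P * L0 - P * x\<^sup>2 * L0"
    unfolding r[symmetric] by (simp add: algebra_simps)
  also have "\<dots> = - (1 - (nu\<^sup>2 - 1/4) / x\<^sup>2) * liouville x"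
    unfolding liouville_def p L0_def using x by (simp add: divide_simps) (simp add: algebra_simps)
  ultimately show ?thesis by simp
qed

sublocale oscillator liouville liouville_deriv "nu\<^sup>2 - 1/4"
  by unfold_locales (fact liouville_deriv, fact liouville_deriv_has_deriv)

abbreviation sz :: "nat \<Rightarrow> real" where "sz \<equiv> bessel_zero nu"

lemma besselJ_zero_iff: "x > 0 \<Longrightarrow> besselJ nu x = 0 \<longleftrightarrow> liouville x = 0"
  by (simp add: besselJ_eq_bessel_entire[OF nu] liouville_def)

text \<open>Half of the value at 0, by continuity. It serves twice: to keep the zeros of J_nu away
  from 0, and later to bound all eigenfunctions below frequency R from below on (0, c0/R).\<close>

lemma bessel_entire_near_0: "\<exists>e>0. \<forall>z. 0 \<le> z \<and> z \<le> e \<longrightarrow> bessel_entire nu z \<ge> 1 / (2 * Gamma (nu + 1))"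
proof -
  have G: "Gamma (nu + 1) > 0" using nu by (intro Gamma_real_pos) auto
  have "isCont (bessel_entire nu) 0" using DERIV_isCont bessel_entire_deriv[OF nu] by blast
  then obtain e where e: "e > 0" "\<And>z. \<bar>z\<bar> < e \<Longrightarrow> \<bar>bessel_entire nu z - bessel_entire nu 0\<bar> < 1 / (2 * Gamma (nu + 1))"
    using G unfolding continuous_at_eps_delta by (metis dist_real_def diff_zero divide_pos_pos mult_pos_pos zero_less_numeral zero_less_one)
  have "bessel_entire nu z \<ge> 1 / (2 * Gamma (nu + 1))" if "0 \<le> z" "z \<le> e / 2" for z
  proof -
    have "1 / Gamma (nu + 1) = 1 / (2 * Gamma (nu + 1)) + 1 / (2 * Gamma (nu + 1))"
      by simp
    then show ?thesis using e(2)[of z] e(1) that unfolding bessel_entire_0 by linarith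
  qed
  then show ?thesis using e by (intro exI[of _ "e / 2"]) auto
qed

lemma liouville_pos_near_0: "\<exists>e>0. \<forall>x. 0 < x \<and> x \<le> e \<longrightarrow> liouville x > 0"
proof -
  obtain e where e: "e > 0" "\<And>z. 0 \<le> z \<Longrightarrow> z \<le> e \<Longrightarrow> bessel_entire nu z \<ge> 1 / (2 * Gamma (nu + 1))"
    using bessel_entire_near_0 by blast
  have G: "Gamma (nu + 1) > 0" using nu by (intro Gamma_real_pos) auto
  have "liouville x > 0" if "0 < x" "x \<le> min 1 e" for x
  proof -
    have "x\<^sup>2 \<le> x * 1" unfolding power2_eq_square using that by (intro mult_left_mono) auto
    then have "x\<^sup>2 / 4 \<le> e" using that e(1) by auto
    then have "bessel_entire nu (x\<^sup>2 / 4) \<ge> 1 / (2 * Gamma (nu + 1))" by (intro e(2)) auto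
    then have "bessel_entire nu (x\<^sup>2 / 4) > 0" using G by (smt (verit) divide_pos_pos)
    then show ?thesis using that by (simp add: liouville_def)
  qed
  then show ?thesis using e(1) by (intro exI[of _ "min 1 e"]) auto
qed

lemma exists_zero_large: "\<exists>X>0. \<forall>x\<ge>X. \<exists>y. x \<le> y \<and> y \<le> x + 2 * pi \<and> besselJ nu y = 0"
proof -
  \<comment> \<open>For x >= X >= 1 this gives |nu^2 - 1/4| <= (3/4) x <= (3/4) x^2, the hypothesis
    of \<open>zero_exists\<close>.\<close>
  define X where "X = \<bar>nu\<^sup>2 - 1/4\<bar> * 4/3 + 1"
  have X: "X \<ge> 1" by (simp add: X_def)
  have "\<exists>y. x \<le> y \<and> y \<le> x + 2 * pi \<and> besselJ nu y = 0" if "x \<ge> X" for x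
  proof -
    have x: "x \<ge> 1" using X that by auto
    have "x * 1 \<le> x\<^sup>2" unfolding power2_eq_square using x by (intro mult_left_mono) auto
    moreover have "\<bar>nu\<^sup>2 - 1/4\<bar> \<le> 3/4 * x" using that by (simp add: X_def)
    ultimately have "\<bar>nu\<^sup>2 - 1/4\<bar> \<le> 3/4 * x\<^sup>2" by linarith
    then have "\<bar>nu\<^sup>2 - 1/4\<bar> / x\<^sup>2 \<le> 3/4" using x by (simp add: pos_divide_le_eq)
    with zero_exists[of x] x obtain y where "x \<le> y" "y \<le> x + 2 * pi" "liouville y = 0" by auto
    then show ?thesis using x besselJ_zero_iff[of y] by auto
  qed
  then show ?thesis using X by (intro exI[of _ X]) auto
qed

text \<open>The energy estimates degenerate at 0, so \<open>zero_gap\<close> starts only at some e >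
  0; positivity of \<open>liouville\<close> on (0, e] rules out zeros before e.\<close>

lemma zeros_gap:
  "\<exists>d>0. \<forall>s>0. \<forall>t>s. besselJ nu s = 0 \<longrightarrow> besselJ nu t = 0 \<longrightarrow> d \<le> t - s"
proof -
  obtain e where e: "e > 0" "\<And>x. 0 < x \<Longrightarrow> x \<le> e \<Longrightarrow> liouville x > 0" using liouville_pos_near_0 by blast
  have "energy e > 0" using e(2)[OF e(1) order_refl] by (auto simp: energy_def sum_power2_gt_zero_iff)
  from zero_gap[OF e(1) this] obtain d where d: "d > 0"
    "\<And>s t. e \<le> s \<Longrightarrow> s < t \<Longrightarrow> liouville s = 0 \<Longrightarrow> liouville t = 0 \<Longrightarrow> d \<le> t - s" by blast
  have "d \<le> t - s" if "0 < s" "s < t" "besselJ nu s = 0" "besselJ nu t = 0" for s t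
  proof -
    have "liouville s = 0" "liouville t = 0" using that besselJ_zero_iff by auto
    then show ?thesis using e(2)[of s] that by (intro d(2)) force+
  qed
  then show ?thesis using d by blast
qed

lemma bessel_zero_enum: "strict_mono sz \<and> range sz = {x. 0 < x \<and> besselJ nu x = 0}"
proof -
  let ?S = "{x. 0 < x \<and> besselJ nu x = 0}"
  obtain d where d: "d > 0" "\<And>s t. 0 < s \<Longrightarrow> s < t \<Longrightarrow> besselJ nu s = 0 \<Longrightarrow> besselJ nu t = 0 \<Longrightarrow> d \<le> t - s"
    using zeros_gap by blast
  have fin: "finite (?S \<inter> {..X})" for X
  proof -
    \<comment> \<open>Zeros at distance at least d have different integer parts after division by d,
      and below X only finitely many integer parts are available.\<close>
    have "inj_on (\<lambda>x. \<lfloor>x / d\<rfloor>) (?S \<inter> {..X})"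
    proof (rule linorder_inj_onI)
      fix s t assume st: "s < t" "s \<in> ?S \<inter> {..X}" "t \<in> ?S \<inter> {..X}"
      then have "s + d \<le> t" using d(2)[of s t] by auto
      then have "(s + d) / d \<le> t / d" using d(1) by (intro divide_right_mono) auto
      then have "s / d + 1 \<le> t / d" using d(1) by (simp add: add_divide_distrib)
      then show "\<lfloor>s / d\<rfloor> \<noteq> \<lfloor>t / d\<rfloor>" by linarith
    qed auto
    moreover have "(\<lambda>x. \<lfloor>x / d\<rfloor>) ` (?S \<inter> {..X}) \<subseteq> {0..\<lfloor>X / d\<rfloor>}"
      using d(1) by (auto intro!: floor_mono divide_right_mono)
    ultimately show ?thesis
      using finite_imageD finite_subset finite_atLeastAtMost_int by meson
  qed
  obtain Y where Y: "Y > 0" "\<And>x. x \<ge> Y \<Longrightarrow> \<exists>y. x \<le> y \<and> y \<le> x + 2 * pi \<and> besselJ nu y = 0"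
    using exists_zero_large by blast
  have unb: "\<exists>x\<in>?S. X < x" for X
  proof -
    from Y(2)[of "max Y (X + 1)"] obtain y where "max Y (X + 1) \<le> y" "besselJ nu y = 0" by auto
    then show ?thesis using Y(1) by (intro bexI[of _ y]) auto
  qed
  show ?thesis unfolding bessel_zero_def using theI'[OF ex1_enumeration[OF fin unb]] .
qed

lemma sz_pos: "sz j > 0" and sz_zero: "besselJ nu (sz j) = 0"
  using bessel_zero_enum rangeI[of sz j] by auto

lemma sz_mono: "strict_mono sz" using bessel_zero_enum by blast

lemma sz_surj: "0 < x \<Longrightarrow> besselJ nu x = 0 \<Longrightarrow> \<exists>j. x = sz j"
  using bessel_zero_enum by (metis (mono_tags, lifting) mem_Collect_eq rangeE)

lemma sz_gap: "\<exists>d>0. \<forall>i j. i \<le> j \<longrightarrow> d * real (j - i) \<le> sz j - sz i"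
proof -
  obtain d where d: "d > 0" "\<And>s t. 0 < s \<Longrightarrow> s < t \<Longrightarrow> besselJ nu s = 0 \<Longrightarrow> besselJ nu t = 0 \<Longrightarrow> d \<le> t - s"
    using zeros_gap by blast
  have "d * real (j - i) \<le> sz j - sz i" if "i \<le> j" for i j
    using that
  proof (induction j rule: dec_induct)
    case (step n)
    have "d \<le> sz (Suc n) - sz n" using sz_pos sz_zero sz_mono by (intro d(2)) (auto simp: strict_mono_def)
    moreover have "real (Suc n - i) = real (n - i) + 1" using step by (simp add: Suc_diff_le)
    ultimately show ?case using step by (simp add: algebra_simps)
  qed auto
  then show ?thesis using d by blast
qed

text \<open>The factor by which the \<open>j\<close>-th eigenfunction enters the kernel near the origin.\<close>

definition weight :: "nat \<Rightarrow> real" where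
  "weight j = 2 / (besselJ (nu + 1) (sz j))\<^sup>2 * (sz j / 2) powr (2 * nu)"

text \<open>At a zero s of J_nu the first term of \<open>liouville_deriv\<close> drops out, leaving
  - 2^nu s^(1/2) J_(nu+1)(s). Its square is the whole energy at s, which is confined between two
  positive constants; this is how \<open>weight_bounds\<close> controls J_(nu+1)(s)^2.\<close>

lemma weight_eq: "weight j = 2 * sz j powr (2 * nu + 1) / (liouville_deriv (sz j))\<^sup>2"
proof -
  let ?s = "sz j"
  have s: "?s > 0" by (rule sz_pos)
  have "liouville ?s = 0" using sz_zero besselJ_zero_iff[OF s] by auto
  then have L: "bessel_entire nu (?s\<^sup>2 / 4) = 0" using s by (simp add: liouville_def)
  have "?s powr (nu + 3/2) = ?s powr (1/2) * ?s powr (nu + 1)" by (simp add: powr_add[symmetric] add.commute)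
  also have "?s powr (nu + 1) = (2 * (?s / 2)) powr (nu + 1)" by simp
  also have "\<dots> = 2 powr (nu + 1) * (?s / 2) powr (nu + 1)" using s by (subst powr_mult) auto
  finally have "liouville_deriv ?s = - (?s powr (1/2) * 2 powr nu * besselJ (nu + 1) ?s)"
    using L s nu by (simp add: liouville_deriv_def besselJ_eq_bessel_entire powr_add)
  then have "(liouville_deriv ?s)\<^sup>2 = ?s * 2 powr (2 * nu) * (besselJ (nu + 1) ?s)\<^sup>2"
    using s by (simp add: power_mult_distrib powr_power)
  moreover have "?s powr (2 * nu + 1) = ?s * 2 powr (2 * nu) * (?s / 2) powr (2 * nu)"
    using s by (simp add: powr_add powr_divide)
  ultimately show ?thesis using s by (simp add: weight_def)
qed

lemma weight_bounds:
  "\<exists>c C. 0 < c \<and> 0 < C \<and> (\<forall>j. c * sz j powr (2 * nu + 1) \<le> weight j \<and> weight j \<le> C * sz j powr (2 * nu + 1))"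
proof -
  obtain e where e: "e > 0" "\<And>x. 0 < x \<Longrightarrow> x \<le> e \<Longrightarrow> liouville x > 0" using liouville_pos_near_0 by blast
  have E: "energy e > 0" using e(2)[OF e(1) order_refl] by (auto simp: energy_def sum_power2_gt_zero_iff)
  define c C where "c = energy e * exp (- \<bar>nu\<^sup>2 - 1/4\<bar> / e)" and "C = energy e * exp (\<bar>nu\<^sup>2 - 1/4\<bar> / e)"
  have cC: "c > 0" "C > 0" using E by (auto simp: c_def C_def)
  have "2 / C * sz j powr (2 * nu + 1) \<le> weight j \<and> weight j \<le> 2 / c * sz j powr (2 * nu + 1)" for j
  proof -
    have u: "liouville (sz j) = 0" using sz_zero sz_pos besselJ_zero_iff by auto
    then have "e \<le> sz j" using e(2)[of "sz j"] sz_pos[of j] by force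
    then have "c \<le> (liouville_deriv (sz j))\<^sup>2" "(liouville_deriv (sz j))\<^sup>2 \<le> C"
      using energy_lower[OF e(1), of "sz j"] energy_upper[OF e(1), of "sz j"] u
      by (auto simp: energy_def c_def C_def)
    then have "2 / C \<le> 2 / (liouville_deriv (sz j))\<^sup>2" "2 / (liouville_deriv (sz j))\<^sup>2 \<le> 2 / c"
      using cC by (auto intro!: divide_left_mono mult_pos_pos intro: less_le_trans)
    then have "2 / C * sz j powr (2 * nu + 1) \<le> 2 / (liouville_deriv (sz j))\<^sup>2 * sz j powr (2 * nu + 1)"
      "2 / (liouville_deriv (sz j))\<^sup>2 * sz j powr (2 * nu + 1) \<le> 2 / c * sz j powr (2 * nu + 1)"
      by (blast intro: mult_right_mono powr_ge_zero)+
    then show ?thesis unfolding weight_eq by simp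
  qed
  then show ?thesis using cC by (intro exI[of _ "2 / C"] exI[of _ "2 / c"]) auto
qed

text \<open>This is J_nu(x) = O(x^(-1/2)): the energy controls x >= 1 and the assumed bound covers x
  < 1. The bound is supplied by Poisson's integral in \<open>bessel_entire_bounded\<close>.\<close>

lemma bessel_entire_decay:
  assumes bdd: "\<And>z. 0 \<le> z \<Longrightarrow> \<bar>bessel_entire nu z\<bar> \<le> B"
  shows "\<exists>C>0. \<forall>x>0. \<bar>bessel_entire nu (x\<^sup>2 / 4)\<bar> \<le> C * x powr (- nu - 1/2)"
proof -
  define C where "C = max B (sqrt (energy 1 * exp (\<bar>nu\<^sup>2 - 1/4\<bar>))) + 1"
  have "B \<ge> 0" using bdd[of 0] by auto
  then have C: "C > 0" "B \<le> C" by (auto simp: C_def)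
  have "\<bar>liouville x\<bar> \<le> C" if x: "x > 0" for x
  proof (cases "x \<ge> 1")
    case True
    have "(liouville x)\<^sup>2 \<le> energy x" by (simp add: energy_def)
    also have "\<dots> \<le> energy 1 * exp (\<bar>nu\<^sup>2 - 1/4\<bar>)" using energy_upper[of 1 x] True by simp
    finally have "\<bar>liouville x\<bar> \<le> sqrt (energy 1 * exp (\<bar>nu\<^sup>2 - 1/4\<bar>))"
      by (metis real_sqrt_abs real_sqrt_le_mono)
    then show ?thesis by (simp add: C_def)
  next
    case False
    have "x powr (nu + 1/2) \<le> 1" using x False nu by (intro powr_le1) auto
    then have "x powr (nu + 1/2) * \<bar>bessel_entire nu (x\<^sup>2 / 4)\<bar> \<le> 1 * B"
      using bdd by (intro mult_mono) auto
    then show ?thesis using C by (simp add: liouville_def abs_mult)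
  qed
  moreover have "bessel_entire nu (x\<^sup>2 / 4) = liouville x * x powr (- nu - 1/2)" if "x > 0" for x
  proof -
    have "x powr (nu + 1/2) * x powr (- nu - 1/2) = 1" using that by (simp add: powr_add[symmetric])
    then show ?thesis by (simp add: liouville_def mult_ac)
  qed
  ultimately show ?thesis using C
    by (intro exI[of _ C]) (auto simp: abs_mult intro!: mult_right_mono)
qed

end

section \<open>Oscillatory integrals with a Beta weight\<close>

text \<open>Since 0 powr r = 0 for every r, this vanishes at both endpoints whatever the exponents,
  so singular exponents need no special values.\<close>

definition beta_density :: "real \<Rightarrow> real \<Rightarrow> real \<Rightarrow> real" where
  "beta_density a b t = indicator {0..1} t * (t powr (a - 1) * (1 - t) powr (b - 1))"

lemma beta_density_nonneg [simp]: "beta_density a b t \<ge> 0"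
  by (simp add: beta_density_def)

lemma borel_measurable_beta_density [measurable]: "beta_density a b \<in> borel_measurable borel"
  unfolding beta_density_def[abs_def] by measurable

lemma integrable_beta_density: "a > 0 \<Longrightarrow> b > 0 \<Longrightarrow> integrable lborel (beta_density a b)"
  using integrable_Beta[of a b] by (simp add: set_integrable_def beta_density_def[abs_def])

lemma integral_beta_density:
  assumes "a > 0" "b > 0"
  shows "(\<integral>t. beta_density a b t \<partial>lborel) = Beta a b"
  using set_borel_integral_eq_integral(2)[OF integrable_Beta[OF assms]]
    integral_unique[OF has_integral_Beta_real[OF assms]]
  by (simp add: set_lebesgue_integral_def beta_density_def[abs_def])

lemma integrable_beta_density_bounded:
  fixes E :: "real \<Rightarrow> 'b :: {banach, second_countable_topology}"
  assumes "a > 0" "b > 0" and [measurable]: "E \<in> borel_measurable borel" and B: "\<And>t. norm (E t) \<le> B"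
  shows "integrable lborel (\<lambda>t. beta_density a b t *\<^sub>R E t)"
proof (rule Bochner_Integration.integrable_bound)
  show "integrable lborel (\<lambda>t. beta_density a b t * B)"
    using integrable_beta_density[OF assms(1,2)] by simp
  have "beta_density a b t * norm (E t) \<le> \<bar>beta_density a b t * B\<bar>" for t
    using mult_left_mono[OF B, of "beta_density a b t" t] by simp
  then show "AE t in lborel. norm (beta_density a b t *\<^sub>R E t) \<le> norm (beta_density a b t * B)"
    by simp
qed measurable

lemma norm_cis_minus_1: "norm (cis x - 1) \<le> \<bar>x\<bar>" "norm (cis x - 1) \<le> 2"
proof -
  have "norm (iexp x - (\<Sum>k\<le>0. (\<i> * x) ^ k / fact k)) \<le> \<bar>x\<bar> ^ Suc 0 / fact (Suc 0)"
    by (rule iexp_approx1)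
  then show "norm (cis x - 1) \<le> \<bar>x\<bar>" by (simp add: cis_conv_exp)
  show "norm (cis x - 1) \<le> 2" using norm_triangle_ineq4[of "cis x" 1] by simp
qed

lemma borel_measurable_cis [measurable]: "cis \<in> borel_measurable borel"
  by (intro borel_measurable_continuous_onI continuous_intros)

text \<open>Fourier transform of the Beta weight, that is Beta a b times Kummer's function M(a, a +
  b, i w). For large b its decay comes from the singularity y^(a - 1) at 0.\<close>

definition cusp :: "real \<Rightarrow> real \<Rightarrow> real \<Rightarrow> complex" where
  "cusp a b w = (\<integral>y. beta_density a b y *\<^sub>R cis (w * y) \<partial>lborel)"

lemma integrable_cusp:
  "a > 0 \<Longrightarrow> b > 0 \<Longrightarrow> integrable lborel (\<lambda>y. beta_density a b y *\<^sub>R cis (w * y))"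
  by (rule integrable_beta_density_bounded[where B = 1]) auto

lemma norm_cusp_le: "a > 0 \<Longrightarrow> b > 0 \<Longrightarrow> norm (cusp a b w) \<le> Beta a b"
  unfolding cusp_def using integral_norm_bound[of lborel "\<lambda>y. beta_density a b y *\<^sub>R cis (w * y)"]
  by (simp add: integral_beta_density)

lemma Beta_nonneg: "a > 0 \<Longrightarrow> b > 0 \<Longrightarrow> Beta a b \<ge> (0 :: real)"
  using order_trans[OF norm_ge_zero norm_cusp_le] .

lemma cusp_0: "a > 0 \<Longrightarrow> b > 0 \<Longrightarrow> cusp a b 0 = of_real (Beta a b)"
  by (simp add: cusp_def integral_beta_density integrable_beta_density scaleR_conv_of_real)

lemma beta_density_diff:
  assumes "y \<noteq> 0"
  shows "beta_density (a + 1) b y = beta_density a b y - beta_density a (b + 1) y"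
proof (cases "0 < y \<and> y \<le> 1")
  case True
  have "y powr a = y * y powr (a - 1)" using True powr_mult_base[of y "a - 1"] by simp
  moreover have "(1 - y) powr b = (1 - y) * (1 - y) powr (b - 1)" 
    using True powr_mult_base[of "1 - y" "b - 1"] by simp
  ultimately show ?thesis using True by (simp add: beta_density_def left_diff_distrib right_diff_distrib mult.left_commute)
next
  case False
  then show ?thesis using assms by (auto simp: beta_density_def indicator_def)
qed

lemma cusp_diff:
  assumes "a > 0" "b > 0"
  shows "cusp (a + 1) b w = cusp a b w - cusp a (b + 1) w"
proof -
  have "cusp (a + 1) b w = (\<integral>y. beta_density a b y *\<^sub>R cis (w * y) - beta_density a (b + 1) y *\<^sub>R cis (w * y) \<partial>lborel)"
    unfolding cusp_def
  proof (rule integral_cong_AE)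
    show "AE y in lborel. beta_density (a + 1) b y *\<^sub>R cis (w * y)
       = beta_density a b y *\<^sub>R cis (w * y) - beta_density a (b + 1) y *\<^sub>R cis (w * y)"
      using AE_lborel_singleton[of 0] by eventually_elim (simp add: beta_density_diff scaleR_diff_left)
  qed measurable
  also have "\<dots> = cusp a b w - cusp a (b + 1) w"
    unfolding cusp_def using assms by (intro Bochner_Integration.integral_diff integrable_cusp) auto
  finally show ?thesis .
qed

text \<open>Integration by parts with the factor \<open>E\<close> left open: it is cis(w y) when a >
  1, but cis(w y) - 1 when a <= 1, where \<open>E\<close> has to compensate the singularity at 0.
  For that reason continuity and integrability are asked of the products and not of the
  weight.\<close>

lemma beta_parts:
  fixes E E' :: "real \<Rightarrow> complex"
  assumes b: "b > 1"
    and E: "\<And>y. (E has_vector_derivative E' y) (at y)"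
    and cont: "continuous_on {0..1} (\<lambda>y. (y powr (a - 1) * (1 - y) powr (b - 1)) *\<^sub>R E y)"
    and i1: "integrable lborel (\<lambda>y. beta_density (a - 1) b y *\<^sub>R E y)"
    and i2: "integrable lborel (\<lambda>y. beta_density a (b - 1) y *\<^sub>R E y)"
    and i3: "integrable lborel (\<lambda>y. beta_density a b y *\<^sub>R E' y)"
  shows "(a - 1) *\<^sub>R (\<integral>y. beta_density (a - 1) b y *\<^sub>R E y \<partial>lborel)
    - (b - 1) *\<^sub>R (\<integral>y. beta_density a (b - 1) y *\<^sub>R E y \<partial>lborel)
    + (\<integral>y. beta_density a b y *\<^sub>R E' y \<partial>lborel) = 0"
proof -
  define F where "F y = (y powr (a - 1) * (1 - y) powr (b - 1)) *\<^sub>R E y" for y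
  define F' where "F' y = ((a - 1) * (y powr (a - 1 - 1) * (1 - y) powr (b - 1))) *\<^sub>R E y
     - ((b - 1) * (y powr (a - 1) * (1 - y) powr (b - 1 - 1))) *\<^sub>R E y + (y powr (a - 1) * (1 - y) powr (b - 1)) *\<^sub>R E' y" for y
  have "(F' has_integral (F 1 - F 0)) {0..1}"
  proof (rule fundamental_theorem_of_calculus_interior)
    fix y :: real assume y: "y \<in> {0<..<1}"
    have "((\<lambda>y. y powr (a - 1)) has_real_derivative (a - 1) * y powr (a - 1 - 1)) (at y)"
      using y has_real_derivative_powr[of y "a - 1"] by simp
    moreover have "((\<lambda>y. (1 - y) powr (b - 1)) has_real_derivative - ((b - 1) * (1 - y) powr (b - 1 - 1))) (at y)"
      using y DERIV_fun_powr[of "\<lambda>y. 1 - y" "-1" y "b - 1"] by (auto intro!: derivative_eq_intros)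
    from DERIV_mult[OF calculation this]
    have "((\<lambda>y. y powr (a - 1) * (1 - y) powr (b - 1)) has_real_derivative
        (a - 1) * (y powr (a - 1 - 1) * (1 - y) powr (b - 1)) - (b - 1) * (y powr (a - 1) * (1 - y) powr (b - 1 - 1))) (at y)"
      by (simp add: algebra_simps)
    from has_vector_derivative_scaleR[OF this E]
    show "(F has_vector_derivative F' y) (at y)"
      unfolding F_def[abs_def] F'_def by (simp add: algebra_simps)
  qed (use cont in \<open>auto simp: F_def\<close>)
  \<comment> \<open>At 0 this is the convention 0 powr (a - 1) = 0, also for a <= 1; the hypothesis
    \<open>cont\<close> ensures that it agrees with the limit.\<close>
  moreover have "F 1 = 0" "F 0 = 0" by (auto simp: F_def)
  ultimately have I: "integral {0..1} F' = 0" by (simp add: integral_unique)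
  have eq: "indicator {0..1} y *\<^sub>R F' y = (a - 1) *\<^sub>R (beta_density (a - 1) b y *\<^sub>R E y)
      - (b - 1) *\<^sub>R (beta_density a (b - 1) y *\<^sub>R E y) + beta_density a b y *\<^sub>R E' y" for y
    by (auto simp: F'_def beta_density_def indicator_def)
  have int: "integrable lborel (\<lambda>y. indicator {0..1} y *\<^sub>R F' y)"
    unfolding eq by (intro Bochner_Integration.integrable_add Bochner_Integration.integrable_diff
      integrable_scaleR_right i1 i2 i3)
  have "(\<integral>y. indicator {0..1} y *\<^sub>R F' y \<partial>lborel) = 0"
    using set_borel_integral_eq_integral(2)[of "{0..1}" F'] int I
    by (simp add: set_integrable_def set_lebesgue_integral_def)
  then show ?thesis
    unfolding eq using i1 i2 i3 by (simp del: scaleR_scaleR)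
qed

lemma cis_has_vector_derivative:
  "((\<lambda>y. cis (w * y)) has_vector_derivative (\<i> * of_real w) * cis (w * y)) (at y)"
  unfolding has_vector_derivative_def
  by (auto intro!: derivative_eq_intros simp: scaleR_conv_of_real)

lemma cusp_recursion:
  assumes "a > 1" "b > 1"
  shows "of_real w * cusp a b w = \<i> * (of_real (a - 1) * cusp (a - 1) b w - of_real (b - 1) * cusp a (b - 1) w)"
proof -
  have "(a - 1) *\<^sub>R (\<integral>y. beta_density (a - 1) b y *\<^sub>R cis (w * y) \<partial>lborel)
    - (b - 1) *\<^sub>R (\<integral>y. beta_density a (b - 1) y *\<^sub>R cis (w * y) \<partial>lborel)
    + (\<integral>y. beta_density a b y *\<^sub>R ((\<i> * of_real w) * cis (w * y)) \<partial>lborel) = 0"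
  proof (rule beta_parts[OF assms(2) cis_has_vector_derivative])
    show "continuous_on {0..1} (\<lambda>y. (y powr (a - 1) * (1 - y) powr (b - 1)) *\<^sub>R cis (w * y))"
      using assms by (intro continuous_intros continuous_on_powr') auto
    show "integrable lborel (\<lambda>y. beta_density a b y *\<^sub>R ((\<i> * of_real w) * cis (w * y)))"
      using assms by (intro integrable_beta_density_bounded[where B = "\<bar>w\<bar>"]) (auto simp: norm_mult)
  qed (use assms in \<open>auto intro!: integrable_cusp\<close>)
  moreover have "(\<integral>y. beta_density a b y *\<^sub>R ((\<i> * of_real w) * cis (w * y)) \<partial>lborel) = (\<i> * of_real w) * cusp a b w"
    unfolding cusp_def by (simp add: mult.left_commute flip: integral_mult_right_zero)
  ultimately have "of_real (a - 1) * cusp (a - 1) b w - of_real (b - 1) * cusp a (b - 1) w + \<i> * of_real w * cusp a b w = 0"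
    by (simp add: cusp_def scaleR_conv_of_real)
  then have "\<i> * (of_real (a - 1) * cusp (a - 1) b w - of_real (b - 1) * cusp a (b - 1) w + \<i> * of_real w * cusp a b w) = 0"
    by simp
  then show ?thesis by (simp add: algebra_simps flip: mult.assoc)
qed

text \<open>For a <= 1 the weight y^(a - 2) produced by integration by parts is not integrable at 0.
  Subtracting 1 from the exponential leaves its derivative unchanged and gains a factor y.\<close>

definition cusp1 :: "real \<Rightarrow> real \<Rightarrow> real \<Rightarrow> complex" where
  "cusp1 a b w = (\<integral>y. beta_density (a - 1) b y *\<^sub>R (cis (w * y) - 1) \<partial>lborel)"

lemma cusp_recursion_base:
  assumes a: "0 < a" "a \<le> 1" and b: "b > 1" and w: "w > 0"
  shows "of_real w * cusp a b w
    = \<i> * (of_real (a - 1) * cusp1 a b w - of_real (b - 1) * (cusp a (b - 1) w - of_real (Beta a (b - 1))))"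
proof -
  have norm_le: "norm (cis (w * y) - 1) \<le> w * y" if "y \<ge> 0" for y
    using norm_cis_minus_1(1)[of "w * y"] that w by simp
  have i1: "integrable lborel (\<lambda>y. beta_density (a - 1) b y *\<^sub>R (cis (w * y) - 1))"
  proof (rule Bochner_Integration.integrable_bound)
    show "integrable lborel (\<lambda>y. w * beta_density a b y)"
      using assms by (intro integrable_mult_right integrable_beta_density) auto
    have "beta_density (a - 1) b y * norm (cis (w * y) - 1) \<le> w * beta_density a b y" for y
    proof (cases "0 < y \<and> y \<le> 1")
      case True
      have "y powr (a - 1) = y * y powr (a - 1 - 1)" using True powr_mult_base[of y "a - 1 - 1"] by simp
      moreover have "beta_density (a - 1) b y * norm (cis (w * y) - 1) \<le> beta_density (a - 1) b y * (w * y)"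
        using True by (intro mult_left_mono norm_le) auto
      ultimately show ?thesis using True by (simp add: beta_density_def mult_ac)
    next
      case False
      then show ?thesis using w by (auto simp: beta_density_def indicator_def)
    qed
    then show "AE y in lborel. norm (beta_density (a - 1) b y *\<^sub>R (cis (w * y) - 1)) \<le> norm (w * beta_density a b y)"
      using w by simp
  qed measurable
  have i2: "integrable lborel (\<lambda>y. beta_density a (b - 1) y *\<^sub>R (cis (w * y) - 1))"
    using assms norm_cis_minus_1 by (intro integrable_beta_density_bounded[where B = 2]) auto
  have "(a - 1) *\<^sub>R (\<integral>y. beta_density (a - 1) b y *\<^sub>R (cis (w * y) - 1) \<partial>lborel)
    - (b - 1) *\<^sub>R (\<integral>y. beta_density a (b - 1) y *\<^sub>R (cis (w * y) - 1) \<partial>lborel)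
    + (\<integral>y. beta_density a b y *\<^sub>R ((\<i> * of_real w) * cis (w * y)) \<partial>lborel) = 0"
  proof (rule beta_parts[OF b _ _ i1 i2])
    show "((\<lambda>y. cis (w * y) - 1) has_vector_derivative (\<i> * of_real w) * cis (w * y)) (at y)" for y
      using has_vector_derivative_diff[OF cis_has_vector_derivative has_vector_derivative_const] by simp
    show "integrable lborel (\<lambda>y. beta_density a b y *\<^sub>R ((\<i> * of_real w) * cis (w * y)))"
      using assms by (intro integrable_beta_density_bounded[where B = "\<bar>w\<bar>"]) (auto simp: norm_mult)
    \<comment> \<open>The bound |cis(w y) - 1| <= w y dominates the product by w y^a, which tends to
      0, the value that \<open>powr\<close> assigns at y = 0.\<close>
    have c0: "continuous (at 0 within {0..1}) (\<lambda>y. y powr (a - 1) *\<^sub>R (cis (w * y) - 1))"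
    proof -
      have "((\<lambda>y. y powr (a - 1) *\<^sub>R (cis (w * y) - 1)) \<longlongrightarrow> 0) (at 0 within {0..1})"
      proof (rule Lim_null_comparison)
        show "\<forall>\<^sub>F y in at 0 within {0..1}. norm (y powr (a - 1) *\<^sub>R (cis (w * y) - 1)) \<le> w * y powr a"
          unfolding eventually_at_filter
        proof (intro always_eventually allI impI)
          fix y :: real assume y: "y \<noteq> 0" "y \<in> {0..1}"
          have "y powr (a - 1) * norm (cis (w * y) - 1) \<le> y powr (a - 1) * (w * y)"
            using y by (intro mult_left_mono norm_le) auto
          also have "\<dots> = w * y powr a" using y powr_mult_base[of y "a - 1"] by (simp add: mult_ac)
          finally show "norm (y powr (a - 1) *\<^sub>R (cis (w * y) - 1)) \<le> w * y powr a" by simp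
        qed
        have "continuous_on {0..1} (\<lambda>y. w * y powr a)"
          using a by (intro continuous_intros continuous_on_powr') auto
        then show "((\<lambda>y. w * y powr a) \<longlongrightarrow> 0) (at 0 within {0..1})"
          using a by (auto simp: continuous_on_def dest!: bspec[where x = 0])
      qed
      then show ?thesis by (simp add: continuous_within)
    qed
    have "continuous_on {0..1} (\<lambda>y. y powr (a - 1) *\<^sub>R (cis (w * y) - 1))"
      unfolding continuous_on_eq_continuous_within
    proof
      fix y :: real assume y: "y \<in> {0..1}"
      show "continuous (at y within {0..1}) (\<lambda>y. y powr (a - 1) *\<^sub>R (cis (w * y) - 1))"
      proof (cases "y = 0")
        case False
        then have "y > 0" using y by auto
        then have "isCont (\<lambda>y. y powr (a - 1)) y"
          using DERIV_isCont has_real_derivative_powr by blast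
        moreover have "isCont (\<lambda>y. cis (w * y) - 1) y"
          using cis_has_vector_derivative[of w y] by (intro continuous_diff continuous_const) (rule has_vector_derivative_continuous)
        ultimately show ?thesis
          by (rule continuous_at_imp_continuous_at_within[OF continuous_scaleR])
      qed (use c0 in simp)
    qed
    moreover have "continuous_on {0..1} (\<lambda>y::real. (1 - y) powr (b - 1))"
      using b by (intro continuous_intros continuous_on_powr') auto
    ultimately have "continuous_on {0..1} (\<lambda>y. (1 - y) powr (b - 1) *\<^sub>R (y powr (a - 1) *\<^sub>R (cis (w * y) - 1)))"
      by (rule continuous_on_scaleR[rotated])
    then show "continuous_on {0..1} (\<lambda>y. (y powr (a - 1) * (1 - y) powr (b - 1)) *\<^sub>R (cis (w * y) - 1))"
      by (simp add: mult.commute)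
  qed
  moreover have "(\<integral>y. beta_density a b y *\<^sub>R ((\<i> * of_real w) * cis (w * y)) \<partial>lborel) = (\<i> * of_real w) * cusp a b w"
    unfolding cusp_def by (simp add: mult.left_commute flip: integral_mult_right_zero)
  moreover have "(\<integral>y. beta_density a (b - 1) y *\<^sub>R (cis (w * y) - 1) \<partial>lborel) = cusp a (b - 1) w - of_real (Beta a (b - 1))"
    using cusp_0[of a "b - 1"] integrable_cusp[of a "b - 1" w] integrable_cusp[of a "b - 1" 0] a b
    by (simp add: cusp_def scaleR_diff_right)
  ultimately have "of_real (a - 1) * cusp1 a b w - of_real (b - 1) * (cusp a (b - 1) w - of_real (Beta a (b - 1))) + \<i> * of_real w * cusp a b w = 0"
    by (simp add: cusp1_def scaleR_conv_of_real)
  then have "\<i> * (of_real (a - 1) * cusp1 a b w - of_real (b - 1) * (cusp a (b - 1) w - of_real (Beta a (b - 1))) + \<i> * of_real w * cusp a b w) = 0"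
    by simp
  then show ?thesis by (simp add: algebra_simps flip: mult.assoc)
qed


section \<open>Asymptotics of the oscillatory integral\<close>

lemma integral_powr_Icc:
  fixes p r :: real
  assumes "p > -1" "r \<ge> 0"
  shows "integrable lborel (\<lambda>u. indicator {0..r} u * u powr p)"
    and "(\<integral>u. indicator {0..r} u * u powr p \<partial>lborel) = r powr (p + 1) / (p + 1)"
proof -
  have H: "((\<lambda>u. u powr p) has_integral r powr (p + 1) / (p + 1)) {0..r}"
    using assms by (intro has_integral_powr_from_0)
  then have "(\<lambda>u. u powr p) absolutely_integrable_on {0..r}"
    by (intro nonnegative_absolutely_integrable_1) (auto simp: integrable_on_def)
  then have "set_integrable lborel {0..r} (\<lambda>u. u powr p)"
    unfolding set_integrable_def by (subst (asm) integrable_completion) auto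
  then show "integrable lborel (\<lambda>u. indicator {0..r} u * u powr p)"
    "(\<integral>u. indicator {0..r} u * u powr p \<partial>lborel) = r powr (p + 1) / (p + 1)"
    using set_borel_integral_eq_integral(2)[of "{0..r}" "\<lambda>u. u powr p"] integral_unique[OF H]
    by (simp_all add: set_integrable_def set_lebesgue_integral_def)
qed

text \<open>Majorant for the dominated convergence below, coming from |cis u - 1| <= min(u, 2): a >
  0 makes it integrable at 0 and a < 1 at infinity.\<close>

lemma powr_min_integrable:
  fixes a :: real
  assumes "0 < a" "a < 1"
  shows "integrable lborel (\<lambda>u. indicator {0..1} u * u powr (a - 1) + indicator {1..} u * (2 * u powr (a - 2)))"
proof (rule Bochner_Integration.integrable_add)
  show "integrable lborel (\<lambda>u. indicator {0..1} u * u powr (a - 1))"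
    using assms by (intro integral_powr_Icc) auto
  have "(\<lambda>u. u powr (a - 2)) absolutely_integrable_on {1..}"
    using assms has_integral_powr_to_inf[of "a - 2" 1]
    by (intro nonnegative_absolutely_integrable_1) (auto simp: integrable_on_def)
  then have "integrable lborel (\<lambda>u. indicator {1..} u *\<^sub>R u powr (a - 2))"
    unfolding set_integrable_def by (subst (asm) integrable_completion) auto
  then have "integrable lborel (\<lambda>u. 2 * (indicator {1..} u *\<^sub>R u powr (a - 2)))"
    by (rule integrable_mult_right)
  then show "integrable lborel (\<lambda>u::real. indicator {1..} u * (2 * u powr (a - 2)))"
    by (simp add: mult_ac)
qed

lemma cusp1_dominated:
  assumes "a < 1"
  shows "norm ((indicator {0..} u * u powr (a - 2)) *\<^sub>R (cis u - 1))
    \<le> indicator {0..1} u * u powr (a - 1) + indicator {1..} u * (2 * u powr (a - 2))"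
proof -
  consider "u \<le> 0" | "0 < u" "u < 1" | "u \<ge> 1" by linarith
  then show ?thesis
  proof cases
    case 1
    then show ?thesis by (cases "u = 0") (auto simp: indicator_def)
  next
    case 2
    have "u powr (a - 2) * norm (cis u - 1) \<le> u powr (a - 2) * u"
      using norm_cis_minus_1(1)[of u] 2 by (intro mult_left_mono) auto
    also have "\<dots> = u powr (a - 1)" using powr_mult_base[of u "a - 2"] 2 by (simp add: mult.commute)
    finally show ?thesis using 2 by (simp add: indicator_def)
  next
    case 3
    have "u powr (a - 2) * norm (cis u - 1) \<le> u powr (a - 2) * 2"
      using norm_cis_minus_1(2)[of u] 3 by (intro mult_left_mono) auto
    then show ?thesis using 3 by (simp add: indicator_def mult.commute add_increasing)
  qed
qed

text \<open>Classically Gamma(a - 1) e^(i pi (a - 1)/2) for 0 < a < 1. It enters only through being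
  nonzero; its argument is absorbed into the phase \<open>phi\<close>.\<close>

definition cusp_limit :: "real \<Rightarrow> complex" where
  "cusp_limit a = (\<integral>u. (indicator {0..} u * u powr (a - 2)) *\<^sub>R (cis u - 1) \<partial>lborel)"

text \<open>Substitute u = w y: the power of w scales out, and (1 - u/w)^(b - 1) tends to 1
  boundedly. The limit is therefore the same for all b, which the induction on a exploits.\<close>

lemma cusp1_limit:
  assumes a: "0 < a" "a < 1" and b: "b > 1"
  shows "((\<lambda>w. w powr (a - 1) *\<^sub>R cusp1 a b w) \<longlongrightarrow> cusp_limit a) at_top"
proof -
  define s where "s w u = (indicator {0..w} u * u powr (a - 2) * (1 - u / w) powr (b - 1)) *\<^sub>R (cis u - 1)" for w u
  have "((\<lambda>w. \<integral>u. s w u \<partial>lborel) \<longlongrightarrow> cusp_limit a) at_top"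
    unfolding cusp_limit_def
  proof (rule integral_dominated_convergence_at_top)
    show "integrable lborel (\<lambda>u. indicator {0..1} u * u powr (a - 1) + indicator {1..} u * (2 * u powr (a - 2)))"
      by (rule powr_min_integrable[OF a])
    show "AE u in lborel. ((\<lambda>w. s w u) \<longlongrightarrow> (indicator {0..} u * u powr (a - 2)) *\<^sub>R (cis u - 1)) at_top"
    proof (rule AE_I2)
      fix u :: real
      show "((\<lambda>w. s w u) \<longlongrightarrow> (indicator {0..} u * u powr (a - 2)) *\<^sub>R (cis u - 1)) at_top"
      proof (cases "u \<ge> 0")
        case True
        have "((\<lambda>w. u / w) \<longlongrightarrow> 0) at_top"
          by (intro tendsto_divide_0[OF tendsto_const] filterlim_at_top_imp_at_infinity filterlim_ident)
        then have "((\<lambda>w. (1 - u / w) powr (b - 1)) \<longlongrightarrow> (1 - 0) powr (b - 1)) at_top"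
          by (intro tendsto_intros) auto
        then have "((\<lambda>w. (u powr (a - 2) * (1 - u / w) powr (b - 1)) *\<^sub>R (cis u - 1)) \<longlongrightarrow> (u powr (a - 2) * (1 - 0) powr (b - 1)) *\<^sub>R (cis u - 1)) at_top"
          by (intro tendsto_scaleR tendsto_mult tendsto_const)
        moreover have "\<forall>\<^sub>F w in at_top. (u powr (a - 2) * (1 - u / w) powr (b - 1)) *\<^sub>R (cis u - 1) = s w u"
          using eventually_ge_at_top[of u] by eventually_elim (use True in \<open>auto simp: s_def indicator_def\<close>)
        ultimately show ?thesis using True by (auto elim: Lim_transform_eventually)
      next
        case False
        then show ?thesis by (simp add: s_def indicator_def)
      qed
    qed
    show "\<forall>\<^sub>F w in at_top. AE u in lborel. norm (s w u) \<le> indicator {0..1} u * u powr (a - 1) + indicator {1..} u * (2 * u powr (a - 2))"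
      using eventually_gt_at_top[of 0]
    proof eventually_elim
      fix w :: real assume w: "w > 0"
      show "AE u in lborel. norm (s w u) \<le> indicator {0..1} u * u powr (a - 1) + indicator {1..} u * (2 * u powr (a - 2))"
      proof (rule AE_I2)
        fix u :: real
        have "norm (s w u) \<le> norm ((indicator {0..} u * u powr (a - 2)) *\<^sub>R (cis u - 1))"
        proof (cases "u \<in> {0..w}")
          case True
          then have "0 \<le> 1 - u / w" "1 - u / w \<le> 1" using w by auto
          then have "(1 - u / w) powr (b - 1) \<le> 1" using b by (intro powr_le1) auto
          then have "u powr (a - 2) * (1 - u / w) powr (b - 1) * norm (cis u - 1) \<le> u powr (a - 2) * 1 * norm (cis u - 1)"
            by (intro mult_right_mono mult_left_mono) auto
          then show ?thesis using True by (simp add: s_def)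
        qed (simp add: s_def)
        then show "norm (s w u) \<le> indicator {0..1} u * u powr (a - 1) + indicator {1..} u * (2 * u powr (a - 2))"
          using cusp1_dominated[OF a(2), of u] by linarith
      qed
    qed
  qed (auto simp: s_def[abs_def])
  moreover have "(\<integral>u. s w u \<partial>lborel) = w powr (a - 1) *\<^sub>R cusp1 a b w" if w: "w > 0" for w
  proof -
    have eq: "s w (0 + w * y) = w powr (a - 2) *\<^sub>R (beta_density (a - 1) b y *\<^sub>R (cis (w * y) - 1))" for y
      using w by (auto simp: s_def beta_density_def indicator_def powr_mult zero_le_mult_iff mult_ac)
    have "(\<integral>u. s w u \<partial>lborel) = w *\<^sub>R (\<integral>y. s w (0 + w * y) \<partial>lborel)"
      using lborel_integral_real_affine[of w "s w" 0] w by simp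
    also have "\<dots> = (w * w powr (a - 2)) *\<^sub>R cusp1 a b w"
      unfolding eq cusp1_def integral_scaleR_right by simp
    also have "w * w powr (a - 2) = w powr (a - 1)" using powr_mult_base[of w "a - 2"] w by simp
    finally show ?thesis .
  qed
  then have "\<forall>\<^sub>F w in at_top. (\<integral>u. s w u \<partial>lborel) = w powr (a - 1) *\<^sub>R cusp1 a b w"
    by (rule eventually_mono[OF eventually_gt_at_top])
  ultimately show ?thesis by (rule Lim_transform_eventually)
qed

text \<open>The real part of the integrand is u^(a - 2) (cos u - 1) <= 0. On [pi/2, pi] one has 1 -
  cos u >= 1, so this interval alone makes the real part of the integral negative.\<close>

lemma cusp_limit_nonzero:
  assumes a: "0 < a" "a < 1"
  shows "cusp_limit a \<noteq> 0"
proof -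
  let ?f = "\<lambda>u. (indicator {0..} u * u powr (a - 2)) *\<^sub>R (cis u - 1)"
  have int: "integrable lborel ?f"
    by (rule Bochner_Integration.integrable_bound[OF powr_min_integrable[OF a]])
       (use cusp1_dominated[OF a(2)] in \<open>auto intro!: AE_I2 order_trans[OF _ abs_ge_self]\<close>)
  have "0 < pi powr (a - 2) * (pi / 2)" by simp
  also have "\<dots> = (\<integral>u. indicator {pi/2..pi} u * pi powr (a - 2) \<partial>lborel)" by simp
  also have "\<dots> \<le> (\<integral>u. - Re (?f u) \<partial>lborel)"
  proof (rule integral_mono)
    show "integrable lborel (\<lambda>u. - Re (?f u))" using int by (intro integrable_minus integrable_Re)
    fix u :: real
    show "indicator {pi/2..pi} u * pi powr (a - 2) \<le> - Re (?f u)"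
    proof (cases "u \<in> {pi/2..pi}")
      case True
      have u0: "u > 0" using True pi_half_gt_zero unfolding atLeastAtMost_iff by linarith
      have "cos u \<le> cos (pi / 2)" using True by (intro cos_monotone_0_pi_le) auto
      moreover have "pi powr (a - 2) \<le> u powr (a - 2)" using True a u0 by (intro powr_mono2') auto
      ultimately have "pi powr (a - 2) * 1 \<le> u powr (a - 2) * (1 - cos u)" by (intro mult_mono) auto
      then show ?thesis using True u0 by (simp add: algebra_simps)
    next
      case False
      have "u powr (a - 2) * (1 - cos u) \<ge> 0" by simp
      then have "0 \<le> - Re (?f u)" by (simp add: indicator_def algebra_simps)
      moreover have z: "indicator {pi/2..pi} u = (0::real)" using False by simp
      ultimately show ?thesis unfolding z by simp
    qed
  qed simp
  also have "\<dots> = - Re (cusp_limit a)"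
    using int unfolding cusp_limit_def by (simp del: scaleR_complex.sel)
  finally show ?thesis by auto
qed

text \<open>The order of quantifiers matters: one Z serves all b. For a < 1 the leading term comes
  from \<open>cusp1\<close>. For a = 1 that term has the factor a - 1 = 0, and the constant Beta 1
  (b - 1) takes over; (b - 1) * Beta 1 (b - 1) = 1 makes the limit free of b.\<close>

lemma cusp_asymptotic_base:
  assumes "0 < a" "a \<le> 1"
  shows "\<exists>Z. Z \<noteq> 0 \<and> (\<forall>b\<ge>3. ((\<lambda>w. w powr a *\<^sub>R cusp a b w) \<longlongrightarrow> Z) at_top)"
proof (cases "a = 1")
  case True
  have "((\<lambda>w. w powr a *\<^sub>R cusp a b w) \<longlongrightarrow> \<i>) at_top" if b: "b \<ge> 3" for b
  proof -
    have w_cusp: "of_real w * cusp 1 c w = - (\<i> * of_real (c - 1) * (cusp 1 (c - 1) w - of_real (Beta 1 (c - 1))))"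
      if "c > 1" "w > 0" for c w :: real
      using cusp_recursion_base[of 1 c w] that by simp
    \<comment> \<open>The recursion applied once more, at b - 1, gives O(1/w). It leads to the
      exponent b - 2, which is positive because b >= 3.\<close>
    have "((\<lambda>w. cusp 1 (b - 1) w) \<longlongrightarrow> 0) at_top"
    proof (rule Lim_null_comparison)
      show "\<forall>\<^sub>F w in at_top. norm (cusp 1 (b - 1) w) \<le> (b - 2) * (2 * Beta 1 (b - 2)) / w"
        using eventually_gt_at_top[of 0]
      proof eventually_elim
        fix w :: real assume w: "w > 0"
        have pos: "Beta 1 (b - 2) \<ge> 0" using b by (intro Beta_nonneg) auto
        have "w * norm (cusp 1 (b - 1) w) = norm (of_real w * cusp 1 (b - 1) w)" using w by (simp add: norm_mult)
        also have "\<dots> = (b - 2) * norm (cusp 1 (b - 2) w - of_real (Beta 1 (b - 2)))"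
          using w_cusp[of "b - 1" w] b w by (simp add: norm_mult del: of_real_diff)
        also have "\<dots> \<le> (b - 2) * (2 * Beta 1 (b - 2))"
        proof (rule mult_left_mono)
          have "norm (cusp 1 (b - 2) w - of_real (Beta 1 (b - 2))) \<le> norm (cusp 1 (b - 2) w) + norm (of_real (Beta 1 (b - 2)) :: complex)"
            by (rule norm_triangle_ineq4)
          then show "norm (cusp 1 (b - 2) w - of_real (Beta 1 (b - 2))) \<le> 2 * Beta 1 (b - 2)"
            using norm_cusp_le[of 1 "b - 2" w] b pos by simp
        qed (use b in auto)
        finally show "norm (cusp 1 (b - 1) w) \<le> (b - 2) * (2 * Beta 1 (b - 2)) / w"
          using w by (simp add: field_simps)
      qed
      show "((\<lambda>w. (b - 2) * (2 * Beta 1 (b - 2)) / w) \<longlongrightarrow> 0) at_top"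
        by (intro tendsto_divide_0[OF tendsto_const] filterlim_at_top_imp_at_infinity filterlim_ident)
    qed
    then have L: "((\<lambda>w. - (\<i> * of_real (b - 1) * (cusp 1 (b - 1) w - of_real (Beta 1 (b - 1))))) \<longlongrightarrow>
      - (\<i> * of_real (b - 1) * (0 - of_real (Beta 1 (b - 1))))) at_top"
      by (intro tendsto_intros)
    have E: "- (\<i> * of_real (b - 1) * (0 - of_real (Beta 1 (b - 1)))) = \<i>"
    proof -
      have "Gamma (b - 1 + 1) = (b - 1) * Gamma (b - 1)"
        using b by (intro Gamma_plus1) (auto elim!: nonpos_Ints_cases)
      moreover have "Gamma (b - 1) \<noteq> 0" using b Gamma_real_pos[of "b - 1"] by linarith
      ultimately have "(b - 1) * Beta 1 (b - 1) = 1" using b by (simp add: Beta_def add.commute)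
      then have "complex_of_real (b - 1) * of_real (Beta 1 (b - 1)) = 1" by (metis of_real_1 of_real_mult)
      then show ?thesis by (simp add: mult.assoc del: of_real_diff)
    qed
    note L[unfolded E]
    moreover have "\<forall>\<^sub>F w in at_top. - (\<i> * of_real (b - 1) * (cusp 1 (b - 1) w - of_real (Beta 1 (b - 1)))) = w powr a *\<^sub>R cusp a b w"
      using eventually_gt_at_top[of 0]
    proof eventually_elim
      fix w :: real assume "w > 0"
      then show "- (\<i> * of_real (b - 1) * (cusp 1 (b - 1) w - of_real (Beta 1 (b - 1)))) = w powr a *\<^sub>R cusp a b w"
        using w_cusp[of b w] b True by (simp add: scaleR_conv_of_real)
    qed
    ultimately show ?thesis by (rule Lim_transform_eventually)
  qed
  then show ?thesis by (intro exI[of _ "\<i>"]) auto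
next
  case False
  then have a: "0 < a" "a < 1" using assms by auto
  have "((\<lambda>w. w powr a *\<^sub>R cusp a b w) \<longlongrightarrow> \<i> * (of_real (a - 1) * cusp_limit a - 0)) at_top" if b: "b \<ge> 3" for b
  proof -
    define g where "g w = cusp a (b - 1) w - of_real (Beta a (b - 1))" for w
    have pos: "Beta a (b - 1) \<ge> 0" using a b by (intro Beta_nonneg) auto
    have g: "norm (g w) \<le> 2 * Beta a (b - 1)" for w
    proof -
      have "norm (g w) \<le> norm (cusp a (b - 1) w) + norm (of_real (Beta a (b - 1)) :: complex)"
        unfolding g_def by (rule norm_triangle_ineq4)
      then show ?thesis using norm_cusp_le[of a "b - 1" w] a b pos by simp
    qed
    have "((\<lambda>w. w powr (a - 1) *\<^sub>R (of_real (b - 1) * g w)) \<longlongrightarrow> 0) at_top"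
    proof (rule Lim_null_comparison)
      show "\<forall>\<^sub>F w in at_top. norm (w powr (a - 1) *\<^sub>R (of_real (b - 1) * g w)) \<le> w powr (a - 1) * ((b - 1) * (2 * Beta a (b - 1)))"
      proof (rule always_eventually, rule allI)
        fix w
        have "norm (of_real (b - 1) * g w) \<le> (b - 1) * (2 * Beta a (b - 1))"
          unfolding norm_mult using g[of w] b by (intro mult_mono) (auto simp del: of_real_diff)
        then show "norm (w powr (a - 1) *\<^sub>R (of_real (b - 1) * g w)) \<le> w powr (a - 1) * ((b - 1) * (2 * Beta a (b - 1)))"
          unfolding norm_scaleR by (intro mult_mono) auto
      qed
      have "((\<lambda>w. w powr (a - 1)) \<longlongrightarrow> 0) at_top" using a by (intro tendsto_neg_powr filterlim_ident) auto
      then show "((\<lambda>w. w powr (a - 1) * ((b - 1) * (2 * Beta a (b - 1)))) \<longlongrightarrow> 0) at_top"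
        by (rule tendsto_mult_left_zero)
    qed
    moreover have "((\<lambda>w. w powr (a - 1) *\<^sub>R cusp1 a b w) \<longlongrightarrow> cusp_limit a) at_top"
      using a b by (intro cusp1_limit) auto
    ultimately have "((\<lambda>w. \<i> * (of_real (a - 1) * (w powr (a - 1) *\<^sub>R cusp1 a b w) - w powr (a - 1) *\<^sub>R (of_real (b - 1) * g w)))
        \<longlongrightarrow> \<i> * (of_real (a - 1) * cusp_limit a - 0)) at_top"
      by (intro tendsto_intros)
    moreover have "\<forall>\<^sub>F w in at_top. \<i> * (of_real (a - 1) * (w powr (a - 1) *\<^sub>R cusp1 a b w) - w powr (a - 1) *\<^sub>R (of_real (b - 1) * g w))
       = w powr a *\<^sub>R cusp a b w"
      using eventually_gt_at_top[of 0]
    proof eventually_elim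
      fix w :: real assume w: "w > 0"
      have "w powr a *\<^sub>R cusp a b w = w powr (a - 1) *\<^sub>R (of_real w * cusp a b w)"
        using powr_mult_base[of w "a - 1"] w by (simp add: scaleR_conv_of_real mult_ac flip: of_real_mult)
      also have "of_real w * cusp a b w = \<i> * (of_real (a - 1) * cusp1 a b w - of_real (b - 1) * g w)"
        unfolding g_def using cusp_recursion_base[of a b w] a b w by simp
      finally show "\<i> * (of_real (a - 1) * (w powr (a - 1) *\<^sub>R cusp1 a b w) - w powr (a - 1) *\<^sub>R (of_real (b - 1) * g w))
       = w powr a *\<^sub>R cusp a b w"
        by (simp add: scaleR_conv_of_real algebra_simps)
    qed
    ultimately show ?thesis by (rule Lim_transform_eventually)
  qed
  moreover have "\<i> * (of_real (a - 1) * cusp_limit a - 0) \<noteq> 0" using cusp_limit_nonzero[OF a] a by simp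
  ultimately show ?thesis by blast
qed

text \<open>Integration by parts passes from \<open>a - 1\<close> to \<open>a\<close>. The extra term, with exponent \<open>b - 1\<close>, is by
  \<open>cusp_diff\<close> a difference of two integrals with the same leading term, so it is negligible.\<close>

lemma cusp_asymptotic_nat:
  "0 < a \<Longrightarrow> a \<le> real n + 1 \<Longrightarrow>
    \<exists>Z b0. Z \<noteq> 0 \<and> (\<forall>b\<ge>b0. ((\<lambda>w. w powr a *\<^sub>R cusp a b w) \<longlongrightarrow> Z) at_top)"
proof (induction n arbitrary: a)
  case 0
  then show ?case using cusp_asymptotic_base[of a] by auto
next
  case (Suc n)
  show ?case
  proof (cases "a \<le> 1")
    case True
    then show ?thesis using cusp_asymptotic_base[of a] Suc by auto
  next
    case False
    then have "0 < a - 1" "a - 1 \<le> real n + 1" using Suc by auto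
    from Suc.IH[OF this] obtain Z b0 where Z: "Z \<noteq> 0"
      "\<And>b. b \<ge> b0 \<Longrightarrow> ((\<lambda>w. w powr (a - 1) *\<^sub>R cusp (a - 1) b w) \<longlongrightarrow> Z) at_top" by blast
    \<comment> \<open>Both b and b - 1 must be at least b0, so that the induction hypothesis gives
      the same Z for each, and b > 1 is required by \<open>cusp_recursion\<close>.\<close>
    have "((\<lambda>w. w powr a *\<^sub>R cusp a b w) \<longlongrightarrow> \<i> * (of_real (a - 1) * Z - of_real (b - 1) * (Z - Z))) at_top"
      if b: "b \<ge> max (b0 + 1) 2" for b
    proof -
      have "((\<lambda>w. \<i> * (of_real (a - 1) * (w powr (a - 1) *\<^sub>R cusp (a - 1) b w)
          - of_real (b - 1) * (w powr (a - 1) *\<^sub>R cusp (a - 1) (b - 1) w - w powr (a - 1) *\<^sub>R cusp (a - 1) b w)))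
          \<longlongrightarrow> \<i> * (of_real (a - 1) * Z - of_real (b - 1) * (Z - Z))) at_top"
        using b by (intro tendsto_intros Z(2)) auto
      moreover have "\<forall>\<^sub>F w in at_top. \<i> * (of_real (a - 1) * (w powr (a - 1) *\<^sub>R cusp (a - 1) b w)
          - of_real (b - 1) * (w powr (a - 1) *\<^sub>R cusp (a - 1) (b - 1) w - w powr (a - 1) *\<^sub>R cusp (a - 1) b w))
          = w powr a *\<^sub>R cusp a b w"
        using eventually_gt_at_top[of 0]
      proof eventually_elim
        fix w :: real assume w: "w > 0"
        have "w powr a *\<^sub>R cusp a b w = w powr (a - 1) *\<^sub>R (of_real w * cusp a b w)"
          using powr_mult_base[of w "a - 1"] w by (simp add: scaleR_conv_of_real mult_ac flip: of_real_mult)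
        also have "of_real w * cusp a b w = \<i> * (of_real (a - 1) * cusp (a - 1) b w - of_real (b - 1) * cusp a (b - 1) w)"
          using False b by (intro cusp_recursion) auto
        also have "cusp a (b - 1) w = cusp (a - 1) (b - 1) w - cusp (a - 1) b w"
          using cusp_diff[of "a - 1" "b - 1" w] False b by simp
        finally show "\<i> * (of_real (a - 1) * (w powr (a - 1) *\<^sub>R cusp (a - 1) b w)
          - of_real (b - 1) * (w powr (a - 1) *\<^sub>R cusp (a - 1) (b - 1) w - w powr (a - 1) *\<^sub>R cusp (a - 1) b w))
          = w powr a *\<^sub>R cusp a b w"
          by (simp add: scaleR_conv_of_real algebra_simps)
      qed
      ultimately show ?thesis by (rule Lim_transform_eventually)
    qed
    then have "((\<lambda>w. w powr a *\<^sub>R cusp a b w) \<longlongrightarrow> \<i> * (of_real (a - 1) * Z)) at_top"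
      if "b \<ge> max (b0 + 1) 2" for b
      using that by fastforce
    moreover have "\<i> * (of_real (a - 1) * Z) \<noteq> 0" using Z(1) False by simp
    ultimately show ?thesis by blast
  qed
qed

text \<open>Rotating by - Arg Z turns the limit into |Z| > 0, and half of it is a lower bound from
  some A on. This turns an asymptotic statement about a complex integral into a sign.\<close>

lemma cusp_phase:
  assumes "a > 0"
  shows "\<exists>b phi c A. b \<ge> 1 \<and> c > 0 \<and> A > 0 \<and> (\<forall>w\<ge>A. Re (cis phi * cusp a b w) \<ge> c * w powr (- a))"
proof -
  have "a \<le> real (nat \<lceil>a\<rceil>) + 1" by linarith
  from cusp_asymptotic_nat[OF assms this] obtain Z b0 where Z: "Z \<noteq> 0"
    "\<And>b. b \<ge> b0 \<Longrightarrow> ((\<lambda>w. w powr a *\<^sub>R cusp a b w) \<longlongrightarrow> Z) at_top" by blast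
  define b where "b = max b0 1"
  define phi where "phi = - Arg Z"
  have "((\<lambda>w. Re (cis phi * (w powr a *\<^sub>R cusp a b w))) \<longlongrightarrow> Re (cis phi * Z)) at_top"
    by (intro tendsto_intros Z(2)) (simp add: b_def)
  moreover have "cis phi * Z = of_real (norm Z)"
  proof -
    have "cis phi * Z = cis phi * (of_real (norm Z) * cis (Arg Z))"
      using rcis_cmod_Arg[of Z] by (simp add: rcis_def)
    also have "\<dots> = of_real (norm Z) * (cis phi * cis (Arg Z))" by (simp only: mult_ac)
    also have "\<dots> = of_real (norm Z)" by (simp add: cis_mult phi_def)
    finally show ?thesis .
  qed
  ultimately have "((\<lambda>w. Re (cis phi * (w powr a *\<^sub>R cusp a b w))) \<longlongrightarrow> norm Z) at_top" by simp
  then have "\<forall>\<^sub>F w in at_top. norm Z / 2 < Re (cis phi * (w powr a *\<^sub>R cusp a b w))"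
    using Z(1) by (intro order_tendstoD(1)) auto
  then obtain A where A: "\<And>w. w \<ge> A \<Longrightarrow> norm Z / 2 < Re (cis phi * (w powr a *\<^sub>R cusp a b w))"
    by (auto simp: eventually_at_top_linorder)
  have "Re (cis phi * cusp a b w) \<ge> norm Z / 2 * w powr (- a)" if "w \<ge> max A 1" for w
  proof -
    have w: "w > 0" using that by auto
    have "norm Z / 2 * w powr (- a) \<le> Re (cis phi * (w powr a *\<^sub>R cusp a b w)) * w powr (- a)"
      using A[of w] that by (intro mult_right_mono) auto
    also have "\<dots> = (w powr a * w powr (- a)) * Re (cis phi * cusp a b w)" by (simp add: algebra_simps)
    also have "w powr a * w powr (- a) = 1" using w by (simp flip: powr_add)
    finally show ?thesis by simp
  qed
  then show ?thesis using Z(1)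
    by (intro exI[of _ b] exI[of _ phi] exI[of _ "norm Z / 2"] exI[of _ "max A 1"]) (auto simp: b_def)
qed

section \<open>Poisson's integral\<close>

text \<open>Turns the moments of the Beta weight with first parameter 1/2 into the factorials (2 m)!
  of the cosine series.\<close>

lemma Gamma_half_fact: "Gamma (real m + 1/2) * 4 ^ m * fact m = fact (2 * m) * sqrt pi"
proof (induction m)
  case 0
  then show ?case using Gamma_one_half_real by simp
next
  case (Suc m)
  have "Gamma (real (Suc m) + 1/2) = Gamma ((real m + 1/2) + 1)" by (simp add: add_ac)
  also have "\<dots> = (real m + 1/2) * Gamma (real m + 1/2)"
    by (intro Gamma_plus1) (auto elim!: nonpos_Ints_cases)
  finally have "Gamma (real (Suc m) + 1/2) * 4 ^ Suc m * fact (Suc m)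
      = (4 * (real m + 1/2) * (real m + 1)) * (Gamma (real m + 1/2) * 4 ^ m * fact m)"
    by (simp add: algebra_simps)
  also have "\<dots> = ((2 * real m + 2) * (2 * real m + 1)) * (fact (2 * m) * sqrt pi)"
    unfolding Suc by (simp add: algebra_simps)
  also have "\<dots> = fact (2 * Suc m) * sqrt pi" by (simp add: algebra_simps)
  finally show ?case .
qed

lemma beta_density_power: "beta_density a b t * t ^ m = beta_density (a + real m) b t"
proof (cases "t > 0")
  case True
  then have "t powr (a + real m - 1) = t powr (a - 1) * t ^ m"
    by (simp add: powr_realpow[symmetric] powr_add[symmetric] algebra_simps)
  then show ?thesis by (simp add: beta_density_def)
next
  case False
  then show ?thesis by (cases "t = 0") (auto simp: beta_density_def indicator_def)
qed

context bessel
begin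

definition kappa :: real where "kappa = 1 / (Gamma (nu + 1/2) * sqrt pi)"

lemma kappa_pos: "kappa > 0"
  using nu by (simp add: kappa_def Gamma_real_pos)

text \<open>The usual form integrates (1 - t^2)^(nu - 1/2) cos(x t) over [-1, 1]. Writing t for t^2
  makes the weight a Beta density; expanding the cosine, each moment is a Beta value, and the series
  of \<open>bessel_entire\<close> appears term by term.\<close>

lemma poisson_integral:
  "bessel_entire nu (x\<^sup>2 / 4) = kappa * (\<integral>t. beta_density (1/2) (nu + 1/2) t * cos (x * sqrt t) \<partial>lborel)"
proof -
  let ?W = "beta_density (1/2) (nu + 1/2)"
  define f where "f m t = ?W t * ((-1) ^ m / fact (2 * m) * (x * sqrt t) ^ (2 * m))" for m t
  have f: "f m t = (-1) ^ m / fact (2 * m) * x ^ (2 * m) * beta_density (1/2 + real m) (nu + 1/2) t" for m t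
  proof (cases "t \<ge> 0")
    case True
    then have "(x * sqrt t) ^ (2 * m) = x ^ (2 * m) * t ^ m" by (simp add: power_mult_distrib power_mult)
    then show ?thesis using beta_density_power[of "1/2" "nu + 1/2" t m]
      by (simp add: f_def mult_ac)
  next
    case False
    then show ?thesis by (simp add: f_def beta_density_def)
  qed
  have pos: "0 < 1/2 + real m" "0 < nu + 1/2" for m using nu by auto
  have int: "integrable lborel (f m)" for m
    unfolding f using pos by (intro integrable_mult_right integrable_beta_density) auto
  have intf: "(\<integral>t. f m t \<partial>lborel) = (Gamma (nu + 1/2) * sqrt pi) * (bessel_coeff nu m * (x\<^sup>2 / 4) ^ m)" for m
  proof -
    have "(\<integral>t. f m t \<partial>lborel) = (-1) ^ m / fact (2 * m) * x ^ (2 * m) * Beta (1/2 + real m) (nu + 1/2)"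
      unfolding f using pos by (simp add: integral_beta_density)
    also have "Beta (1/2 + real m) (nu + 1/2) = Gamma (real m + 1/2) * Gamma (nu + 1/2) / Gamma (real m + nu + 1)"
      by (simp add: Beta_def add_ac)
    also have "Gamma (real m + 1/2) = fact (2 * m) * sqrt pi / (4 ^ m * fact m)"
      using Gamma_half_fact[of m] by (simp add: field_simps)
    finally show ?thesis
      by (simp add: bessel_coeff_def power_divide power_mult[symmetric] mult_ac)
  qed
  have norm_coeff: "norm ((-1) ^ m / fact (2 * m) :: real) = inverse (fact (2 * m))" for m
    by (simp add: norm_divide norm_power inverse_eq_divide del: real_norm_def)
  have abs_summable: "summable (\<lambda>m. inverse (fact (2 * m)) * \<bar>y\<bar> ^ (2 * m))" for y :: real
  proof -
    have "summable (\<lambda>n. inverse (fact n) * \<bar>y\<bar> ^ n)" by (rule summable_exp)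
    then have "summable ((\<lambda>n. inverse (fact n) * \<bar>y\<bar> ^ n) \<circ> (\<lambda>m. 2 * m))"
      by (rule summable_reindex) (auto simp: inj_on_def)
    then show ?thesis by (simp add: o_def)
  qed
  have "(\<lambda>m. \<integral>t. f m t \<partial>lborel) sums (\<integral>t. (\<Sum>m. f m t) \<partial>lborel)"
  proof (rule sums_integral[OF int])
    show "AE t in lborel. summable (\<lambda>m. norm (f m t))"
    proof (rule AE_I2)
      fix t :: real
      have "summable (\<lambda>m. ?W t * (inverse (fact (2 * m)) * \<bar>x * sqrt t\<bar> ^ (2 * m)))"
        by (rule summable_mult[OF abs_summable])
      moreover have "norm (f m t) = ?W t * (inverse (fact (2 * m)) * \<bar>x * sqrt t\<bar> ^ (2 * m))" for m
        unfolding f_def norm_mult norm_power norm_coeff by (simp add: abs_mult)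
      ultimately show "summable (\<lambda>m. norm (f m t))" by (simp only:)
    qed
    show "summable (\<lambda>m. \<integral>t. norm (f m t) \<partial>lborel)"
    proof (rule summable_comparison_test)
      have "(\<integral>t. norm (f m t) \<partial>lborel) \<le> Beta (1/2) (nu + 1/2) * (inverse (fact (2 * m)) * \<bar>x\<bar> ^ (2 * m))" for m
      proof -
        have le: "norm (f m t) \<le> (inverse (fact (2 * m)) * \<bar>x\<bar> ^ (2 * m)) * ?W t" for t
        proof -
          have "beta_density (1/2 + real m) (nu + 1/2) t \<le> ?W t"
          proof (cases "t \<in> {0..1}")
            case True
            then have "?W t * t ^ m \<le> ?W t * 1" by (intro mult_left_mono power_le_one) auto
            then show ?thesis using beta_density_power[of "1/2" "nu + 1/2" t m] by simp
          qed (simp add: beta_density_def)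
          then show ?thesis unfolding f norm_mult norm_power norm_coeff by (simp add: mult_left_mono)
        qed
        have "(\<integral>t. norm (f m t) \<partial>lborel) \<le> (\<integral>t. (inverse (fact (2 * m)) * \<bar>x\<bar> ^ (2 * m)) * ?W t \<partial>lborel)"
          using int[of m] pos(1)[of 0] pos(2) le by (intro integral_mono integrable_norm integrable_mult_right integrable_beta_density) auto
        then show ?thesis using pos(1)[of 0] pos(2) by (simp add: integral_beta_density mult_ac)
      qed
      then show "\<exists>N. \<forall>n\<ge>N. norm (\<integral>t. norm (f n t) \<partial>lborel) \<le> Beta (1/2) (nu + 1/2) * (inverse (fact (2 * n)) * \<bar>x\<bar> ^ (2 * n))"
        by simp
      show "summable (\<lambda>m. Beta (1/2) (nu + 1/2) * (inverse (fact (2 * m)) * \<bar>x\<bar> ^ (2 * m)))"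
        by (rule summable_mult[OF abs_summable])
    qed
  qed
  moreover have "(\<Sum>m. f m t) = ?W t * cos (x * sqrt t)" for t
  proof -
    have "(\<lambda>m. ?W t * ((-1) ^ m / fact (2 * m) * (x * sqrt t) ^ (2 * m))) sums (?W t * cos (x * sqrt t))"
      by (intro sums_mult cos_paired)
    then show ?thesis unfolding f_def by (rule sums_unique[symmetric])
  qed
  ultimately have "(\<lambda>m. (Gamma (nu + 1/2) * sqrt pi) * (bessel_coeff nu m * (x\<^sup>2 / 4) ^ m)) sums (\<integral>t. ?W t * cos (x * sqrt t) \<partial>lborel)"
    by (simp add: intf)
  moreover have "(\<lambda>m. (Gamma (nu + 1/2) * sqrt pi) * (bessel_coeff nu m * (x\<^sup>2 / 4) ^ m)) sums ((Gamma (nu + 1/2) * sqrt pi) * bessel_entire nu (x\<^sup>2 / 4))"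
    unfolding bessel_entire_def by (intro sums_mult summable_sums summable_bessel_entire nu)
  ultimately have "(\<integral>t. ?W t * cos (x * sqrt t) \<partial>lborel) = (Gamma (nu + 1/2) * sqrt pi) * bessel_entire nu (x\<^sup>2 / 4)"
    by (rule sums_unique2)
  moreover have "Gamma (nu + 1/2) \<noteq> 0" using nu Gamma_real_pos[of "nu + 1/2"] by linarith
  ultimately show ?thesis by (simp add: kappa_def)
qed

lemma bessel_entire_bounded: "0 \<le> z \<Longrightarrow> \<bar>bessel_entire nu z\<bar> \<le> kappa * Beta (1/2) (nu + 1/2)"
proof -
  assume z: "0 \<le> z"
  let ?I = "\<integral>t. beta_density (1/2) (nu + 1/2) t * cos (2 * sqrt z * sqrt t) \<partial>lborel"
  have "\<bar>?I\<bar> \<le> (\<integral>t. norm (beta_density (1/2) (nu + 1/2) t * cos (2 * sqrt z * sqrt t)) \<partial>lborel)"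
    unfolding real_norm_def by (rule integral_abs_bound)
  also have "\<dots> \<le> (\<integral>t. beta_density (1/2) (nu + 1/2) t \<partial>lborel)"
  proof (rule integral_mono')
    show "integrable lborel (beta_density (1/2) (nu + 1/2))" using nu by (intro integrable_beta_density) auto
    fix t :: real
    show "norm (beta_density (1/2) (nu + 1/2) t * cos (2 * sqrt z * sqrt t)) \<le> beta_density (1/2) (nu + 1/2) t"
      using mult_left_mono[OF abs_cos_le_one[of "2 * sqrt z * sqrt t"], of "beta_density (1/2) (nu + 1/2) t"]
      by (simp add: abs_mult)
  qed auto
  also have "\<dots> = Beta (1/2) (nu + 1/2)" using nu by (intro integral_beta_density) auto
  finally have "kappa * \<bar>?I\<bar> \<le> kappa * Beta (1/2) (nu + 1/2)" using kappa_pos by (intro mult_left_mono) auto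
  moreover have "bessel_entire nu z = kappa * ?I"
    using poisson_integral[of "2 * sqrt z"] z by (simp add: power_mult_distrib)
  ultimately show ?thesis using kappa_pos by (simp add: abs_mult)
qed

section \<open>Bessel transform of the test function\<close>

text \<open>For a = delta + nu + 3/2 and s = s_j this is, up to the factor \<open>amp j\<close>, the
  coefficient of the test function without cut-off: a - 1 adds the exponent 2 nu + 1 of
  \<open>mu\<close> to the exponent of the test function.\<close>

definition transform :: "real \<Rightarrow> real \<Rightarrow> real \<Rightarrow> real \<Rightarrow> real \<Rightarrow> real" where
  "transform a b phi R s = (\<integral>y. beta_density a b y * (cos (R * y + phi) * bessel_entire nu ((s * y)\<^sup>2 / 4)) \<partial>lborel)"

lemma integrable_transform:
  assumes "a > 0" "b > 0"
  shows "integrable lborel (\<lambda>y. beta_density a b y * (cos (R * y + phi) * bessel_entire nu ((s * y)\<^sup>2 / 4)))"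
proof -
  have "integrable lborel (\<lambda>y. beta_density a b y *\<^sub>R (cos (R * y + phi) * bessel_entire nu ((s * y)\<^sup>2 / 4)))"
  proof (rule integrable_beta_density_bounded[OF assms, where B = "1 * (kappa * Beta (1/2) (nu + 1/2))"])
    show "(\<lambda>y. cos (R * y + phi) * bessel_entire nu ((s * y)\<^sup>2 / 4)) \<in> borel_measurable borel"
      using borel_measurable_bessel_entire[OF nu, measurable] by measurable
    show "norm (cos (R * t + phi) * bessel_entire nu ((s * t)\<^sup>2 / 4)) \<le> 1 * (kappa * Beta (1/2) (nu + 1/2))" for t
      unfolding real_norm_def abs_mult by (intro mult_mono bessel_entire_bounded) auto
  qed
  then show ?thesis by simp
qed

text \<open>The function G of the overview, written with a real integrand.\<close>

definition phase_cusp :: "real \<Rightarrow> real \<Rightarrow> real \<Rightarrow> real \<Rightarrow> real" where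
  "phase_cusp a b phi w = (\<integral>y. beta_density a b y * cos (w * y + phi) \<partial>lborel)"

lemma integrable_phase_cusp: "a > 0 \<Longrightarrow> b > 0 \<Longrightarrow> integrable lborel (\<lambda>y. beta_density a b y * cos (w * y + phi))"
  using integrable_beta_density_bounded[of a b "\<lambda>y. cos (w * y + phi)" 1] by simp

lemma phase_cusp_eq:
  assumes "a > 0" "b > 0"
  shows "phase_cusp a b phi w = Re (cis phi * cusp a b w)"
proof -
  have int: "integrable lborel (\<lambda>y. cis phi * (beta_density a b y *\<^sub>R cis (w * y)))"
    by (intro integrable_mult_right integrable_cusp assms)
  have E: "Re (cis phi * (beta_density a b y *\<^sub>R cis (w * y))) = beta_density a b y * cos (w * y + phi)" for y
    by (simp add: cos_add algebra_simps)
  have I: "(\<integral>y. Re (cis phi * (beta_density a b y *\<^sub>R cis (w * y))) \<partial>lborel) = Re (cis phi * cusp a b w)"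
    unfolding integral_Re[OF int] cusp_def by (simp only: integral_mult_right_zero)
  show ?thesis unfolding phase_cusp_def by (rule I[unfolded E])
qed

lemma borel_measurable_phase_cusp [measurable]: "phase_cusp a b phi \<in> borel_measurable borel"
  unfolding phase_cusp_def[abs_def] by measurable

lemma phase_cusp_bounded: "a > 0 \<Longrightarrow> b > 0 \<Longrightarrow> \<bar>phase_cusp a b phi w\<bar> \<le> Beta a b"
proof -
  assume ab: "a > 0" "b > 0"
  have "\<bar>phase_cusp a b phi w\<bar> \<le> norm (cis phi * cusp a b w)"
    unfolding phase_cusp_eq[OF ab] by (rule abs_Re_le_cmod)
  then show ?thesis using norm_cusp_le[OF ab, of w] by (simp add: norm_mult)
qed

text \<open>Insert Poisson's integral, exchange the integrals, and split the product of the two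
  cosines into the frequencies R - s sqrt t and R + s sqrt t. The first of them carries the
  resonance at s = R.\<close>

lemma transform_eq:
  assumes ab: "a > 0" "b > 0"
  shows "transform a b phi R s = kappa * (\<integral>t. beta_density (1/2) (nu + 1/2) t *
    ((phase_cusp a b phi (R - s * sqrt t) + phase_cusp a b phi (R + s * sqrt t)) / 2) \<partial>lborel)"
proof -
  let ?W = "beta_density (1/2) (nu + 1/2)" and ?Y = "beta_density a b"
  define g where "g y t = cos (R * y + phi) * cos (s * y * sqrt t)" for y t
  have nu': "0 < nu + 1/2" using nu by auto
  have prod: "integrable (lborel \<Otimes>\<^sub>M lborel) (\<lambda>(y, t). ?Y y * ?W t)"
  proof (rule lborel_pair.Fubini_integrable)
    show "integrable lborel (\<lambda>y. \<integral>t. norm (case (y, t) of (y, t) \<Rightarrow> ?Y y * ?W t) \<partial>lborel)"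
      using ab nu' by (simp add: integral_beta_density integrable_beta_density)
    show "AE y in lborel. integrable lborel (\<lambda>t. case (y, t) of (y, t) \<Rightarrow> ?Y y * ?W t)"
      using nu' by (simp add: integrable_beta_density)
  qed measurable
  have int: "integrable (lborel \<Otimes>\<^sub>M lborel) (\<lambda>(y, t). ?Y y * (?W t * g y t))"
  proof (rule Bochner_Integration.integrable_bound[OF prod])
    show "(\<lambda>(y, t). ?Y y * (?W t * g y t)) \<in> borel_measurable (lborel \<Otimes>\<^sub>M lborel)"
      unfolding g_def by measurable
    have "norm (?Y y * (?W t * g y t)) \<le> norm (?Y y * ?W t)" for y t
    proof -
      have "\<bar>g y t\<bar> \<le> 1 * 1" unfolding g_def abs_mult by (intro mult_mono) auto
      then have "?Y y * (?W t * \<bar>g y t\<bar>) \<le> ?Y y * (?W t * 1)" by (intro mult_left_mono) auto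
      then show ?thesis by (simp add: abs_mult)
    qed
    then show "AE x in lborel \<Otimes>\<^sub>M lborel. norm (case x of (y, t) \<Rightarrow> ?Y y * (?W t * g y t)) \<le> norm (case x of (y, t) \<Rightarrow> ?Y y * ?W t)"
      by (intro AE_I2) (auto split: prod.split)
  qed
  have "transform a b phi R s = (\<integral>y. kappa * (\<integral>t. ?Y y * (?W t * g y t) \<partial>lborel) \<partial>lborel)"
    unfolding transform_def poisson_integral
  proof (rule Bochner_Integration.integral_cong[OF refl])
    fix y :: real
    have "(\<integral>t. ?Y y * (?W t * g y t) \<partial>lborel) = (\<integral>t. (?Y y * cos (R * y + phi)) * (?W t * cos (s * y * sqrt t)) \<partial>lborel)"
      by (simp add: g_def mult_ac)
    also have "\<dots> = (?Y y * cos (R * y + phi)) * (\<integral>t. ?W t * cos (s * y * sqrt t) \<partial>lborel)"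
      by (rule integral_mult_right_zero)
    finally have E: "(\<integral>t. ?Y y * (?W t * g y t) \<partial>lborel) = (?Y y * cos (R * y + phi)) * (\<integral>t. ?W t * cos (s * y * sqrt t) \<partial>lborel)" .
    show "?Y y * (cos (R * y + phi) * (kappa * (\<integral>t. ?W t * cos (s * y * sqrt t) \<partial>lborel)))
      = kappa * (\<integral>t. ?Y y * (?W t * g y t) \<partial>lborel)" unfolding E by (simp only: mult_ac)
  qed
  also have "\<dots> = kappa * (\<integral>y. (\<integral>t. ?Y y * (?W t * g y t) \<partial>lborel) \<partial>lborel)"
    by (rule integral_mult_right_zero)
  also have "(\<integral>y. (\<integral>t. ?Y y * (?W t * g y t) \<partial>lborel) \<partial>lborel) = (\<integral>t. (\<integral>y. ?Y y * (?W t * g y t) \<partial>lborel) \<partial>lborel)"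
    using lborel_pair.Fubini_integral[OF int] by simp
  also have "\<dots> = (\<integral>t. ?W t * ((phase_cusp a b phi (R - s * sqrt t) + phase_cusp a b phi (R + s * sqrt t)) / 2) \<partial>lborel)"
  proof (rule Bochner_Integration.integral_cong[OF refl])
    fix t :: real
    have "?Y y * (?W t * g y t) = (?W t / 2) * (?Y y * cos ((R - s * sqrt t) * y + phi) + ?Y y * cos ((R + s * sqrt t) * y + phi))" for y
    proof -
      have arg: "R * y + phi - s * y * sqrt t = (R - s * sqrt t) * y + phi"
        "R * y + phi + s * y * sqrt t = (R + s * sqrt t) * y + phi" by (simp_all add: algebra_simps)
      have "Y * (W * ((p + q) / 2)) = (W / 2) * (Y * p + Y * q)" for Y W p q :: real
        by (simp add: field_simps)
      then show ?thesis unfolding g_def cos_times_cos arg .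
    qed
    then have "(\<integral>y. ?Y y * (?W t * g y t) \<partial>lborel) = (?W t / 2) * (\<integral>y. ?Y y * cos ((R - s * sqrt t) * y + phi) + ?Y y * cos ((R + s * sqrt t) * y + phi) \<partial>lborel)"
      by (simp only: integral_mult_right_zero)
    also have "\<dots> = ?W t * ((phase_cusp a b phi (R - s * sqrt t) + phase_cusp a b phi (R + s * sqrt t)) / 2)"
      unfolding phase_cusp_def
      by (subst Bochner_Integration.integral_add) (auto intro: integrable_phase_cusp[OF ab])
    finally show "(\<integral>y. ?Y y * (?W t * g y t) \<partial>lborel) = ?W t * ((phase_cusp a b phi (R - s * sqrt t) + phase_cusp a b phi (R + s * sqrt t)) / 2)" .
  qed
  finally show ?thesis .
qed

text \<open>For s <= R - A all arguments R - s sqrt t and R + s sqrt t are at least A, so the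
  integrand has a sign. For the size keep only 1 - t <= r = (R - s)/s: there R - s sqrt t <= 2 (R -
  s), and the Beta weight of this range is at least r^(nu + 1/2)/(nu + 1/2). The hypothesis R/2 < s
  ensures r < 1.\<close>

lemma transform_lower:
  assumes ab: "a > 0" "b > 0" and c: "c > 0" and A: "A > 0"
    and G: "\<And>w. w \<ge> A \<Longrightarrow> phase_cusp a b phi w \<ge> c * w powr (- a)"
  shows "0 < s \<Longrightarrow> s \<le> R - A \<Longrightarrow> transform a b phi R s \<ge> 0"
    and "R / 2 < s \<Longrightarrow> s \<le> R - A \<Longrightarrow> transform a b phi R s \<ge>
      kappa * c / 2 / (nu + 1/2) * 2 powr (- a) * (R - s) powr (nu + 1/2 - a) * R powr (- nu - 1/2)"
proof -
  let ?W = "beta_density (1/2) (nu + 1/2)"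
  let ?h = "\<lambda>t. ?W t * ((phase_cusp a b phi (R - s * sqrt t) + phase_cusp a b phi (R + s * sqrt t)) / 2)"
  have nu': "0 < nu + 1/2" using nu by auto
  have pos: "phase_cusp a b phi w \<ge> 0" if "w \<ge> A" for w
    by (rule order_trans[OF mult_nonneg_nonneg[OF less_imp_le[OF c] powr_ge_zero] G[OF that]])
  have arg: "R - s * sqrt t \<ge> A" "R + s * sqrt t \<ge> A" if "0 < s" "s \<le> R - A" "t \<in> {0..1}" for t
  proof -
    have "s * sqrt t \<le> s * 1" using that by (intro mult_left_mono) auto
    moreover have "0 \<le> s * sqrt t" using that by simp
    ultimately show "R - s * sqrt t \<ge> A" "R + s * sqrt t \<ge> A" using that(1,2) by linarith+
  qed
  have h_nonneg: "?h t \<ge> 0" if "0 < s" "s \<le> R - A" for t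
  proof (cases "t \<in> {0..1}")
    case True
    then show ?thesis using pos arg[OF that True] by (intro mult_nonneg_nonneg) auto
  qed (simp add: beta_density_def)
  show "transform a b phi R s \<ge> 0" if "0 < s" "s \<le> R - A"
    unfolding transform_eq[OF ab]
    by (rule mult_nonneg_nonneg[OF less_imp_le[OF kappa_pos] Bochner_Integration.integral_nonneg[OF h_nonneg[OF that]]])
  assume s: "R / 2 < s" "s \<le> R - A"
  define d where "d = R - s"
  have d: "d > 0" "d < s" "s > 0" "s < R" using s A by (auto simp: d_def)
  define D where "D = c * (2 * d) powr (- a) / 2"
  define r where "r = d / s"
  have r: "0 < r" "r < 1" using d by (auto simp: r_def)
  have "(\<integral>t. D * (indicator {1-r..1} t * (1 - t) powr (nu - 1/2)) \<partial>lborel) \<le> (\<integral>t. ?h t \<partial>lborel)"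
  proof (rule integral_mono')
    have "integrable lborel (\<lambda>t. ?W t *\<^sub>R ((phase_cusp a b phi (R - s * sqrt t) + phase_cusp a b phi (R + s * sqrt t)) / 2))"
    proof (rule integrable_beta_density_bounded[where B = "Beta a b"])
      fix t
      show "norm ((phase_cusp a b phi (R - s * sqrt t) + phase_cusp a b phi (R + s * sqrt t)) / 2) \<le> Beta a b"
        using phase_cusp_bounded[OF ab, of phi "R - s * sqrt t"] phase_cusp_bounded[OF ab, of phi "R + s * sqrt t"] by simp
    qed (use nu' in auto)
    then show "integrable lborel ?h" by simp
    show "0 \<le> ?h t" for t using h_nonneg d s by auto
    fix t :: real
    show "D * (indicator {1-r..1} t * (1 - t) powr (nu - 1/2)) \<le> ?h t"
    proof (cases "t \<in> {1-r..1}")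
      case True
      then have t: "0 < t" "t \<le> 1" using r by auto
      have "t \<le> sqrt t" using t by (simp add: real_le_rsqrt power2_eq_square mult_left_le)
      then have "s * t \<le> s * sqrt t" using d by (intro mult_left_mono) auto
      moreover have "s * (1 - t) \<le> s * r" using True d by (intro mult_left_mono) auto
      moreover have "s * r = d" using d by (simp add: r_def)
      ultimately have up: "R - s * sqrt t \<le> 2 * d" by (simp add: d_def algebra_simps)
      have lo: "R - s * sqrt t \<ge> A" "R + s * sqrt t \<ge> A" using arg[of t] t d s by auto
      have "(2 * d) powr (- a) \<le> (R - s * sqrt t) powr (- a)"
        using up lo A ab by (intro powr_mono2') auto
      then have "c * (2 * d) powr (- a) \<le> c * (R - s * sqrt t) powr (- a)" using c by (intro mult_left_mono) auto
      also have "\<dots> \<le> phase_cusp a b phi (R - s * sqrt t)" by (rule G[OF lo(1)])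
      finally have 1: "D \<le> (phase_cusp a b phi (R - s * sqrt t) + phase_cusp a b phi (R + s * sqrt t)) / 2"
        using pos[OF lo(2)] by (simp add: D_def)
      have "1 powr (-1/2) \<le> t powr (- 1/2)" using t by (intro powr_mono2') auto
      then have "1 * (1 - t) powr (nu - 1/2) \<le> t powr (-1/2) * (1 - t) powr (nu - 1/2)" by (intro mult_right_mono) auto
      then have 2: "(1 - t) powr (nu - 1/2) \<le> ?W t" using t by (simp add: beta_density_def algebra_simps)
      have "D * (1 - t) powr (nu - 1/2) \<le> ((phase_cusp a b phi (R - s * sqrt t) + phase_cusp a b phi (R + s * sqrt t)) / 2) * ?W t"
        using 1 2 pos[OF lo(1)] pos[OF lo(2)] by (intro mult_mono) auto
      then show ?thesis using True by (simp add: mult.commute)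
    next
      case False
      then have z: "indicator {1-r..1} t = (0::real)" by simp
      show ?thesis unfolding z using h_nonneg d s by simp
    qed
  qed
  also have "(\<integral>t. D * (indicator {1-r..1} t * (1 - t) powr (nu - 1/2)) \<partial>lborel) = D * (r powr (nu + 1/2) / (nu + 1/2))"
  proof -
    have "(\<integral>t. indicator {1-r..1} t * (1 - t) powr (nu - 1/2) \<partial>lborel) = (\<integral>u. indicator {0..r} u * u powr (nu - 1/2) \<partial>lborel)"
      by (subst lborel_integral_real_affine[where c = "-1" and t = 1])
         (auto intro!: Bochner_Integration.integral_cong simp: indicator_def)
    also have "\<dots> = r powr (nu + 1/2) / (nu + 1/2)"
      using integral_powr_Icc(2)[of "nu - 1/2" r] nu r by (simp add: add.commute)
    finally show ?thesis by (simp only: integral_mult_right_zero)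
  qed
  finally have "D * (r powr (nu + 1/2) / (nu + 1/2)) \<le> (\<integral>t. ?h t \<partial>lborel)" .
  then have "kappa * (D * (r powr (nu + 1/2) / (nu + 1/2))) \<le> transform a b phi R s"
    unfolding transform_eq[OF ab] using kappa_pos by (intro mult_left_mono) auto
  moreover have "(d / R) powr (nu + 1/2) \<le> r powr (nu + 1/2)"
    unfolding r_def using d nu' by (intro powr_mono2 divide_left_mono) auto
  then have "kappa * (D * ((d / R) powr (nu + 1/2) / (nu + 1/2))) \<le> kappa * (D * (r powr (nu + 1/2) / (nu + 1/2)))"
    using kappa_pos c nu' by (intro mult_left_mono divide_right_mono) (auto simp: D_def)
  moreover have "kappa * (D * ((d / R) powr (nu + 1/2) / (nu + 1/2))) =
    kappa * c / 2 / (nu + 1/2) * 2 powr (- a) * (R - s) powr (nu + 1/2 - a) * R powr (- nu - 1/2)"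
  proof -
    have "(2 * d) powr (- a) = 2 powr (- a) * d powr (- a)" using d by (simp add: powr_mult)
    moreover have "(d / R) powr (nu + 1/2) = d powr (nu + 1/2) * R powr (- nu - 1/2)"
    proof -
      have "- nu - 1/2 = - (nu + 1/2)" by simp
      then have "R powr (- nu - 1/2) = inverse (R powr (nu + 1/2))" by (simp only: powr_minus)
      moreover have "(d / R) powr (nu + 1/2) = d powr (nu + 1/2) / R powr (nu + 1/2)"
        by (rule powr_divide)
      ultimately show ?thesis by (simp only: divide_inverse)
    qed
    moreover have "d powr (nu + 1/2 - a) = d powr (- a) * d powr (nu + 1/2)"
      by (simp flip: powr_add)
    ultimately show ?thesis by (simp add: D_def flip: d_def)
  qed
  ultimately show "transform a b phi R s \<ge>
      kappa * c / 2 / (nu + 1/2) * 2 powr (- a) * (R - s) powr (nu + 1/2 - a) * R powr (- nu - 1/2)"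
    by linarith
qed

text \<open>Absolute values and the decay of J_nu; a > nu + 1/2 keeps the remaining power of y
  integrable. The bound ignores the oscillation, hence is uniform in R, and is applied only to the
  boundedly many zeros in (R - A, R).\<close>

lemma transform_upper:
  assumes b: "b > 0" and a: "a > nu + 1/2"
  shows "\<exists>C>0. \<forall>R. \<forall>s>0. \<bar>transform a b phi R s\<bar> \<le> C * s powr (- nu - 1/2)"
proof -
  obtain C where C: "C > 0" "\<And>x. x > 0 \<Longrightarrow> \<bar>bessel_entire nu (x\<^sup>2 / 4)\<bar> \<le> C * x powr (- nu - 1/2)"
    using bessel_entire_decay[OF bessel_entire_bounded] by blast
  define a' where "a' = a - nu - 1/2"
  have a': "a' > 0" using a by (simp add: a'_def)
  have "\<bar>transform a b phi R s\<bar> \<le> (C * (Beta a' b + 1)) * s powr (- nu - 1/2)" if s: "s > 0" for R s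
  proof -
    have "\<bar>transform a b phi R s\<bar> \<le> (\<integral>y. norm (beta_density a b y * (cos (R * y + phi) * bessel_entire nu ((s * y)\<^sup>2 / 4))) \<partial>lborel)"
      unfolding transform_def real_norm_def by (rule integral_abs_bound)
    also have "\<dots> \<le> (\<integral>y. C * s powr (- nu - 1/2) * beta_density a' b y \<partial>lborel)"
    proof (rule integral_mono')
      show "integrable lborel (\<lambda>y. C * s powr (- nu - 1/2) * beta_density a' b y)"
        using a' b by (intro integrable_mult_right integrable_beta_density)
      fix y :: real
      show "0 \<le> C * s powr (- nu - 1/2) * beta_density a' b y" using C by simp
      show "norm (beta_density a b y * (cos (R * y + phi) * bessel_entire nu ((s * y)\<^sup>2 / 4))) \<le> C * s powr (- nu - 1/2) * beta_density a' b y"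
      proof (cases "0 < y \<and> y \<le> 1")
        case True
        have "\<bar>cos (R * y + phi)\<bar> * \<bar>bessel_entire nu ((s * y)\<^sup>2 / 4)\<bar> \<le> 1 * (C * (s * y) powr (- nu - 1/2))"
          using True s by (intro mult_mono C(2)) auto
        then have "beta_density a b y * (\<bar>cos (R * y + phi)\<bar> * \<bar>bessel_entire nu ((s * y)\<^sup>2 / 4)\<bar>) \<le> beta_density a b y * (1 * (C * (s * y) powr (- nu - 1/2)))"
          by (intro mult_left_mono) auto
        also have "\<dots> = C * s powr (- nu - 1/2) * beta_density a' b y"
        proof -
          have "y powr (a' - 1) = y powr (a - 1) * y powr (- nu - 1/2)" by (simp add: a'_def flip: powr_add)
          then show ?thesis using True s by (simp add: beta_density_def powr_mult)
        qed
        finally show ?thesis by (simp add: abs_mult)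
      next
        case False
        then have "beta_density a b y = 0" by (cases "y = 0") (auto simp: beta_density_def indicator_def)
        then show ?thesis using C by simp
      qed
    qed
    also have "\<dots> = C * s powr (- nu - 1/2) * Beta a' b" using a' b by (simp add: integral_beta_density)
    also have "\<dots> \<le> C * s powr (- nu - 1/2) * (Beta a' b + 1)" using C by (intro mult_left_mono) auto
    finally show ?thesis by (simp add: mult_ac)
  qed
  moreover have "C * (Beta a' b + 1) > 0" using C Beta_nonneg[OF a' b] by (intro mult_pos_pos) auto
  ultimately show ?thesis by blast
qed

end

section \<open>The measure and the eigenfunctions\<close>

lemma mu_eq: "mu nu = density lborel (\<lambda>x. ennreal (indicator {0<..<1} x * x powr (2 * nu + 1)))"
  unfolding mu_def by (intro arg_cong[where f = "density lborel"] ext) (simp add: indicator_def)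

lemma space_mu [simp]: "space (mu nu) = UNIV" and sets_mu [simp, measurable_cong]: "sets (mu nu) = sets borel"
  by (simp_all add: mu_def)

lemma integral_mu:
  fixes g :: "real \<Rightarrow> real"
  assumes [measurable]: "g \<in> borel_measurable borel"
  shows "(\<integral>x. g x \<partial>mu nu) = (\<integral>x. indicator {0<..<1} x * x powr (2 * nu + 1) * g x \<partial>lborel)"
  unfolding mu_eq by (subst integral_density) auto

lemma integrable_mu_iff:
  fixes g :: "real \<Rightarrow> real"
  assumes [measurable]: "g \<in> borel_measurable borel"
  shows "integrable (mu nu) g \<longleftrightarrow> integrable lborel (\<lambda>x. indicator {0<..<1} x * x powr (2 * nu + 1) * g x)"
  unfolding mu_eq by (subst integrable_density) auto

context bessel
begin

lemma borel_measurable_besselJ [measurable]: "besselJ a \<in> borel_measurable borel"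
  unfolding besselJ_def[abs_def] by measurable

lemma borel_measurable_psi [measurable]: "psi nu j \<in> borel_measurable borel"
  unfolding psi_def[abs_def] by measurable

lemma borel_measurable_bochner_riesz [measurable]: "bochner_riesz nu delta R f \<in> borel_measurable borel"
  unfolding bochner_riesz_def[abs_def] by measurable

definition amp :: "nat \<Rightarrow> real" where
  "amp j = sqrt 2 / \<bar>besselJ (nu + 1) (sz j)\<bar> * (sz j / 2) powr nu"

lemma amp_sq: "(amp j)\<^sup>2 = weight j"
  using sz_pos[of j] by (simp add: amp_def weight_def power_mult_distrib power_divide powr_power mult.commute)

lemma psi_eq: "x > 0 \<Longrightarrow> psi nu j x = amp j * bessel_entire nu ((sz j * x)\<^sup>2 / 4)"
proof -
  assume x: "x > 0"
  have s: "sz j > 0" by (rule sz_pos)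
  have "besselJ nu (sz j * x) = (sz j * x / 2) powr nu * bessel_entire nu ((sz j * x)\<^sup>2 / 4)"
    using x s by (intro besselJ_eq_bessel_entire nu) auto
  moreover have "(sz j * x / 2) powr nu = (sz j / 2) powr nu * x powr nu"
    using x s powr_mult[of "sz j / 2" x nu] by simp
  moreover have "x powr (- nu) * x powr nu = 1" using x by (simp flip: powr_add)
  ultimately show ?thesis by (simp add: psi_def amp_def mult_ac)
qed

section \<open>The multiplier and the number of zeros in a window\<close>

definition multiplier :: "real \<Rightarrow> real \<Rightarrow> nat \<Rightarrow> real" where
  "multiplier delta R j = (max 0 (1 - (sz j)\<^sup>2 / R\<^sup>2)) powr delta"

lemma multiplier_eq_0:
  assumes "R > 0" "sz j \<ge> R"
  shows "multiplier delta R j = 0"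
proof -
  have "R\<^sup>2 \<le> (sz j)\<^sup>2" using assms by (intro power_mono) auto
  then have "1 - (sz j)\<^sup>2 / R\<^sup>2 \<le> 0" using assms by (simp add: field_simps)
  then have "max 0 (1 - (sz j)\<^sup>2 / R\<^sup>2) = 0" by (simp only: max_def if_True split: if_splits) auto
  then show ?thesis by (simp add: multiplier_def)
qed

lemma one_minus_ratio: "R > 0 \<Longrightarrow> 1 - s\<^sup>2 / R\<^sup>2 = (R - s) / R * ((R + s) / R)" for R s :: real
  by (simp add: field_simps power2_eq_square)

text \<open>The second factor of 1 - s^2/R^2 = ((R - s)/R) ((R + s)/R) lies between 1 and 2.\<close>

lemma multiplier_bounds:
  assumes R: "R > 0" and j: "sz j < R" and delta: "delta > 0"
  shows "((R - sz j) / R) powr delta \<le> multiplier delta R j" "multiplier delta R j \<le> 1"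
    "multiplier delta R j \<le> (2 * (R - sz j) / R) powr delta"
proof -
  have s: "sz j > 0" by (rule sz_pos)
  have q: "(R - sz j) / R > 0" "(R + sz j) / R \<ge> 1" "(R + sz j) / R \<le> 2"
    using R j s by (simp_all add: field_simps)
  define P where "P = 1 - (sz j)\<^sup>2 / R\<^sup>2"
  have P: "P = (R - sz j) / R * ((R + sz j) / R)" unfolding P_def by (rule one_minus_ratio[OF R])
  have "P \<ge> 0" unfolding P using q by (intro mult_nonneg_nonneg) auto
  then have eq: "multiplier delta R j = P powr delta" by (simp add: multiplier_def flip: P_def)
  have "(R - sz j) / R * 1 \<le> P" "P \<le> (R - sz j) / R * 2"
    unfolding P using q by (auto intro!: mult_left_mono simp del: times_divide_eq_left times_divide_eq_right)
  then have "(R - sz j) / R \<le> P" "P \<le> 2 * (R - sz j) / R" by (simp_all add: algebra_simps)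
  then show "((R - sz j) / R) powr delta \<le> multiplier delta R j"
    "multiplier delta R j \<le> (2 * (R - sz j) / R) powr delta"
    unfolding eq using q(1) delta \<open>P \<ge> 0\<close> by (auto intro!: powr_mono2)
  have "P \<le> 1" by (simp add: P_def)
  then show "multiplier delta R j \<le> 1"
    unfolding eq using \<open>P \<ge> 0\<close> delta by (intro powr_le1) auto
qed

text \<open>By the gap, the indices of zeros in a window of length L lie within L / d of the least
  one, in a block of ceiling (L / d) indices.\<close>

lemma card_zeros:
  assumes d: "d > 0" "\<And>i j. i \<le> j \<Longrightarrow> d * real (j - i) \<le> sz j - sz i" and L: "L \<ge> 0"
  shows "finite {j. u < sz j \<and> sz j < u + L}" "real (card {j. u < sz j \<and> sz j < u + L}) \<le> L / d + 1"
proof -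
  let ?J = "{j. u < sz j \<and> sz j < u + L}"
  have "\<exists>i. ?J \<subseteq> {i..<i + nat \<lceil>L / d\<rceil>}"
  proof (cases "?J = {}")
    case False
    then obtain k where k: "k \<in> ?J" by blast
    define i where "i = (LEAST k. k \<in> ?J)"
    have i: "i \<in> ?J" unfolding i_def by (rule LeastI[of _ k]) (rule k)
    have "j \<in> {i..<i + nat \<lceil>L / d\<rceil>}" if j: "j \<in> ?J" for j
    proof -
      have ij: "i \<le> j" unfolding i_def by (rule Least_le) (rule j)
      have "d * real (j - i) < L" using d(2)[OF ij] i j by auto
      then have "real (j - i) < L / d" using d(1) by (simp add: pos_less_divide_eq mult.commute)
      then have "j - i < nat \<lceil>L / d\<rceil>" by linarith
      then show ?thesis using ij by auto
    qed
    then show ?thesis by blast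
  qed auto
  then obtain i where i: "?J \<subseteq> {i..<i + nat \<lceil>L / d\<rceil>}" by blast
  then show "finite ?J" using finite_subset by blast
  have "card ?J \<le> card {i..<i + nat \<lceil>L / d\<rceil>}" by (rule card_mono[OF _ i]) simp
  then have "real (card ?J) \<le> real (nat \<lceil>L / d\<rceil>)" by simp
  also have "\<dots> \<le> L / d + 1" using L d(1) by (simp add: of_nat_nat)
  finally show "real (card ?J) \<le> L / d + 1" .
qed

lemma finite_zeros_below: "finite {j. sz j < R}"
proof -
  obtain d where "d > 0" "\<And>i j. i \<le> j \<Longrightarrow> d * real (j - i) \<le> sz j - sz i" using sz_gap by blast
  from card_zeros(1)[OF this, of "max 0 R" 0] have "finite {j. 0 < sz j \<and> sz j < 0 + max 0 R}" by simp
  moreover have "{j. sz j < R} \<subseteq> {j. 0 < sz j \<and> sz j < 0 + max 0 R}" using sz_pos by auto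
  ultimately show ?thesis using finite_subset by blast
qed

lemma bochner_riesz_finite:
  assumes "R > 0"
  shows "bochner_riesz nu delta R f x = (\<Sum>j | sz j < R. multiplier delta R j * coef nu f j * psi nu j x)"
  unfolding bochner_riesz_def multiplier_def[symmetric]
  by (rule suminf_finite[OF finite_zeros_below]) (simp add: multiplier_eq_0[OF assms])

section \<open>The test function and its coefficients\<close>

definition test_fun :: "real \<Rightarrow> real \<Rightarrow> real \<Rightarrow> real \<Rightarrow> real \<Rightarrow> real" where
  "test_fun delta b phi R y =
     indicator {1/R..<1} y * (y powr (delta - nu - 1/2) * (1 - y) powr (b - 1) * cos (R * y + phi))"

lemma borel_measurable_test_fun [measurable]: "test_fun delta b phi R \<in> borel_measurable borel"
  unfolding test_fun_def[abs_def] by measurable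

text \<open>Here \<open>e\<close> is the part of the integral over y < 1/R that the cut-off removes,
  at most a constant times the integral of y^(a - 1), that is R^(-a)/a. This is small enough: O(R)
  zeros with weight O(R^(2 nu + 1)) turn it into O(R^(nu + 1/2 - delta)).\<close>

lemma coef_test_fun:
  assumes delta: "delta > 0" and b: "b \<ge> 1" and R: "R > 1"
  defines "a \<equiv> delta + nu + 3/2"
  shows "\<exists>e. coef nu (test_fun delta b phi R) j = amp j * (transform a b phi R (sz j) - e) \<and>
    \<bar>e\<bar> \<le> kappa * Beta (1/2) (nu + 1/2) * R powr (- a)"
proof -
  define K where "K = kappa * Beta (1/2) (nu + 1/2)"
  have K: "K \<ge> 0" using bessel_entire_bounded[of 0] by (simp add: K_def order_trans[OF abs_ge_zero])
  have a: "a > 1" using delta nu by (simp add: a_def)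
  define h where "h y = cos (R * y + phi) * bessel_entire nu ((sz j * y)\<^sup>2 / 4)" for y
  have [measurable]: "h \<in> borel_measurable borel"
    unfolding h_def[abs_def] using borel_measurable_bessel_entire[OF nu, measurable] by measurable
  have h: "\<bar>h y\<bar> \<le> K" for y
  proof -
    have "\<bar>h y\<bar> \<le> 1 * K" unfolding h_def abs_mult K_def by (intro mult_mono bessel_entire_bounded) auto
    then show ?thesis by simp
  qed
  have int: "integrable lborel (\<lambda>y. beta_density a b y * h y)"
    unfolding h_def using a b by (intro integrable_transform) auto
  define e where "e = (\<integral>y. indicator {..<1/R} y * (beta_density a b y * h y) \<partial>lborel)"
  have int': "integrable lborel (\<lambda>y. indicator {..<1/R} y * (beta_density a b y * h y))"
    using integrable_mult_indicator[OF _ int, of "{..<1/R}"] by simp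
  have pt: "indicator {0<..<1} y * y powr (2 * nu + 1) * (test_fun delta b phi R y * psi nu j y)
     = amp j * (beta_density a b y * h y - indicator {..<1/R} y * (beta_density a b y * h y))" if y: "y \<noteq> 1" for y
  proof (cases "0 < y \<and> y < 1")
    case True
    have "y powr (2 * nu + 1) * y powr (delta - nu - 1/2) = y powr (a - 1)"
      by (simp add: a_def algebra_simps flip: powr_add)
    then show ?thesis
      using True psi_eq[of y j] by (auto simp: test_fun_def beta_density_def h_def indicator_def mult_ac)
  next
    case False
    have "beta_density a b y = 0"
      using False y by (cases "y = 0") (auto simp: beta_density_def indicator_def)
    then show ?thesis using False by (auto simp: indicator_def)
  qed
  have "coef nu (test_fun delta b phi R) j
     = (\<integral>y. indicator {0<..<1} y * y powr (2 * nu + 1) * (test_fun delta b phi R y * psi nu j y) \<partial>lborel)"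
    unfolding coef_def by (rule integral_mu) measurable
  also have "\<dots> = (\<integral>y. amp j * (beta_density a b y * h y - indicator {..<1/R} y * (beta_density a b y * h y)) \<partial>lborel)"
  proof (rule integral_cong_AE)
    show "AE y in lborel. indicator {0<..<1} y * y powr (2 * nu + 1) * (test_fun delta b phi R y * psi nu j y)
     = amp j * (beta_density a b y * h y - indicator {..<1/R} y * (beta_density a b y * h y))"
      using AE_lborel_singleton[of 1] by eventually_elim (rule pt)
  qed measurable
  also have "\<dots> = amp j * (transform a b phi R (sz j) - e)"
    unfolding integral_mult_right_zero using int int'
    by (simp add: e_def transform_def h_def)
  finally have 1: "coef nu (test_fun delta b phi R) j = amp j * (transform a b phi R (sz j) - e)" .
  have "\<bar>e\<bar> \<le> (\<integral>y. \<bar>indicator {..<1/R} y * (beta_density a b y * h y)\<bar> \<partial>lborel)"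
    unfolding e_def by (rule integral_abs_bound)
  also have "\<dots> \<le> (\<integral>y. K * (indicator {0..1/R} y * y powr (a - 1)) \<partial>lborel)"
  proof (rule integral_mono')
    show "integrable lborel (\<lambda>y. K * (indicator {0..1/R} y * y powr (a - 1)))"
      using a R by (intro integrable_mult_right integral_powr_Icc) auto
    fix y :: real
    show "0 \<le> K * (indicator {0..1/R} y * y powr (a - 1))" using K by simp
    show "\<bar>indicator {..<1/R} y * (beta_density a b y * h y)\<bar> \<le> K * (indicator {0..1/R} y * y powr (a - 1))"
    proof (cases "0 \<le> y \<and> y < 1/R")
      case True
      have "1/R < 1" using R by simp
      then have y: "0 \<le> 1 - y" "1 - y \<le> 1" using True by auto
      then have "(1 - y) powr (b - 1) \<le> 1" using b by (intro powr_le1) auto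
      then have "y powr (a - 1) * (1 - y) powr (b - 1) \<le> y powr (a - 1) * 1" by (intro mult_left_mono) auto
      then have "beta_density a b y \<le> y powr (a - 1)" using y True by (simp add: beta_density_def)
      then have "beta_density a b y * \<bar>h y\<bar> \<le> y powr (a - 1) * K" using h[of y] by (intro mult_mono) auto
      then show ?thesis using True by (simp add: abs_mult mult.commute)
    next
      case False
      then have z: "indicator {..<1/R} y * (beta_density a b y * h y) = 0"
        by (auto simp: beta_density_def indicator_def)
      show ?thesis unfolding z using K by simp
    qed
  qed
  also have "\<dots> = K * ((1/R) powr a / a)" using integral_powr_Icc(2)[of "a - 1" "1/R"] a R by simp
  also have "\<dots> \<le> K * ((1/R) powr a / 1)" using a K by (intro mult_left_mono divide_left_mono) auto
  also have "(1/R) powr a / 1 = R powr (- a)" using R by (simp add: powr_divide powr_minus_divide)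
  finally show ?thesis using 1 unfolding K_def by blast
qed

section \<open>Growth of the means of the test function\<close>

text \<open>Bookkeeping of one summand. The powers of R - s, delta from the multiplier and - delta -
  1 from the transform, combine to 1/(R - s); the powers of R are - delta, 2 nu + 1 and - nu - 1/2.
  The factor \<open>L\<close> is the eigenfunction near 0.\<close>

lemma main_term_lower:
  assumes delta: "delta > 0" and s: "R / 2 < s" "s < R"
    and m: "m \<ge> ((R - s) / R) powr delta" and w: "w \<ge> cw * s powr (2 * nu + 1)" and cw: "cw > 0"
    and T: "T \<ge> cT * (R - s) powr (- delta - 1) * R powr (- nu - 1/2)" and cT: "cT > 0"
    and L: "L \<ge> l" and l: "l > 0"
  shows "m * w * T * L \<ge> cw * 2 powr (- (2 * nu + 1)) * cT * l * R powr (nu + 1/2 - delta) / (R - s)"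
proof -
  define d where "d = R - s"
  have d: "d > 0" "R > 0" using s by (auto simp: d_def)
  have w': "w \<ge> cw * (R / 2) powr (2 * nu + 1)"
    by (rule order_trans[OF _ w]) (use s d cw nu in \<open>auto intro!: mult_left_mono powr_mono2\<close>)
  have "(d / R) powr delta * (cw * (R / 2) powr (2 * nu + 1)) * (cT * d powr (- delta - 1) * R powr (- nu - 1/2)) * l \<le> m * w * T * L"
    using m w' T L cw cT l unfolding d_def[symmetric]
    by (intro mult_mono) (auto intro!: mult_nonneg_nonneg order_trans[OF _ m] order_trans[OF _ w'] order_trans[OF _ T] simp: d_def)
  moreover have "(d / R) powr delta * (cw * (R / 2) powr (2 * nu + 1)) * (cT * d powr (- delta - 1) * R powr (- nu - 1/2)) * l
    = cw * 2 powr (- (2 * nu + 1)) * cT * l * R powr (nu + 1/2 - delta) / d"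
  proof -
    have 1: "(d / R) powr delta = d powr delta * R powr (- delta)"
      unfolding powr_divide powr_minus by (rule divide_inverse)
    have 2: "(R / 2) powr (2 * nu + 1) = R powr (2 * nu + 1) * 2 powr (- (2 * nu + 1))"
      unfolding powr_divide powr_minus by (rule divide_inverse)
    have 3: "d powr delta * d powr (- delta - 1) = inverse d"
      using d by (simp add: powr_minus flip: powr_add)
    have 4: "R powr (- delta) * R powr (2 * nu + 1) * R powr (- nu - 1/2) = R powr (nu + 1/2 - delta)"
      by (simp add: algebra_simps flip: powr_add)
    have "(d / R) powr delta * (cw * (R / 2) powr (2 * nu + 1)) * (cT * d powr (- delta - 1) * R powr (- nu - 1/2)) * l
       = cw * 2 powr (- (2 * nu + 1)) * cT * l * (R powr (- delta) * R powr (2 * nu + 1) * R powr (- nu - 1/2)) * (d powr delta * d powr (- delta - 1))"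
      unfolding 1 2 by (simp only: mult_ac)
    then show ?thesis unfolding 3 4 by (simp only: divide_inverse)
  qed
  ultimately show ?thesis by (simp add: d_def)
qed

text \<open>Since \<open>2 * pi < 7\<close>, each of the disjoint intervals \<open>[B - 7 * (k + 1), B - 7 * k)\<close> contains a zero.\<close>

lemma sum_over_zeros:
  assumes X: "\<And>x. x \<ge> X \<Longrightarrow> \<exists>y. x \<le> y \<and> y \<le> x + 2 * pi \<and> besselJ nu y = 0" "X > 0"
    and B: "B - 7 * real N \<ge> X" and A: "A > 0"
  shows "(\<Sum>j | B - 7 * real N \<le> sz j \<and> sz j \<le> B. 1 / (A + B - sz j)) \<ge> ln (real N + 1) / (A + 7)"
proof -
  have pi7: "2 * pi < 7" using pi_less_4 pi_approx by auto
  have "\<exists>j. B - 7 * real (Suc k) \<le> sz j \<and> sz j < B - 7 * real k" if k: "k < N" for k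
  proof -
    have XB: "X \<le> B - 7 * real (Suc k)"
      by (rule order_trans[OF B]) (use k in \<open>intro diff_left_mono mult_left_mono, auto\<close>)
    from X(1)[OF XB] obtain y where y: "B - 7 * real (Suc k) \<le> y" "y \<le> B - 7 * real (Suc k) + 2 * pi" "besselJ nu y = 0"
      by blast
    then have "y > 0" using XB X(2) by linarith
    then obtain j where "y = sz j" using sz_surj y by blast
    then show ?thesis using y pi7 by (intro exI[of _ j]) auto
  qed
  then obtain js where js: "\<And>k. k < N \<Longrightarrow> B - 7 * real (Suc k) \<le> sz (js k) \<and> sz (js k) < B - 7 * real k"
    by metis
  have inj: "inj_on js {..<N}"
  proof (rule linorder_inj_onI)
    fix k l assume kl: "k < l" "k \<in> {..<N}" "l \<in> {..<N}"
    then have "real (Suc k) \<le> real l" by simp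
    then have "sz (js l) < sz (js k)" using js[of k] js[of l] kl by auto
    then show "js k \<noteq> js l" by auto
  qed auto
  let ?J = "{j. B - 7 * real N \<le> sz j \<and> sz j \<le> B}"
  have fin: "finite ?J" by (rule finite_subset[OF _ finite_zeros_below[of "B + 1"]]) auto
  have sub: "js ` {..<N} \<subseteq> ?J"
  proof
    fix j assume "j \<in> js ` {..<N}"
    then obtain k where k: "k < N" "j = js k" by auto
    then have "real (Suc k) \<le> real N" by simp
    then show "j \<in> ?J" using js[OF k(1)] k by auto
  qed
  have "ln (real N + 1) / (A + 7) \<le> harm N / (A + 7)"
    using A ln_le_harm[of N] by (intro divide_right_mono) (auto simp: add.commute)
  also have "\<dots> = (\<Sum>k<N. inverse (real (Suc k)) / (A + 7))"
    unfolding harm_def sum_divide_distrib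
    by (rule sum.reindex_bij_witness[of _ Suc "\<lambda>k. k - 1"]) auto
  also have "\<dots> \<le> (\<Sum>k<N. 1 / (A + B - sz (js k)))"
  proof (rule sum_mono)
    fix k assume "k \<in> {..<N}"
    then have k: "k < N" by simp
    \<comment> \<open>In the k-th interval the denominator is at most A + 7 (k + 1) <= (A + 7) (k +
      1), which leaves a harmonic sum.\<close>
    have "A + B - sz (js k) \<le> A * 1 + 7 * real (Suc k)" using js[OF k] by auto
    also have "\<dots> \<le> A * real (Suc k) + 7 * real (Suc k)" using A by (intro add_right_mono mult_left_mono) auto
    finally have le: "A + B - sz (js k) \<le> (A + 7) * real (Suc k)" by (simp add: algebra_simps)
    have "B - 7 * real k \<le> B" by simp
    then have "0 < A + B - sz (js k)" using js[OF k] A by linarith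
    then have "1 / ((A + 7) * real (Suc k)) \<le> 1 / (A + B - sz (js k))"
      using le A by (intro divide_left_mono) auto
    then show "inverse (real (Suc k)) / (A + 7) \<le> 1 / (A + B - sz (js k))"
      by (simp add: divide_inverse mult.commute del: of_nat_Suc)
  qed
  also have "\<dots> = (\<Sum>j\<in>js ` {..<N}. 1 / (A + B - sz j))"
    using inj by (simp add: sum.reindex)
  also have "\<dots> \<le> (\<Sum>j\<in>?J. 1 / (A + B - sz j))"
    using fin sub A by (intro sum_mono2) auto
  finally show ?thesis .
qed

text \<open>On (0, c0/R) every eigenfunction of frequency below R is still comparable with its value
  at 0, so the signs of the coefficients decide. The clause c0 < R places this interval inside (0,
  1).\<close>

lemma bochner_riesz_test_lower:
  assumes delta: "delta > 0"
  shows "\<exists>b phi c c0 R0. b \<ge> 1 \<and> c > 0 \<and> c0 > 0 \<and> R0 > 1 \<and> (\<forall>R\<ge>R0. c0 < R \<and>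
    (\<forall>x. 0 < x \<and> x < c0 / R \<longrightarrow>
      bochner_riesz nu delta R (test_fun delta b phi R) x \<ge> c * R powr (nu + 1/2 - delta) * ln R))"
proof -
  define a where "a = delta + nu + 3/2"
  have a: "a > 0" "a > nu + 1/2" using delta nu by (auto simp: a_def)
  obtain b phi c A where b: "b \<ge> 1" and c: "c > 0" and A: "A > 0"
    and G: "\<And>w. w \<ge> A \<Longrightarrow> Re (cis phi * cusp a b w) \<ge> c * w powr (- a)"
    using cusp_phase[OF a(1)] by blast
  have b0: "b > 0" using b by simp
  have G': "phase_cusp a b phi w \<ge> c * w powr (- a)" if "w \<ge> A" for w
    unfolding phase_cusp_eq[OF a(1) b0] by (rule G[OF that])
  define cT where "cT = kappa * c / 2 / (nu + 1/2) * 2 powr (- a)"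
  have cT: "cT > 0" using kappa_pos c nu by (simp add: cT_def)
  have T1: "transform a b phi R s \<ge> 0" if "0 < s" "s \<le> R - A" for R s
    by (rule transform_lower(1)[OF a(1) b0 c A G' that])
  have T2: "transform a b phi R s \<ge> cT * (R - s) powr (- delta - 1) * R powr (- nu - 1/2)"
    if "R / 2 < s" "s \<le> R - A" for R s
  proof -
    have "nu + 1/2 - a = - delta - 1" by (simp add: a_def)
    then show ?thesis using transform_lower(2)[OF a(1) b0 c A G' that] unfolding cT_def by simp
  qed
  obtain CT where CT: "CT > 0" "\<And>R s. s > 0 \<Longrightarrow> \<bar>transform a b phi R s\<bar> \<le> CT * s powr (- nu - 1/2)"
    using transform_upper[OF b0 a(2), of phi] by blast
  obtain cw Cw where cw: "cw > 0" "Cw > 0" "\<And>j. cw * sz j powr (2 * nu + 1) \<le> weight j"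
    "\<And>j. weight j \<le> Cw * sz j powr (2 * nu + 1)"
    using weight_bounds by blast
  obtain d where d: "d > 0" "\<And>i j. i \<le> j \<Longrightarrow> d * real (j - i) \<le> sz j - sz i" using sz_gap by blast
  obtain X where X: "X > 0" "\<And>x. x \<ge> X \<Longrightarrow> \<exists>y. x \<le> y \<and> y \<le> x + 2 * pi \<and> besselJ nu y = 0"
    using exists_zero_large by blast
  define l where "l = 1 / (2 * Gamma (nu + 1))"
  have l: "l > 0" using nu by (simp add: l_def Gamma_real_pos)
  obtain e0 where e0: "e0 > 0" "\<And>z. 0 \<le> z \<Longrightarrow> z \<le> e0 \<Longrightarrow> bessel_entire nu z \<ge> l"
    using bessel_entire_near_0 unfolding l_def by blast
  define K where "K = kappa * Beta (1/2) (nu + 1/2)"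
  have K: "\<bar>bessel_entire nu z\<bar> \<le> K" if "z \<ge> 0" for z unfolding K_def by (rule bessel_entire_bounded[OF that])
  have K0: "K \<ge> 0" using K[of 0] by simp
  define E where "E = nu + 1/2 - delta"
  define cM where "cM = cw * 2 powr (- (2 * nu + 1)) * cT * l"
  have cM: "cM > 0" using cw cT l by (simp add: cM_def)
  \<comment> \<open>\<open>D1\<close> bounds the cut-off error of one zero, relative to R^(2 nu + 1
    - a); \<open>D2\<close> bounds a zero in (R - A, R), relative to R^E. \<open>DD\<close> weighs
    them with the numbers of such zeros, at most (1/d + 1) R and A/d + 1.\<close>
  define D1 where "D1 = Cw * K * K"
  define D2 where "D2 = (2 * A) powr delta * Cw * (CT * 2 powr (nu + 1/2)) * K"
  have D: "D1 \<ge> 0" "D2 \<ge> 0" using K0 cw CT by (auto simp: D1_def D2_def)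
  define c1 where "c1 = cM / (A + 7) / 2"
  define DD where "DD = (A / d + 1) * D2 + (1 / d + 1) * D1"
  have c1: "c1 > 0" using cM A by (simp add: c1_def)
  \<comment> \<open>Then s < R and x < c0/R give (s x)^2/4 <= e0, the range of
    \<open>bessel_entire_near_0\<close>.\<close>
  define c0 where "c0 = 2 * sqrt e0"
  have c0: "c0 > 0" using e0 by (simp add: c0_def)
  \<comment> \<open>784 = 28^2 gives ln(R/28) >= (ln R)/2; 4 A + 1 keeps the window of main terms
    above R/2, and 2 X + 1 keeps it above X; the exponential makes the total error at most half of
    the main sum.\<close>
  define R0 where "R0 = Max {784, 4 * A + 1, 2 * X + 1, c0 + 1, exp (2 * DD / c1)}"
  have R0: "784 \<le> R0" "4 * A + 1 \<le> R0" "2 * X + 1 \<le> R0" "c0 + 1 \<le> R0" "exp (2 * DD / c1) \<le> R0"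
    unfolding R0_def by (intro Max_ge; simp)+
  have "bochner_riesz nu delta R (test_fun delta b phi R) x \<ge> c1 / 2 * R powr E * ln R"
    if R: "R \<ge> R0" and x: "0 < x" "x < c0 / R" for R x
  proof -
    have RR: "R \<ge> 784" "R \<ge> 4 * A + 1" "R \<ge> 2 * X + 1" "R \<ge> exp (2 * DD / c1)" "R > 0" "R > 1"
      using R R0 by auto
    define J where "J = {j. sz j < R}"
    have fin: "finite J" unfolding J_def by (rule finite_zeros_below)
    define T where "T j = transform a b phi R (sz j)" for j
    define L where "L j = bessel_entire nu ((sz j * x)\<^sup>2 / 4)" for j
    define m where "m j = multiplier delta R j" for j
    have "\<forall>j. \<exists>e. coef nu (test_fun delta b phi R) j = amp j * (T j - e) \<and> \<bar>e\<bar> \<le> K * R powr (- a)"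
      using coef_test_fun[OF delta b RR(6), of phi] unfolding T_def K_def a_def by blast
    then obtain e where e: "\<And>j. coef nu (test_fun delta b phi R) j = amp j * (T j - e j)" "\<And>j. \<bar>e j\<bar> \<le> K * R powr (- a)"
      by metis
    have L: "l \<le> L j" "L j \<le> K" "L j > 0" if "j \<in> J" for j
    proof -
      have "sz j * x \<le> R * (c0 / R)" using that x RR sz_pos[of j] by (intro mult_mono) (auto simp: J_def)
      then have "sz j * x \<le> c0" using RR by simp
      then have "(sz j * x)\<^sup>2 \<le> c0\<^sup>2" using x sz_pos[of j] by (intro power_mono) auto
      then have "(sz j * x)\<^sup>2 / 4 \<le> e0" using e0(1) by (simp add: c0_def power_mult_distrib)
      then show "l \<le> L j" unfolding L_def by (intro e0(2)) auto
      then show "L j > 0" using l by simp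
      show "L j \<le> K" unfolding L_def using K[of "(sz j * x)\<^sup>2 / 4"] by simp
    qed
    have term_eq: "m j * coef nu (test_fun delta b phi R) j * psi nu j x = m j * weight j * T j * L j - m j * weight j * e j * L j" for j
      unfolding e(1) psi_eq[OF x(1)] L_def[symmetric] amp_sq[symmetric]
      by (simp add: power2_eq_square algebra_simps)
    have m: "0 \<le> m j" "m j \<le> 1" "m j \<ge> ((R - sz j) / R) powr delta" "m j \<le> (2 * (R - sz j) / R) powr delta" if "j \<in> J" for j
      using multiplier_bounds[OF RR(5) _ delta, of j] that unfolding m_def J_def by (auto simp: multiplier_def)
    have w: "0 \<le> weight j" "weight j \<le> Cw * R powr (2 * nu + 1)" if "j \<in> J" for j
    proof -
      show "0 \<le> weight j" using amp_sq[of j] by (metis zero_le_power2)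
      have "sz j powr (2 * nu + 1) \<le> R powr (2 * nu + 1)"
        using that sz_pos[of j] nu by (intro powr_mono2) (auto simp: J_def)
      then have "Cw * sz j powr (2 * nu + 1) \<le> Cw * R powr (2 * nu + 1)" using cw by (intro mult_left_mono) auto
      then show "weight j \<le> Cw * R powr (2 * nu + 1)" using cw(4)[of j] by linarith
    qed
    have err: "m j * weight j * e j * L j \<le> D1 * R powr (2 * nu + 1 - a)" if j: "j \<in> J" for j
    proof -
      have "m j * weight j * e j * L j \<le> m j * weight j * \<bar>e j\<bar> * L j"
        using m(1)[OF j] w(1)[OF j] L(3)[OF j] by (intro mult_right_mono mult_left_mono) auto
      also have "\<dots> \<le> 1 * (Cw * R powr (2 * nu + 1)) * (K * R powr (- a)) * K"
        using m(1,2)[OF j] w[OF j] L[OF j] e(2)[of j] cw K0 by (intro mult_mono) auto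
      also have "\<dots> = D1 * (R powr (2 * nu + 1) * R powr (- a))" by (simp add: D1_def mult_ac)
      also have "R powr (2 * nu + 1) * R powr (- a) = R powr (2 * nu + 1 - a)" by (simp flip: powr_add)
      finally show ?thesis .
    qed
    \<comment> \<open>For s <= R/2 only the sign is used, so \<open>main\<close> is 0 there.
      \<open>bad\<close> collects the zeros in (R - A, R), where G is sampled below A and no sign is
      known.\<close>
    define main where "main j = (if R / 2 < sz j \<and> sz j \<le> R - A then cM * R powr E * (1 / (R - sz j)) else 0)" for j
    define bad where "bad j = (if R - A < sz j then D2 * R powr E else 0)" for j
    have mt: "m j * weight j * T j * L j \<ge> main j - bad j" if j: "j \<in> J" for j
    proof -
      consider "sz j \<le> R - A" "R / 2 < sz j" | "sz j \<le> R - A" "sz j \<le> R / 2" | "R - A < sz j" by linarith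
      then show ?thesis
      proof cases
        case 1
        have "m j * weight j * T j * L j \<ge> cw * 2 powr (- (2 * nu + 1)) * cT * l * R powr (nu + 1/2 - delta) / (R - sz j)"
          using 1 A m(3)[OF j] cw cT l L(1)[OF j] T2 unfolding T_def
          by (intro main_term_lower[OF delta]) auto
        then show ?thesis using 1 by (simp add: main_def bad_def cM_def E_def)
      next
        case 2
        have "0 \<le> m j * weight j * T j * L j"
          using m(1)[OF j] w(1)[OF j] L(3)[OF j] T1[of "sz j" R] 2 sz_pos[of j]
          by (intro mult_nonneg_nonneg) (auto simp: T_def)
        then show ?thesis using 2 by (simp add: main_def bad_def)
      next
        \<comment> \<open>Close to the edge the multiplier is O(R^(-delta)), which together with the
          crude bound on the transform gives O(R^E) for each of these boundedly many zeros, without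
          a factor ln R.\<close>
        case 3
        have "m j \<le> (2 * (R - sz j) / R) powr delta" by (rule m(4)[OF j])
        also have "\<dots> \<le> (2 * A / R) powr delta"
          using 3 RR j delta by (intro powr_mono2 divide_right_mono) (auto simp: J_def)
        also have "\<dots> = (2 * A) powr delta * R powr (- delta)"
          unfolding powr_divide powr_minus by (rule divide_inverse)
        finally have m': "m j \<le> (2 * A) powr delta * R powr (- delta)" .
        have "\<bar>T j\<bar> \<le> CT * sz j powr (- nu - 1/2)" unfolding T_def by (rule CT(2)[OF sz_pos])
        also have "\<dots> \<le> CT * (R / 2) powr (- nu - 1/2)"
          using 3 RR CT nu by (intro mult_left_mono powr_mono2') auto
        also have "(R / 2) powr (- nu - 1/2) = R powr (- nu - 1/2) * 2 powr (- (- nu - 1/2))"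
          unfolding powr_divide powr_minus by (rule divide_inverse)
        finally have T': "\<bar>T j\<bar> \<le> CT * 2 powr (nu + 1/2) * R powr (- nu - 1/2)" by (simp add: mult_ac add.commute)
        have "m j * weight j * (- T j) * L j \<le> m j * weight j * \<bar>T j\<bar> * L j"
          using m(1)[OF j] w(1)[OF j] L(3)[OF j] by (intro mult_right_mono mult_left_mono) auto
        also have "\<dots> \<le> ((2 * A) powr delta * R powr (- delta)) * (Cw * R powr (2 * nu + 1)) * (CT * 2 powr (nu + 1/2) * R powr (- nu - 1/2)) * K"
          using m(1)[OF j] m' w[OF j] T' L[OF j] cw CT by (intro mult_mono) auto
        also have "\<dots> = D2 * (R powr (- delta) * R powr (2 * nu + 1) * R powr (- nu - 1/2))"
          by (simp only: D2_def mult_ac)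
        also have "R powr (- delta) * R powr (2 * nu + 1) * R powr (- nu - 1/2) = R powr E"
          by (simp add: E_def algebra_simps flip: powr_add)
        finally show ?thesis using 3 by (simp add: main_def bad_def)
      qed
    qed
    have "(\<Sum>j\<in>J. main j - bad j - D1 * R powr (2 * nu + 1 - a)) \<le> bochner_riesz nu delta R (test_fun delta b phi R) x"
      unfolding bochner_riesz_finite[OF RR(5)] J_def[symmetric] m_def[symmetric] term_eq
      by (intro sum_mono diff_mono mt err)
    moreover have "(\<Sum>j\<in>J. main j - bad j - D1 * R powr (2 * nu + 1 - a)) = (\<Sum>j\<in>J. main j) - (\<Sum>j\<in>J. bad j) - real (card J) * (D1 * R powr (2 * nu + 1 - a))"
      by (simp add: sum_subtractf)
    moreover have "real (card J) * (D1 * R powr (2 * nu + 1 - a)) \<le> (1 / d + 1) * D1 * R powr E"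
    proof -
      have "J = {j. 0 < sz j \<and> sz j < 0 + R}" using sz_pos by (auto simp: J_def)
      then have "real (card J) \<le> R / d + 1" using card_zeros(2)[OF d, of R 0] RR by simp
      also have "\<dots> \<le> (1 / d + 1) * R" using RR by (simp add: algebra_simps)
      finally have "real (card J) * (D1 * R powr (2 * nu + 1 - a)) \<le> (1 / d + 1) * R * (D1 * R powr (2 * nu + 1 - a))"
        using D by (intro mult_right_mono) auto
      also have "\<dots> = (1 / d + 1) * D1 * (R * R powr (2 * nu + 1 - a))" by (simp only: mult_ac)
      also have "R * R powr (2 * nu + 1 - a) = R powr E"
        using RR powr_mult_base[of R "2 * nu + 1 - a"] by (simp add: E_def a_def algebra_simps)
      finally show ?thesis .
    qed
    moreover have "(\<Sum>j\<in>J. bad j) \<le> (A / d + 1) * D2 * R powr E"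
    proof -
      have "(\<Sum>j\<in>J. bad j) = (\<Sum>j\<in>{j \<in> J. R - A < sz j}. D2 * R powr E)"
        unfolding bad_def using fin by (simp add: sum.inter_filter[symmetric])
      also have "\<dots> = real (card {j \<in> J. R - A < sz j}) * (D2 * R powr E)" by simp
      also have "{j \<in> J. R - A < sz j} = {j. R - A < sz j \<and> sz j < R - A + A}" by (auto simp: J_def)
      also have "real (card \<dots>) * (D2 * R powr E) \<le> (A / d + 1) * (D2 * R powr E)"
        using card_zeros(2)[OF d, of A "R - A"] A D by (intro mult_right_mono) auto
      finally show ?thesis by (simp add: mult_ac)
    qed
    moreover have "c1 * ln R * R powr E \<le> (\<Sum>j\<in>J. main j)"
    proof -
      \<comment> \<open>28 = 4 * 7: the N intervals of length 7 below R - A cover at most R/4, and A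
        < R/4, so they stay above R/2.\<close>
      define N where "N = nat \<lfloor>R / 28\<rfloor>"
      have N: "real N \<le> R / 28" "R / 28 \<le> real N + 1" using RR unfolding N_def by linarith+
      have B: "R - A - 7 * real N > R / 2" using N RR by linarith
      have "ln R / 2 \<le> ln (R / 28)"
      proof -
        have "ln 784 \<le> ln R" using RR by simp
        moreover have "ln (784::real) = 2 * ln 28" using ln_realpow[of "28::real" 2] by simp
        ultimately show ?thesis using RR by (simp add: ln_div)
      qed
      also have "\<dots> \<le> ln (real N + 1)" using N RR by simp
      finally have "ln R / 2 / (A + 7) \<le> ln (real N + 1) / (A + 7)" using A by (intro divide_right_mono) auto
      also have "\<dots> \<le> (\<Sum>j | R - A - 7 * real N \<le> sz j \<and> sz j \<le> R - A. 1 / (A + (R - A) - sz j))"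
        using B RR X by (intro sum_over_zeros[OF X(2) X(1) _ A]) auto
      finally have "ln R / 2 / (A + 7) \<le> (\<Sum>j | R - A - 7 * real N \<le> sz j \<and> sz j \<le> R - A. 1 / (R - sz j))"
        by simp
      then have "cM * R powr E * (ln R / 2 / (A + 7)) \<le> cM * R powr E * (\<Sum>j | R - A - 7 * real N \<le> sz j \<and> sz j \<le> R - A. 1 / (R - sz j))"
        using cM by (intro mult_left_mono) auto
      also have "\<dots> = (\<Sum>j | R - A - 7 * real N \<le> sz j \<and> sz j \<le> R - A. main j)"
        unfolding sum_distrib_left by (rule sum.cong) (use B in \<open>auto simp: main_def\<close>)
      also have "\<dots> \<le> (\<Sum>j\<in>J. main j)"
        using fin cM A by (intro sum_mono2) (auto simp: J_def main_def)
      finally show ?thesis by (simp add: c1_def mult_ac)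
    qed
    ultimately have low: "c1 * ln R * R powr E - (A / d + 1) * D2 * R powr E - (1 / d + 1) * D1 * R powr E
       \<le> bochner_riesz nu delta R (test_fun delta b phi R) x" by linarith
    have "ln (exp (2 * DD / c1)) \<le> ln R" using RR(4,5) by (subst ln_le_cancel_iff) auto
    then have "2 * DD / c1 \<le> ln R" by simp
    then have "DD \<le> c1 / 2 * ln R" using c1 by (simp add: field_simps)
    then have "DD * R powr E \<le> c1 / 2 * ln R * R powr E" by (intro mult_right_mono) auto
    moreover have "c1 * ln R * R powr E - DD * R powr E \<le> bochner_riesz nu delta R (test_fun delta b phi R) x"
      using low unfolding DD_def by (simp add: algebra_simps)
    moreover have "c1 / 2 * R powr E * ln R = c1 / 2 * ln R * R powr E"
      "c1 * ln R * R powr E = 2 * (c1 / 2 * ln R * R powr E)" by simp_all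
    ultimately show ?thesis by linarith
  qed
  then show ?thesis using b c1 c0 R0 unfolding E_def
    by (intro exI[of _ b] exI[of _ phi] exI[of _ "c1 / 2"] exI[of _ c0] exI[of _ R0]) auto
qed

section \<open>From the test function to the operator norms\<close>

lemma integrable_mu_weight:
  "integrable lborel (\<lambda>x. indicator {0<..<1} x * x powr (2 * nu + 1))"
proof (rule Bochner_Integration.integrable_bound)
  show "integrable lborel (\<lambda>x. indicator {0..1} x * x powr (2 * nu + 1))"
    using nu by (intro integral_powr_Icc) auto
qed (auto simp: indicator_def)

lemma finite_measure_mu: "finite_measure (mu nu)"
proof (rule finite_measureI)
  have "integrable (mu nu) (indicator UNIV :: real \<Rightarrow> real)"
    by (subst integrable_mu_iff) (use integrable_mu_weight in auto)
  then have "emeasure (mu nu) (UNIV \<inter> space (mu nu)) < \<infinity>"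
    by (simp only: integrable_indicator_iff)
  then show "emeasure (mu nu) (space (mu nu)) \<noteq> \<infinity>" by simp
qed

lemma measure_mu_Ioo:
  assumes "0 < r" "r \<le> 1"
  shows "measure (mu nu) {0<..<r} = r powr (2 * nu + 2) / (2 * nu + 2)"
proof -
  have "measure (mu nu) {0<..<r} = (\<integral>x. indicator {0<..<r} x \<partial>mu nu)" by simp
  also have "\<dots> = (\<integral>x. indicator {0<..<1} x * x powr (2 * nu + 1) * indicator {0<..<r} x \<partial>lborel)"
    by (rule integral_mu) measurable
  also have "\<dots> = (\<integral>x. indicator {0..r} x * x powr (2 * nu + 1) \<partial>lborel)"
  proof (rule integral_cong_AE)
    show "AE x in lborel. indicator {0<..<1} x * x powr (2 * nu + 1) * indicator {0<..<r} x = indicator {0..r} x * x powr (2 * nu + 1)"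
      using AE_lborel_singleton[of r] AE_lborel_singleton[of 0]
      by eventually_elim (use assms in \<open>auto simp: indicator_def\<close>)
  qed measurable
  also have "\<dots> = r powr (2 * nu + 2) / (2 * nu + 2)"
    using integral_powr_Icc(2)[of "2 * nu + 1" r] nu assms by (simp add: add.assoc)
  finally show ?thesis .
qed

lemma bochner_riesz_divide:
  "R > 0 \<Longrightarrow> bochner_riesz nu delta R (\<lambda>y. f y / n) x = bochner_riesz nu delta R f x / n"
  by (simp add: bochner_riesz_finite coef_def sum_divide_distrib)

text \<open>Through this lemma the lower bound for the means already shows that the test function is
  not null, so it can be normalised without estimating its norm from below.\<close>

lemma bochner_riesz_AE_0:
  assumes "R > 0" "AE y in mu nu. f y = 0"
  shows "bochner_riesz nu delta R f x = 0"
proof -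
  have "coef nu f j = 0" for j
    unfolding coef_def by (rule integral_eq_zero_AE) (use assms(2) in eventually_elim, simp)
  then show ?thesis by (simp add: bochner_riesz_finite[OF assms(1)])
qed

lemma abs_test_fun_le:
  assumes b: "b \<ge> 1" and R: "R > 0"
  shows "\<bar>test_fun delta b phi R y\<bar> \<le> indicator {1/R..<1} y * y powr (delta - nu - 1/2)"
proof (cases "1/R \<le> y \<and> y < 1")
  case True
  have "0 < 1/R" using R by simp
  then have y: "0 \<le> 1 - y" "1 - y \<le> 1" using True by linarith+
  then have "(1 - y) powr (b - 1) \<le> 1" using b by (intro powr_le1) auto
  then have "y powr (delta - nu - 1/2) * (1 - y) powr (b - 1) * \<bar>cos (R * y + phi)\<bar> \<le> y powr (delta - nu - 1/2) * 1 * 1"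
    by (intro mult_mono mult_left_mono) auto
  then show ?thesis using True by (simp add: test_fun_def abs_mult mult.assoc)
qed (simp add: test_fun_def)

text \<open>Here \<open>p\<close> is p1 with numerator and denominator halved. The exponent delta -
  nu - 1/2 times \<open>p\<close> is - (2 nu + 2), so against the density y^(2 nu + 1) the integrand
  is at most 1/y on [1/R, 1].\<close>

lemma test_fun_Lp:
  assumes E: "delta < nu + 1/2" and b: "b \<ge> 1" and R: "R > 1"
  defines "p \<equiv> 2 * (nu + 1) / (nu + 1/2 - delta)"
  shows "integrable (mu nu) (\<lambda>x. \<bar>test_fun delta b phi R x\<bar> powr p)"
    and "(\<integral>x. \<bar>test_fun delta b phi R x\<bar> powr p \<partial>mu nu) \<le> ln R"
proof -
  let ?g = "\<lambda>y. indicator {0<..<1} y * y powr (2 * nu + 1) * \<bar>test_fun delta b phi R y\<bar> powr p"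
  have p: "p > 0" using E nu by (simp add: p_def)
  have le: "?g y \<le> inverse y * indicator {1/R..1} y" for y
  proof (cases "1/R \<le> y \<and> y < 1")
    case True
    have "0 < 1/R" using R by simp
    then have y: "0 < y" using True by linarith
    have "\<bar>test_fun delta b phi R y\<bar> powr p \<le> (y powr (delta - nu - 1/2)) powr p"
      using abs_test_fun_le[OF b, of R delta phi y] R True p by (intro powr_mono2) auto
    also have "(y powr (delta - nu - 1/2)) powr p = y powr (- (2 * nu + 2))"
    proof -
      have "(delta - nu - 1/2) * p = - (2 * nu + 2)" using E by (simp add: p_def field_simps)
      then show ?thesis by (simp add: powr_powr)
    qed
    finally have "y powr (2 * nu + 1) * \<bar>test_fun delta b phi R y\<bar> powr p \<le> y powr (2 * nu + 1) * y powr (- (2 * nu + 2))"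
      by (intro mult_left_mono) auto
    also have "\<dots> = inverse y" using y by (simp add: powr_minus flip: powr_add)
    finally show ?thesis using True y by simp
  next
    case False
    then have "test_fun delta b phi R y = 0" by (simp add: test_fun_def)
    moreover have "0 \<le> inverse y * indicator {1/R..1} y" using R by (auto simp: indicator_def intro: order_trans[of 0 "1/R"])
    ultimately show ?thesis by simp
  qed
  have H: "has_bochner_integral lborel (\<lambda>y. inverse y * indicator {1/R..1} y) (ln 1 - ln (1/R))"
  proof (rule has_bochner_integral_FTC_Icc_nonneg[where F = ln])
    show "(\<lambda>y. inverse y :: real) \<in> borel_measurable borel" by measurable
    have pos: "y > 0" if "1/R \<le> y" for y using R that by (smt (verit) zero_less_divide_1_iff)
    show "(ln has_real_derivative inverse y) (at y)" if "y \<in> {1/R..1}" for y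
      using pos[of y] that by (intro DERIV_ln) auto
    show "0 \<le> inverse y" if "y \<in> {1/R..1}" for y using pos[of y] that by simp
    show "1/R \<le> 1" using R by simp
  qed
  have [measurable]: "(\<lambda>x. \<bar>test_fun delta b phi R x\<bar> powr p) \<in> borel_measurable borel" by measurable
  have int: "integrable lborel ?g"
  proof (rule Bochner_Integration.integrable_bound)
    show "integrable lborel (\<lambda>y. inverse y * indicator {1/R..1} y)" using H by (rule integrable.intros)
    show "AE y in lborel. norm (?g y) \<le> norm (inverse y * indicator {1/R..1} y)"
      using le by (auto intro!: AE_I2 order_trans[OF _ abs_ge_self])
  qed measurable
  then show "integrable (mu nu) (\<lambda>x. \<bar>test_fun delta b phi R x\<bar> powr p)"
    by (subst integrable_mu_iff) auto
  have "(\<integral>x. \<bar>test_fun delta b phi R x\<bar> powr p \<partial>mu nu) = (\<integral>y. ?g y \<partial>lborel)"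
    by (rule integral_mu) measurable
  also have "\<dots> \<le> (\<integral>y. inverse y * indicator {1/R..1} y \<partial>lborel)"
    using int H le by (intro integral_mono) (auto simp: has_bochner_integral_iff)
  also have "\<dots> = ln 1 - ln (1/R)" using H by (rule has_bochner_integral_integral_eq)
  finally show "(\<integral>x. \<bar>test_fun delta b phi R x\<bar> powr p \<partial>mu nu) \<le> ln R" using R by (simp add: ln_div)
qed

text \<open>The weak norm uses strict superlevel sets, so the level v / 2 is tested instead of
  v.\<close>

lemma weak_norm_lower:
  assumes p: "p > 0" and r: "0 < r" "r \<le> 1" and v: "v > 0"
    and g: "g \<in> borel_measurable borel" "\<And>x. 0 < x \<Longrightarrow> x < r \<Longrightarrow> v \<le> g x"
  shows "weak_Lq_norm (mu nu) p g \<ge> ereal (v / 2 * (r powr (2 * nu + 2) / (2 * nu + 2)) powr (1 / p))"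
proof -
  interpret finite_measure "mu nu" by (rule finite_measure_mu)
  have "r powr (2 * nu + 2) / (2 * nu + 2) = measure (mu nu) {0<..<r}" by (rule measure_mu_Ioo[OF r, symmetric])
  also have "\<dots> \<le> measure (mu nu) {x \<in> space (mu nu). \<bar>g x\<bar> > v / 2}"
  proof (rule finite_measure_mono)
    show "{0<..<r} \<subseteq> {x \<in> space (mu nu). \<bar>g x\<bar> > v / 2}"
      using g(2) v by (force simp: abs_if)
    have [measurable]: "g \<in> borel_measurable (mu nu)" using g(1) by simp
    show "{x \<in> space (mu nu). \<bar>g x\<bar> > v / 2} \<in> sets (mu nu)" by measurable
  qed
  finally have "(r powr (2 * nu + 2) / (2 * nu + 2)) powr (1 / p) \<le> measure (mu nu) {x \<in> space (mu nu). \<bar>g x\<bar> > v / 2} powr (1 / p)"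
    using p nu by (intro powr_mono2) auto
  then have "v / 2 * (r powr (2 * nu + 2) / (2 * nu + 2)) powr (1 / p) \<le> v / 2 * measure (mu nu) {x \<in> space (mu nu). \<bar>g x\<bar> > v / 2} powr (1 / p)"
    using v by (intro mult_left_mono) auto
  moreover have "ereal (v / 2 * measure (mu nu) {x \<in> space (mu nu). \<bar>g x\<bar> > v / 2} powr (1 / p)) \<le> weak_Lq_norm (mu nu) p g"
    unfolding weak_Lq_norm_def using v by (intro SUP_upper) auto
  ultimately show ?thesis by (meson ereal_less_eq(3) order_trans)
qed

lemma sup_norm_lower:
  assumes r: "0 < r" "r \<le> 1" and g: "g \<in> borel_measurable borel" "\<And>x. 0 < x \<Longrightarrow> x < r \<Longrightarrow> v \<le> g x"
  shows "Linf_norm (mu nu) g \<ge> ereal v"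
proof (rule ccontr)
  assume "\<not> ?thesis"
  then have less: "Linf_norm (mu nu) g < ereal v" by simp
  have "AE x in mu nu. ereal \<bar>g x\<bar> \<le> Linf_norm (mu nu) g"
    unfolding Linf_norm_def by (rule esssup_AE)
  then have "AE x in mu nu. x \<notin> {0<..<r}"
  proof eventually_elim
    fix x assume le: "ereal \<bar>g x\<bar> \<le> Linf_norm (mu nu) g"
    then have "ereal \<bar>g x\<bar> < ereal v" using less by (rule le_less_trans)
    then show "x \<notin> {0<..<r}" using g(2)[of x] by (auto simp: abs_if split: if_splits)
  qed
  then have "emeasure (mu nu) {0<..<r} = 0" by (subst (asm) AE_iff_measurable[of "{0<..<r}"]) auto
  then have "measure (mu nu) {0<..<r} = 0" by (simp add: measure_def)
  then show False using measure_mu_Ioo[OF r] r nu by simp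
qed

end

section \<open>Normalising the test function in the two cases\<close>

theorem theorem6:
  fixes nu delta :: real
  assumes "nu > -1/2" and "delta > 0"
  defines "p0 \<equiv> 4 * (nu + 1) / (2 * nu + 3 + 2 * delta)"
      and "p1 \<equiv> 4 * (nu + 1) / (2 * nu + 1 - 2 * delta)"
  shows "(delta < nu + 1/2 \<longrightarrow>
           (\<exists>C>0. \<forall>\<^sub>F R in at_top.
              (SUP f\<in>{f. f \<in> borel_measurable (mu nu) \<and>
                         integrable (mu nu) (\<lambda>x. \<bar>f x\<bar> powr p1) \<and>
                         Lp_norm (mu nu) p1 f = 1}.
                 weak_Lq_norm (mu nu) p1 (bochner_riesz nu delta R f))
              \<ge> ereal (C * ln R powr (1 / p0))))
       \<and> (delta = nu + 1/2 \<longrightarrow>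
           (\<exists>C>0. \<forall>\<^sub>F R in at_top.
              (SUP f\<in>{f. f \<in> borel_measurable (mu nu) \<and> Linf_norm (mu nu) f = 1}.
                 Linf_norm (mu nu) (bochner_riesz nu delta R f))
              \<ge> ereal (C * ln R)))"
proof -
  interpret bessel nu by unfold_locales (rule assms(1))
  obtain b phi c c0 R0 where b: "b \<ge> 1" and c: "c > 0" "c0 > 0" "R0 > 1" and
    lower: "\<And>R. R \<ge> R0 \<Longrightarrow> c0 < R" "\<And>R x. R \<ge> R0 \<Longrightarrow> 0 < x \<Longrightarrow> x < c0 / R \<Longrightarrow>
      c * R powr (nu + 1/2 - delta) * ln R \<le> bochner_riesz nu delta R (test_fun delta b phi R) x"
    using bochner_riesz_test_lower[OF assms(2)] by blast
  \<comment> \<open>A null function has vanishing means, which contradicts the lower bound at a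
    point of (0, c0/R).\<close>
  have not_null: "\<not> (AE y in mu nu. test_fun delta b phi R y = 0)" if R: "R \<ge> R0" for R
  proof
    assume AE: "AE y in mu nu. test_fun delta b phi R y = 0"
    have "0 < c0 / R" using R c by auto
    moreover have "0 < r / 2 \<and> r / 2 < r" if "0 < r" for r :: real using that by simp
    ultimately have x: "0 < c0 / R / 2" "c0 / R / 2 < c0 / R" by blast+
    have "bochner_riesz nu delta R (test_fun delta b phi R) (c0 / R / 2) = 0"
      using R c AE by (intro bochner_riesz_AE_0) auto
    moreover have "c * R powr (nu + 1/2 - delta) * ln R > 0" using R c by (intro mult_pos_pos) auto
    ultimately show False using lower(2)[OF R, of "c0 / R / 2"] x by linarith
  qed
  show ?thesis
  proof (intro conjI impI)
    assume less: "delta < nu + 1/2"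
    define E where "E = nu + 1/2 - delta"
    have E: "E > 0" using less by (simp add: E_def)
    have p1: "p1 = 2 * (nu + 1) / E"
      unfolding p1_def E_def using less by (simp add: field_simps)
    have p: "p1 > 0" using E assms(1) by (simp add: p1)
    \<comment> \<open>The exponents are dual: dividing ln R by the norm, at most (ln R)^(1/p1),
      leaves (ln R)^(1/p0).\<close>
    have p0: "1 / p0 = 1 - 1 / p1"
      using E assms(1) unfolding p0_def p1 by (simp add: E_def field_simps)
    \<comment> \<open>As (2 nu + 2)/p1 = E, the measure of (0, c0/R) to the power 1/p1 is V *
      R^(-E), which cancels the growth R^E of the means.\<close>
    define V where "V = (c0 powr (2 * nu + 2) / (2 * nu + 2)) powr (1 / p1)"
    have V: "V > 0" using c assms(1) by (simp add: V_def)
    have "ereal (c / 2 * V * ln R powr (1 / p0)) \<le> (SUP f\<in>{f. f \<in> borel_measurable (mu nu) \<and>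
             integrable (mu nu) (\<lambda>x. \<bar>f x\<bar> powr p1) \<and> Lp_norm (mu nu) p1 f = 1}.
             weak_Lq_norm (mu nu) p1 (bochner_riesz nu delta R f))" if R: "R \<ge> R0" for R
    proof -
      let ?f = "test_fun delta b phi R"
      have R1: "R > 1" using R c by simp
      have lnR: "ln R > 0" using R1 by simp
      define N where "N = (\<integral>x. \<bar>?f x\<bar> powr p1 \<partial>mu nu)"
      have int: "integrable (mu nu) (\<lambda>x. \<bar>?f x\<bar> powr p1)" and N_le: "N \<le> ln R"
        unfolding N_def p1 E_def using test_fun_Lp[OF less b R1] by auto
      have "N \<noteq> 0"
      proof
        assume "N = 0"
        then have "AE x in mu nu. \<bar>?f x\<bar> powr p1 = 0"
          unfolding N_def using int by (subst (asm) integral_nonneg_eq_0_iff_AE) auto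
        then show False using not_null[OF R] by simp
      qed
      moreover have "N \<ge> 0" by (simp add: N_def)
      ultimately have N: "N > 0" by simp
      define n where "n = N powr (1 / p1)"
      have n: "n > 0" using N by (simp add: n_def)
      have n_p: "n powr p1 = N" using N p by (simp add: n_def powr_powr)
      define g where "g x = ?f x / n" for x
      have g_p: "\<bar>g x\<bar> powr p1 = \<bar>?f x\<bar> powr p1 / N" for x
        using n by (simp add: g_def powr_divide n_p)
      have g: "g \<in> {f. f \<in> borel_measurable (mu nu) \<and>
             integrable (mu nu) (\<lambda>x. \<bar>f x\<bar> powr p1) \<and> Lp_norm (mu nu) p1 f = 1}"
      proof -
        have "g \<in> borel_measurable (mu nu)" unfolding g_def[abs_def] by measurable
        moreover have "integrable (mu nu) (\<lambda>x. \<bar>g x\<bar> powr p1)" unfolding g_p using int by simp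
        moreover have "Lp_norm (mu nu) p1 g = 1" unfolding Lp_norm_def g_p using N by (simp flip: N_def)
        ultimately show ?thesis by blast
      qed
      define v where "v = c * R powr E * ln R / n"
      have "ereal (v / 2 * ((c0 / R) powr (2 * nu + 2) / (2 * nu + 2)) powr (1 / p1)) \<le> weak_Lq_norm (mu nu) p1 (bochner_riesz nu delta R g)"
      proof (rule weak_norm_lower[OF p])
        show "0 < c0 / R" "c0 / R \<le> 1" using c R1 lower(1)[OF R] by auto
        show "v > 0" using c R1 n by (simp add: v_def mult_ac)
        show "v \<le> bochner_riesz nu delta R g x" if "0 < x" "x < c0 / R" for x
          using lower(2)[OF R that] R1 n
          unfolding g_def v_def by (simp add: bochner_riesz_divide E_def divide_right_mono)
      qed measurable
      moreover have "((c0 / R) powr (2 * nu + 2) / (2 * nu + 2)) powr (1 / p1) = V * R powr (- E)"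
      proof -
        have e1: "(c0 / R) powr (2 * nu + 2) / (2 * nu + 2) = c0 powr (2 * nu + 2) / (2 * nu + 2) * R powr (- (2 * nu + 2))"
          unfolding powr_divide powr_minus by (simp add: divide_inverse)
        have e2: "- (2 * nu + 2) * (1 / p1) = - E" using E assms(1) by (simp add: p1 field_simps)
        show ?thesis unfolding e1 powr_mult powr_powr e2 V_def ..
      qed
      moreover have "c / 2 * V * ln R powr (1 / p0) \<le> v / 2 * (V * R powr (- E))"
      proof -
        have "n \<le> ln R powr (1 / p1)" unfolding n_def using N N_le p by (intro powr_mono2) auto
        then have "ln R / ln R powr (1 / p1) \<le> ln R / n" using n lnR by (intro divide_left_mono) auto
        moreover have "ln R powr (1 / p0) = ln R / ln R powr (1 / p1)" unfolding p0 powr_diff using lnR by simp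
        ultimately have "c / 2 * V * ln R powr (1 / p0) \<le> c / 2 * V * (ln R / n)" using c V by (intro mult_left_mono) auto
        also have "\<dots> = c / 2 * V * (ln R / n) * (R powr E * R powr (- E))" using R1 by (simp flip: powr_add)
        also have "\<dots> = v / 2 * (V * R powr (- E))" by (simp add: v_def mult_ac)
        finally show ?thesis .
      qed
      ultimately have "ereal (c / 2 * V * ln R powr (1 / p0)) \<le> weak_Lq_norm (mu nu) p1 (bochner_riesz nu delta R g)"
        by (metis ereal_less_eq(3) order_trans)
      then show ?thesis by (rule SUP_upper2[OF g])
    qed
    then have "\<forall>\<^sub>F R in at_top. ereal (c / 2 * V * ln R powr (1 / p0)) \<le> (SUP f\<in>{f. f \<in> borel_measurable (mu nu) \<and>
             integrable (mu nu) (\<lambda>x. \<bar>f x\<bar> powr p1) \<and> Lp_norm (mu nu) p1 f = 1}.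
             weak_Lq_norm (mu nu) p1 (bochner_riesz nu delta R f))"
      by (rule eventually_mono[OF eventually_ge_at_top])
    then show "\<exists>C>0. \<forall>\<^sub>F R in at_top. (SUP f\<in>{f. f \<in> borel_measurable (mu nu) \<and>
             integrable (mu nu) (\<lambda>x. \<bar>f x\<bar> powr p1) \<and> Lp_norm (mu nu) p1 f = 1}.
             weak_Lq_norm (mu nu) p1 (bochner_riesz nu delta R f)) \<ge> ereal (C * ln R powr (1 / p0))"
      using c V by (intro exI[of _ "c / 2 * V"]) auto
  next
    assume eq: "delta = nu + 1/2"
    have "ereal (c * ln R) \<le> (SUP f\<in>{f. f \<in> borel_measurable (mu nu) \<and> Linf_norm (mu nu) f = 1}.
        Linf_norm (mu nu) (bochner_riesz nu delta R f))" if R: "R \<ge> R0" for R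
    proof -
      let ?f = "test_fun delta b phi R"
      have R1: "R > 1" using R c by simp
      have meas: "(\<lambda>x. ereal \<bar>?f x\<bar>) \<in> borel_measurable (mu nu)" by measurable
      have "\<bar>?f x\<bar> \<le> 1" for x
      proof -
        \<comment> \<open>In the endpoint case the exponent delta - nu - 1/2 is 0, so the power of x
          is 1 on the support.\<close>
        have "\<bar>?f x\<bar> \<le> indicator {1/R..<1} x * x powr (delta - nu - 1/2)"
          using abs_test_fun_le[OF b] R1 by simp
        also have "\<dots> \<le> 1" by (auto simp: eq indicator_def)
        finally show ?thesis .
      qed
      then have le1: "Linf_norm (mu nu) ?f \<le> 1"
        unfolding Linf_norm_def by (intro esssup_I meas) (auto intro!: AE_I2)
      have pos: "Linf_norm (mu nu) ?f > 0"
      proof (rule ccontr)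
        assume "\<not> ?thesis"
        then have n0: "Linf_norm (mu nu) ?f \<le> 0" by simp
        have "AE x in mu nu. ereal \<bar>?f x\<bar> \<le> Linf_norm (mu nu) ?f"
          unfolding Linf_norm_def by (rule esssup_AE)
        then have "AE x in mu nu. ?f x = 0"
        proof eventually_elim
          fix x assume "ereal \<bar>?f x\<bar> \<le> Linf_norm (mu nu) ?f"
          then have "ereal \<bar>?f x\<bar> \<le> 0" using n0 by (rule order_trans)
          then show "?f x = 0" by simp
        qed
        then show False using not_null[OF R] by blast
      qed
      \<comment> \<open>Since the norm n is at most 1, dividing by it can only increase the positive
        lower bound.\<close>
      obtain n where n: "Linf_norm (mu nu) ?f = ereal n" "0 < n" "n \<le> 1"
        using le1 pos by (cases "Linf_norm (mu nu) ?f") auto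
      define g where "g x = ?f x / n" for x
      have "Linf_norm (mu nu) g = esssup (mu nu) (\<lambda>x. ereal (1 / n) * ereal \<bar>?f x\<bar>)"
        unfolding Linf_norm_def g_def using n by (simp add: abs_divide)
      also have "\<dots> = ereal (1 / n) * Linf_norm (mu nu) ?f"
        unfolding Linf_norm_def using n by (intro esssup_cmult) auto
      also have "\<dots> = 1" using n by (simp add: one_ereal_def)
      finally have g: "g \<in> {f. f \<in> borel_measurable (mu nu) \<and> Linf_norm (mu nu) f = 1}"
        unfolding g_def[abs_def] by simp
      have "ereal (c * ln R) \<le> Linf_norm (mu nu) (bochner_riesz nu delta R g)"
      proof (rule sup_norm_lower)
        show "0 < c0 / R" "c0 / R \<le> 1" using c R1 lower(1)[OF R] by auto
        show "c * ln R \<le> bochner_riesz nu delta R g x" if x: "0 < x" "x < c0 / R" for x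
        proof -
          have "c * ln R \<le> c * ln R / n" using n c R1 by (simp add: pos_le_divide_eq mult_left_le)
          also have "\<dots> \<le> bochner_riesz nu delta R ?f x / n"
            using lower(2)[OF R x] n R1 by (intro divide_right_mono) (auto simp: eq)
          finally show ?thesis using R1 unfolding g_def[abs_def] by (simp add: bochner_riesz_divide)
        qed
      qed measurable
      then show ?thesis by (rule SUP_upper2[OF g])
    qed
    then have "\<forall>\<^sub>F R in at_top. ereal (c * ln R) \<le> (SUP f\<in>{f. f \<in> borel_measurable (mu nu) \<and> Linf_norm (mu nu) f = 1}.
        Linf_norm (mu nu) (bochner_riesz nu delta R f))"
      by (rule eventually_mono[OF eventually_ge_at_top])
    then show "\<exists>C>0. \<forall>\<^sub>F R in at_top. (SUP f\<in>{f. f \<in> borel_measurable (mu nu) \<and> Linf_norm (mu nu) f = 1}.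
        Linf_norm (mu nu) (bochner_riesz nu delta R f)) \<ge> ereal (C * ln R)"
      using c by (intro exI[of _ c]) auto
  qed
qed

end
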